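(* Let $a,b\in\mathbb{R}$ and $1\leq p,r<\infty$ be given. Then $W_{\{a,b\}}^{1,(\infty,p)}(\mathbb{R}_*^N)\hookrightarrow L^r(\mathbb{R}^N)$ if and only if $a>0$ and one of the following conditions holds: (i) $1\leq r<p$ and (i-1) $a<\frac{N}{r}$ and $b>Np\left(\frac1N+\frac1r-\frac1p\right)$, or (i-2) $a>\frac{N}{r}$ and $b<Np\left(\frac1N+\frac1r-\frac1p\right)$. (ii) $p\leq r\leq p^*$ and (ii-1) $a<\frac{N}{r}$ and $b\geq Np\left(\frac1N+\frac1r-\frac1p\right)$, or (ii-2) $a>\frac{N}{r}$ and $b\leq Np\left(\frac1N+\frac1r-\frac1p\right)$, or (ii-3) $a=\frac{N}{r}$ and $b=Np\left(\frac1N+\frac1r-\frac1p\right)$. (iii) $p<N$, $r>p^*$ and (iii-1) $a<\frac{N}{r}$ and $b\geq arp\left(\frac1N+\frac1r-\frac1p\right)$, or (iii-2) $a>\frac{N}{r}$ and $b\leq arp\left(\frac1N+\frac1r-\frac1p\right)$, or (iii-3) $a=\frac{N}{r}$ and $b=arp\left(\frac1N+\frac1r-\frac1p\right)=Np\left(\frac1N+\frac1r-\frac1p\right)$.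
   Context: $N\geq 1$ is an integer and $\mathbb{R}_*^N:=\mathbb{R}^N\setminus\{0\}$. For $d\in\mathbb{R}$ and $1\leq s<\infty$, $L^s(\mathbb{R}^N;|x|^d dx)$ is the space of Lebesgue measurable functions $u$ such that $|x|^{d/s}u\in L^s(\mathbb{R}^N)$, with norm $\|u\|_{d,s}:=\|\,|x|^{d/s}u\|_s$. For $a,b\in\mathbb{R}$ and $1\leq p<\infty$, $$W_{\{a,b\}}^{1,(\infty,p)}(\mathbb{R}_*^N):=\{u\in L^1_{loc}(\mathbb{R}_*^N): |x|^a u\in L^\infty(\mathbb{R}^N),\ \nabla u\in (L^p(\mathbb{R}^N;|x|^b dx))^N\},$$ with norm $\|\,|x|^a u\|_\infty+\|\nabla u\|_{b,p}$, where $\nabla u$ is the distributional gradient on $\mathbb{R}_*^N$. The symbol $\hookrightarrow$ denotes continuous embedding. $p^*:=\infty$ if $p\geq N$ and $p^*:=\frac{Np}{N-p}$ if $1\leq p<N$. *)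

theory Defs
  imports "HOL-Analysis.Analysis" "HOL-Probability.Essential_Supremum"
begin

text \<open>
  \<open>\<real>\<^sup>N\<close> is an arbitrary type \<open>'a :: euclidean_space\<close> with \<open>N = DIM('a)\<close>.
  Function spaces are sets of representatives \<open>'a \<Rightarrow> 'b\<close>: functions are not quotiented by equality
  almost everywhere, but every membership condition and every norm below is invariant under it.
  In particular the values at the origin (where \<open>0 powr d = 0\<close>) are irrelevant.  With \<open>'b = 'a\<close>,
  the spaces of vector fields are \<open>(L\<^sup>s)\<^sup>N\<close>, normed by the \<open>L\<^sup>s\<close>-norm of the Euclidean length.
\<close>

subsection \<open>Lebesgue spaces\<close>

definition Lp_space :: "real \<Rightarrow> ('a::euclidean_space \<Rightarrow> 'b::euclidean_space) set" where
  "Lp_space s = {f. f \<in> borel_measurable lebesgue \<and> integrable lebesgue (\<lambda>x. norm (f x) powr s)}"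

definition Lp_norm :: "real \<Rightarrow> ('a::euclidean_space \<Rightarrow> 'b::euclidean_space) \<Rightarrow> real" where
  "Lp_norm s f = (integral\<^sup>L lebesgue (\<lambda>x. norm (f x) powr s)) powr (1 / s)"

definition Linf_space :: "('a::euclidean_space \<Rightarrow> 'b::euclidean_space) set" where
  "Linf_space = {f. f \<in> borel_measurable lebesgue \<and> esssup lebesgue (\<lambda>x. ereal (norm (f x))) < \<infinity>}"

definition Linf_norm :: "('a::euclidean_space \<Rightarrow> 'b::euclidean_space) \<Rightarrow> real" where
  "Linf_norm f = real_of_ereal (esssup lebesgue (\<lambda>x. ereal (norm (f x))))"

text \<open>\<open>L\<^sup>s(\<real>\<^sup>N; |x|\<^sup>d dx)\<close> with norm \<open>\<parallel>|x|\<^bsup>d/s\<^esup> u\<parallel>\<^sub>s\<close>.\<close>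

definition weighted_Lp_space ::
    "real \<Rightarrow> real \<Rightarrow> ('a::euclidean_space \<Rightarrow> 'b::euclidean_space) set" where
  "weighted_Lp_space d s =
     {u. u \<in> borel_measurable lebesgue \<and> (\<lambda>x. norm x powr (d / s) *\<^sub>R u x) \<in> Lp_space s}"

definition weighted_Lp_norm ::
    "real \<Rightarrow> real \<Rightarrow> ('a::euclidean_space \<Rightarrow> 'b::euclidean_space) \<Rightarrow> real" where
  "weighted_Lp_norm d s u = Lp_norm s (\<lambda>x. norm x powr (d / s) *\<^sub>R u x)"

definition L1_loc :: "'a::euclidean_space set \<Rightarrow> ('a \<Rightarrow> 'b::euclidean_space) set" where
  "L1_loc \<Omega> = {u. \<forall>K. compact K \<and> K \<subseteq> \<Omega> \<longrightarrow> set_integrable lebesgue K u}"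

subsection \<open>Distributional gradient\<close>

text \<open>
  \<open>smooth_order k f\<close>: all iterated directional derivatives of \<open>f\<close> of order less than \<open>k\<close> are
  (Frechet) differentiable everywhere and those of order \<open>k\<close> are continuous, i.e. \<open>f \<in> C\<^sup>k(\<real>\<^sup>N)\<close>.
\<close>

primrec smooth_order :: "nat \<Rightarrow> ('a::euclidean_space \<Rightarrow> real) \<Rightarrow> bool" where
  "smooth_order 0 f \<longleftrightarrow> continuous_on UNIV f"
| "smooth_order (Suc k) f \<longleftrightarrow>
     (\<forall>x. f differentiable (at x)) \<and> (\<forall>v. smooth_order k (\<lambda>x. frechet_derivative f (at x) v))"

text \<open>\<open>C\<^sub>c\<^sup>\<infinity>(\<Omega>)\<close>, the functions being extended by \<open>0\<close> outside \<open>\<Omega>\<close>.\<close>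

definition test_functions :: "'a::euclidean_space set \<Rightarrow> ('a \<Rightarrow> real) set" where
  "test_functions \<Omega> =
     {\<phi>. (\<forall>k. smooth_order k \<phi>) \<and> compact (closure {x. \<phi> x \<noteq> 0}) \<and> closure {x. \<phi> x \<noteq> 0} \<subseteq> \<Omega>}"

text \<open>The locally integrable vector field \<open>G\<close> represents the distributional gradient of \<open>u\<close> on \<open>\<Omega>\<close>.\<close>

definition has_distributional_gradient ::
    "'a::euclidean_space set \<Rightarrow> ('a \<Rightarrow> real) \<Rightarrow> ('a \<Rightarrow> 'a) \<Rightarrow> bool" where
  "has_distributional_gradient \<Omega> u G \<longleftrightarrow>
     u \<in> L1_loc \<Omega> \<and> G \<in> L1_loc \<Omega> \<and>
     (\<forall>\<phi>\<in>test_functions \<Omega>. \<forall>i\<in>Basis.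
        integral\<^sup>L lebesgue (\<lambda>x. u x * frechet_derivative \<phi> (at x) i) =
        - integral\<^sup>L lebesgue (\<lambda>x. (G x \<bullet> i) * \<phi> x))"

text \<open>
  The gradient is determined only almost everywhere on \<open>\<Omega>\<close>, so it is chosen among its
  representatives; for \<open>\<Omega> = \<real>\<^sup>N - {0}\<close> its weighted norm does not depend on the choice.
\<close>

definition distributional_gradient ::
    "'a::euclidean_space set \<Rightarrow> ('a \<Rightarrow> real) \<Rightarrow> 'a \<Rightarrow> 'a" where
  "distributional_gradient \<Omega> u = (SOME G. has_distributional_gradient \<Omega> u G)"

subsection \<open>The space \<open>W\<^bsub>{a,b}\<^esub>\<^bsup>1,(\<infinity>,p)\<^esup>(\<real>\<^sup>N - {0})\<close>\<close>

definition W_space :: "real \<Rightarrow> real \<Rightarrow> real \<Rightarrow> ('a::euclidean_space \<Rightarrow> real) set" where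
  "W_space a b p =
     {u. u \<in> L1_loc (- {0}) \<and> (\<lambda>x. norm x powr a * u x) \<in> Linf_space \<and>
         (\<exists>G. has_distributional_gradient (- {0}) u G \<and> G \<in> weighted_Lp_space b p)}"

definition W_norm :: "real \<Rightarrow> real \<Rightarrow> real \<Rightarrow> ('a::euclidean_space \<Rightarrow> real) \<Rightarrow> real" where
  "W_norm a b p u =
     Linf_norm (\<lambda>x. norm x powr a * u x) +
     weighted_Lp_norm b p (distributional_gradient (- {0}) u)"

subsection \<open>Continuous embedding, critical exponent\<close>

definition continuously_embedded ::
    "'f set \<Rightarrow> ('f \<Rightarrow> real) \<Rightarrow> 'f set \<Rightarrow> ('f \<Rightarrow> real) \<Rightarrow> bool" where
  "continuously_embedded X normX Y normY \<longleftrightarrow>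
     X \<subseteq> Y \<and> (\<exists>C. \<forall>u\<in>X. normY u \<le> C * normX u)"

definition sobolev_exponent :: "nat \<Rightarrow> real \<Rightarrow> ereal" where
  "sobolev_exponent N p =
     (if p \<ge> real N then \<infinity> else ereal (real N * p / (real N - p)))"

end

theory Submission
  imports Defs
begin

text \<open>
  Sufficiency. By scaling it suffices to bound \<open>\<integral> |u|\<^sup>r\<close> for \<open>|x|\<^sup>a |u| \<le> 1\<close> and
  \<open>\<integral> |x|\<^sup>b |\<nabla>u|\<^sup>p \<le> 1\<close>, and mollification reduces this to \<open>C\<^sup>1\<close> functions. On one side of the unit
  sphere the bound \<open>|u| \<le> |x|\<^bsup>-a\<^esup>\<close> is enough. On the other side, integrating along rays which
  move away from the origin gives the weak type estimate
  \<open>|{|u| \<ge> 1}|\<^bsup>1/q\<^esup> \<le> C \<integral> |x|\<^sup>\<beta> |\<nabla>u|\<close> with \<open>\<beta> = 1 - N (1 - 1/q)\<close>, \<open>0 \<le> \<beta>\<close>. Applied to smooth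
  dyadic truncations of \<open>u\<close> it becomes the strong estimate
  \<open>\<integral> |u|\<^sup>r \<le> C (\<integral> |x|\<^sup>\<beta> |u|\<^bsup>r/q - 1\<^esup> |\<nabla>u|)\<^sup>q\<close>. Hoelder's inequality and, where needed, the pointwise
  bound for \<open>u\<close> estimate the right-hand side by a power less than \<open>1\<close> of \<open>\<integral> |u|\<^sup>r\<close>, which is
  absorbed; a truncation of \<open>u\<close> ensures that this integral is finite. The exponent \<open>q\<close>
  depends on the case: \<open>q = 1\<close> for \<open>r < p\<close>, \<open>q = r / (1 + r (1 - 1/p))\<close> for \<open>p \<le> r \<le> p\<^sup>*\<close> and
  \<open>q = N / (N - 1)\<close> for \<open>r > p\<^sup>*\<close>.

  Necessity. A function equal to \<open>1\<close> near infinity excludes \<open>a \<le> 0\<close>. The other conditions result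
  from sums of bumps in the shells \<open>|x| \<sim> 2\<^sup>j\<close> or \<open>|x| \<sim> 2\<^bsup>-j\<^esup>\<close>, either of width comparable to
  \<open>|x|\<close> and height \<open>|x|\<^bsup>-N/r\<^esup> j\<^bsup>-1/r\<^esup>\<close>, or of height \<open>|x|\<^bsup>-a\<^esup>\<close> and width \<open>|x|\<^bsup>a r/N\<^esup>\<close>, up to constants.
\<close>

subsection \<open>Mollifiers\<close>

text \<open>The exponents come from power counting. Hoelder's inequality splits |x|^\<beta>
  |u|^(r/q-1) |grad u| into |x|^(b/p) |grad u| and a remainder to be controlled by |u|^(r(1-1/p)).
  Equality of the powers of |u| forces q = r/(1+r(1-1/p)), and \<beta> = b/p is then the critical b.
  This q is at least 1 iff p <= r, and \<beta> >= 0 iff r is at most the Sobolev exponent. Beyond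
  it, the largest admissible q = N/(N-1) leaves a surplus power r(1/p-1/N)-1 > 0 of |u|, which the
  bound |u| <= C|x|^(-a) turns into a power of |x|; so a enters the critical exponent. For r < p the
  choice q = 1 leaves a gap filled by an integrable power of |x|, hence the strict inequalities. In
  all cases q(1-1/p) < 1, which makes the absorption possible.

  The obstacle is the origin: mollification works only away from a small ball around it. Rays moving
  outwards never enter that ball, so no constant depends on its radius.\<close>

definition exp_tail :: "nat \<Rightarrow> real \<Rightarrow> real" where
  "exp_tail n t = (if t > 0 then exp (- inverse t) * inverse t ^ n else 0)"

lemma exp_tail_tendsto_0: "(exp_tail n \<longlongrightarrow> 0) (at 0)"
proof -
  have "((\<lambda>t. inverse t ^ n / exp (inverse t)) \<longlongrightarrow> 0) (at_right (0::real))"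
    by (rule filterlim_compose[OF tendsto_power_div_exp_0 filterlim_inverse_at_top_right])
  then have "((\<lambda>t. exp (- inverse t) * inverse t ^ n) \<longlongrightarrow> 0) (at_right (0::real))"
    by (simp add: exp_minus field_simps)
  then have r: "(exp_tail n \<longlongrightarrow> 0) (at_right 0)"
    by (rule Lim_transform_eventually)
       (auto simp: exp_tail_def eventually_at_filter)
  have l: "(exp_tail n \<longlongrightarrow> 0) (at_left 0)"
    by (rule Lim_transform_eventually[where f="\<lambda>_. 0"])
       (auto simp: exp_tail_def eventually_at_filter)
  show ?thesis using l r by (simp add: filterlim_split_at)
qed

text \<open>Indexing by the power of 1/t makes the family closed under differentiation. At the
  origin the difference quotient of \<open>exp_tail n\<close> is exactly
  \<open>exp_tail (Suc n)\<close>, so differentiability there is the vanishing limit one index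
  up.\<close>

lemma exp_tail_has_real_derivative:
  "(exp_tail n has_real_derivative (exp_tail (n + 2) t - real n * exp_tail (Suc n) t)) (at t)"
proof -
  consider "t > 0" | "t < 0" | "t = 0" by linarith
  then show ?thesis
  proof cases
    case 1
    have pw: "m = 0 \<or> inverse t ^ m = inverse t * inverse t ^ (m - Suc 0)" for m by (cases m) auto
    have "((\<lambda>t. exp (- inverse t) * inverse t ^ n) has_real_derivative
        (exp_tail (n + 2) t - real n * exp_tail (Suc n) t)) (at t)"
      using 1 pw by (cases n)
        (auto intro!: derivative_eq_intros simp: exp_tail_def algebra_simps power2_eq_square)
    then show ?thesis
      by (rule DERIV_cong_ev[THEN iffD1, rotated -1])
        (use 1 in \<open>auto simp: exp_tail_def intro!: eventually_nhds_in_open[of "{0<..}", THEN eventually_mono]\<close>)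
  next
    case 2
    have "((\<lambda>t. 0) has_real_derivative (exp_tail (n + 2) t - real n * exp_tail (Suc n) t)) (at t)"
      using 2 by (simp add: exp_tail_def)
    then show ?thesis
      by (rule DERIV_cong_ev[THEN iffD1, rotated -1])
        (use 2 in \<open>auto simp: exp_tail_def intro!: eventually_nhds_in_open[of "{..<0}", THEN eventually_mono]\<close>)
  next
    case 3
    have "((\<lambda>h. (exp_tail n (0 + h) - exp_tail n 0) / h) \<longlongrightarrow> 0) (at 0)"
      by (rule Lim_transform_eventually[OF exp_tail_tendsto_0[of "Suc n"]])
         (auto simp: exp_tail_def eventually_at_filter field_simps)
    then show ?thesis using 3 by (simp add: DERIV_def exp_tail_def)
  qed
qed

text \<open>An algebra of functions closed under directional derivatives, so that all its members are
  smooth; it contains the standard bump on the ball \<open>cball c e\<close>.\<close>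

inductive smooth_class :: "'a::euclidean_space \<Rightarrow> real \<Rightarrow> ('a \<Rightarrow> real) \<Rightarrow> bool"
  for c :: 'a and e :: real where
  const: "smooth_class c e (\<lambda>x. k)"
| lin: "smooth_class c e (\<lambda>x. x \<bullet> w)"
| tail: "smooth_class c e (\<lambda>x. exp_tail n (1 - ((x - c) \<bullet> (x - c)) / e\<^sup>2))"
| add: "smooth_class c e f \<Longrightarrow> smooth_class c e g \<Longrightarrow> smooth_class c e (\<lambda>x. f x + g x)"
| mult: "smooth_class c e f \<Longrightarrow> smooth_class c e g \<Longrightarrow> smooth_class c e (\<lambda>x. f x * g x)"

lemma smooth_class_derivative:
  assumes "smooth_class c e f"
  shows "\<exists>D. (\<forall>x. (f has_derivative D x) (at x)) \<and> (\<forall>v. smooth_class c e (\<lambda>x. D x v))"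
  using assms
proof induction
  case (const k)
  show ?case
    by (rule exI[of _ "\<lambda>x v. 0"]) (auto intro: smooth_class.const)
next
  case (lin w)
  show ?case
    by (rule exI[of _ "\<lambda>x v. v \<bullet> w"])
      (auto intro!: smooth_class.const derivative_eq_intros)
next
  case (tail n)
  let ?q = "\<lambda>x. 1 - ((x - c) \<bullet> (x - c)) / e\<^sup>2"
  let ?D = "\<lambda>x v. (exp_tail (n + 2) (?q x) + (- real n) * exp_tail (Suc n) (?q x)) *
       ((- 2 / e\<^sup>2) * (x \<bullet> v + (- (c \<bullet> v))))"
  have "((\<lambda>x. exp_tail n (?q x)) has_derivative ?D x) (at x)" for x
  proof -
    have "(?q has_derivative (\<lambda>v. (- 2 / e\<^sup>2) * ((x - c) \<bullet> v))) (at x)"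
      by (cases "e = 0")
        (auto intro!: derivative_eq_intros simp: fun_eq_iff inner_commute field_simps)
    from has_derivative_compose[OF this exp_tail_has_real_derivative[unfolded has_field_derivative_def]]
    show ?thesis by (simp add: inner_diff_left inner_commute algebra_simps)
  qed
  moreover have "smooth_class c e (\<lambda>x. ?D x v)" for v
    by (intro smooth_class.mult smooth_class.add smooth_class.const smooth_class.lin smooth_class.tail)
  ultimately show ?case by (intro exI[of _ ?D]) blast
next
  case (add f g)
  then obtain D E where "\<forall>x. (f has_derivative D x) (at x)" "\<forall>v. smooth_class c e (\<lambda>x. D x v)"
    "\<forall>x. (g has_derivative E x) (at x)" "\<forall>v. smooth_class c e (\<lambda>x. E x v)" by blast
  then show ?case
    by (intro exI[of _ "\<lambda>x v. D x v + E x v"])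
      (auto intro!: smooth_class.add derivative_eq_intros)
next
  case (mult f g)
  then obtain D E where "\<forall>x. (f has_derivative D x) (at x)" "\<forall>v. smooth_class c e (\<lambda>x. D x v)"
    "\<forall>x. (g has_derivative E x) (at x)" "\<forall>v. smooth_class c e (\<lambda>x. E x v)" by blast
  then show ?case using mult.hyps
    by (intro exI[of _ "\<lambda>x v. f x * E x v + D x v * g x"])
      (auto intro!: smooth_class.add smooth_class.mult derivative_eq_intros)
qed

lemma smooth_class_smooth_order: "smooth_class c e f \<Longrightarrow> smooth_order k f"
proof (induction k arbitrary: f)
  case 0
  then show ?case using smooth_class_derivative[of c e f]
    by (auto simp: continuous_on_eq_continuous_within intro: has_derivative_continuous)
next
  case (Suc k)
  from smooth_class_derivative[OF Suc.prems] obtain D where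
    D: "\<And>x. (f has_derivative D x) (at x)" "\<And>v. smooth_class c e (\<lambda>x. D x v)" by blast
  have "frechet_derivative f (at x) = D x" for x
    using frechet_derivative_at[OF D(1)] by simp
  then show ?case using D Suc.IH by (auto simp: differentiable_def)
qed

text \<open>An affine change of variable only moves the ball attached to the class, so every
  translated and rescaled bump is smooth without a new computation.\<close>

lemma smooth_class_scaleR_diff:
  assumes "smooth_class c e f" "h > 0"
  shows "smooth_class (a + h *\<^sub>R c) (h * e) (\<lambda>y. f ((y - a) /\<^sub>R h))"
  using assms(1)
proof induction
  case (lin w)
  have "(\<lambda>y. ((y - a) /\<^sub>R h) \<bullet> w) = (\<lambda>y. inverse h * (y \<bullet> w + (- (a \<bullet> w))))"
    by (auto simp: inner_diff_left)
  then show ?case by (simp only:) (intro smooth_class.intros)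
next
  case (tail n)
  have "(\<lambda>y. exp_tail n (1 - (((y - a) /\<^sub>R h - c) \<bullet> ((y - a) /\<^sub>R h - c)) / e\<^sup>2)) =
     (\<lambda>y. exp_tail n (1 - ((y - (a + h *\<^sub>R c)) \<bullet> (y - (a + h *\<^sub>R c))) / (h * e)\<^sup>2))"
  proof
    fix y
    have "(y - a) /\<^sub>R h - c = (y - (a + h *\<^sub>R c)) /\<^sub>R h"
      using assms(2) by (simp add: scaleR_diff_right algebra_simps)
    moreover have "(w /\<^sub>R h) \<bullet> (w /\<^sub>R h) / e\<^sup>2 = (w \<bullet> w) / (h * e)\<^sup>2" for w
      using assms(2) by (simp add: field_simps power2_eq_square)
    ultimately show "exp_tail n (1 - (((y - a) /\<^sub>R h - c) \<bullet> ((y - a) /\<^sub>R h - c)) / e\<^sup>2) =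
      exp_tail n (1 - ((y - (a + h *\<^sub>R c)) \<bullet> (y - (a + h *\<^sub>R c))) / (h * e)\<^sup>2)"
      by metis
  qed
  then show ?case by (auto intro: smooth_class.intros)
qed (auto intro: smooth_class.intros)

lemma smooth_class_cmult: "smooth_class c e f \<Longrightarrow> smooth_class c e (\<lambda>x. k * f x)"
  by (intro smooth_class.mult smooth_class.const)

text \<open>The ball of radius 1/2 about \<open>(1/2) *\<^sub>R One\<close> is inscribed in the unit
  cube. After rescaling, the support therefore lies in a cube with a corner at the origin.\<close>

definition bump0 :: "'a::euclidean_space \<Rightarrow> real" where
  "bump0 x = exp_tail 0 (1 - ((x - (1/2) *\<^sub>R One) \<bullet> (x - (1/2) *\<^sub>R One)) / (1/2)\<^sup>2)"

lemma bump0_bounds: "0 \<le> bump0 x" "bump0 x \<le> 1"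
  by (auto simp: bump0_def exp_tail_def)

lemma bump0_support: "bump0 x \<noteq> 0 \<Longrightarrow> x \<in> cbox 0 One"
proof -
  assume "bump0 x \<noteq> 0"
  let ?d = "x - (1/2) *\<^sub>R One"
  have "?d \<bullet> ?d \<le> (1/2)\<^sup>2"
    using \<open>bump0 x \<noteq> 0\<close> by (auto simp: bump0_def exp_tail_def field_simps split: if_splits)
  then have n: "norm ?d \<le> 1/2"
    by (metis abs_le_square_iff abs_norm_cancel abs_of_nonneg half_bounded_equal order_less_imp_le power2_norm_eq_inner zero_less_divide_1_iff zero_less_numeral zero_le_divide_1_iff zero_le_numeral)
  show ?thesis
    unfolding mem_box
  proof
    fix i :: 'a assume i: "i \<in> Basis"
    have "\<bar>?d \<bullet> i\<bar> \<le> 1/2" using Basis_le_norm[OF i, of ?d] n by linarith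
    moreover have "?d \<bullet> i = x \<bullet> i - 1/2" using i by (simp add: inner_diff_left)
    ultimately have "0 \<le> x \<bullet> i \<and> x \<bullet> i \<le> 1" by linarith
    then show "0 \<bullet> i \<le> x \<bullet> i \<and> x \<bullet> i \<le> One \<bullet> i" using i by simp
  qed
qed

lemma smooth_class_bump0: "smooth_class ((1/2) *\<^sub>R One) (1/2) bump0"
  unfolding bump0_def[abs_def] by (rule smooth_class.tail)

lemma continuous_on_bump0: "continuous_on A bump0"
  using smooth_class_smooth_order[OF smooth_class_bump0, of 0]
  by (auto intro: continuous_on_subset)

lemma bump0_integrable: "integrable lborel bump0"
proof -
  have "integrable lborel (\<lambda>x. indicator (cbox 0 One) x *\<^sub>R (bump0 x :: real))"
    by (intro borel_integrable_compact continuous_on_bump0) auto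
  also have "(\<lambda>x. indicator (cbox 0 One) x *\<^sub>R (bump0 x :: real)) = bump0"
    using bump0_support by (auto simp: fun_eq_iff indicator_def)
  finally show ?thesis .
qed

lemma bump0_integral_pos: "integral\<^sup>L lborel (bump0 :: 'a::euclidean_space \<Rightarrow> real) > 0"
proof (rule ccontr)
  let ?c = "(1/2) *\<^sub>R One :: 'a"
  assume "\<not> ?thesis"
  moreover have "integral\<^sup>L lborel (bump0 :: 'a \<Rightarrow> real) \<ge> 0"
    by (simp add: bump0_bounds integral_nonneg_AE)
  ultimately have "integral\<^sup>L lborel (bump0 :: 'a \<Rightarrow> real) = 0" by linarith
  then have ae: "AE x in lborel. (bump0 :: 'a \<Rightarrow> real) x = 0"
    using integral_nonneg_eq_0_iff_AE[OF bump0_integrable] bump0_bounds by auto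
  have pos: "bump0 x \<noteq> 0" if "x \<in> ball ?c (1/2)" for x :: 'a
  proof -
    have "norm (x - ?c) < 1/2" using that by (simp add: dist_norm norm_minus_commute)
    then have "(norm (x - ?c))\<^sup>2 < (1/2)\<^sup>2" by (intro power_strict_mono) auto
    then show ?thesis
      by (auto simp: bump0_def exp_tail_def power2_norm_eq_inner field_simps)
  qed
  have "AE x in lborel. x \<notin> ball ?c (1/2)"
    using ae by eventually_elim (use pos in blast)
  then have "emeasure lborel (ball ?c (1/2)) = 0"
    by (subst (asm) AE_iff_measurable[of "ball ?c (1/2)"]) (auto simp: ball_def)
  then show False by (metis emeasure_lborel_ball_finite content_ball_pos half_gt_zero_iff zero_less_one measure_def enn2real_0 order_less_irrefl)
qed

text \<open>A smooth kernel in the corner cube \<open>[0, h]\<^sup>N\<close>, the shape for which the library provides the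
  Lebesgue differentiation theorem.\<close>

definition mollifier :: "real \<Rightarrow> 'a::euclidean_space \<Rightarrow> real" where
  "mollifier h z = bump0 (z /\<^sub>R h) / (h ^ DIM('a) * integral\<^sup>L lborel (bump0 :: 'a \<Rightarrow> real))"

lemma mollifier_nonneg: "h > 0 \<Longrightarrow> 0 \<le> mollifier h z"
  using bump0_integral_pos by (auto simp: mollifier_def bump0_bounds less_imp_le)

lemma mollifier_le:
  "h > 0 \<Longrightarrow> mollifier h (z::'a::euclidean_space) \<le>
     (1 / integral\<^sup>L lborel (bump0 :: 'a \<Rightarrow> real)) / h ^ DIM('a)"
  using bump0_integral_pos[where 'a='a] bump0_bounds(2)[of "z /\<^sub>R h"]
  by (auto simp: mollifier_def divide_simps mult.commute)

lemma mollifier_support: "h > 0 \<Longrightarrow> mollifier h z \<noteq> 0 \<Longrightarrow> z \<in> cbox 0 (h *\<^sub>R One)"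
  using bump0_support[of "z /\<^sub>R h"]
  by (auto simp: mollifier_def mem_box field_simps)

lemma norm_le_of_mem_cbox:
  assumes "h > 0" "(z::'a::euclidean_space) \<in> cbox 0 (h *\<^sub>R One)"
  shows "norm z \<le> real DIM('a) * h"
proof -
  have "norm z \<le> (\<Sum>i\<in>Basis. \<bar>z \<bullet> i\<bar>)" by (rule norm_le_l1)
  also have "\<dots> \<le> (\<Sum>i\<in>(Basis::'a set). h)"
    using assms by (intro sum_mono) (auto simp: mem_box)
  finally show ?thesis by simp
qed

lemma mollifier_support_norm:
  "h > 0 \<Longrightarrow> mollifier h (z::'a::euclidean_space) \<noteq> 0 \<Longrightarrow> norm z \<le> real DIM('a) * h"
  using mollifier_support norm_le_of_mem_cbox by blast

lemma smooth_order_mollifier: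
  assumes "h > 0" shows "smooth_order k (\<lambda>y. mollifier h (y - x :: 'a::euclidean_space))"
proof -
  have "smooth_class (x + h *\<^sub>R ((1/2) *\<^sub>R One)) (h * (1/2))
      (\<lambda>y. (1 / (h ^ DIM('a) * integral\<^sup>L lborel (bump0 :: 'a \<Rightarrow> real))) * bump0 ((y - x) /\<^sub>R h))"
    by (intro smooth_class_cmult smooth_class_scaleR_diff smooth_class_bump0 assms)
  from smooth_class_smooth_order[OF this] show ?thesis by (simp add: mollifier_def)
qed

lemma mollifier_integrable_integral:
  assumes "h > 0"
  shows "integrable lborel (mollifier h :: 'a::euclidean_space \<Rightarrow> real)"
    and "integral\<^sup>L lborel (mollifier h :: 'a \<Rightarrow> real) = 1"
proof -
  let ?I = "integral\<^sup>L lborel (bump0 :: 'a \<Rightarrow> real)"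
  have m: "(bump0 :: 'a \<Rightarrow> real) \<in> borel_measurable borel"
    using borel_measurable_integrable[OF bump0_integrable] by simp
  have l: "lborel = density (distr lborel borel (\<lambda>x::'a. 0 + (1/h) *\<^sub>R x)) (\<lambda>_. \<bar>1/h\<bar>^DIM('a))"
    by (rule lborel_affine) (use assms in simp)
  have 1: "integrable lborel (\<lambda>x::'a. (1/h)^DIM('a) * bump0 (x /\<^sub>R h))"
    using bump0_integrable[where 'a='a] m assms
    by (subst (asm) l) (auto simp: integrable_density integrable_distr_eq inverse_eq_divide)
  have 2: "?I = integral\<^sup>L lborel (\<lambda>x::'a. (1/h)^DIM('a) * bump0 (x /\<^sub>R h))"
    using m assms by (subst l) (auto simp: integral_density integral_distr inverse_eq_divide)
  have eq: "mollifier h = (\<lambda>x::'a. ((1/h)^DIM('a) * bump0 (x /\<^sub>R h)) / ?I)"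
    by (auto simp: mollifier_def fun_eq_iff power_divide)
  show "integrable lborel (mollifier h :: 'a \<Rightarrow> real)"
    unfolding eq using 1 by (intro integrable_divide_zero) auto
  show "integral\<^sup>L lborel (mollifier h :: 'a \<Rightarrow> real) = 1"
    unfolding eq integral_divide_zero 2[symmetric] using bump0_integral_pos[where 'a='a] by simp
qed

section \<open>Locally integrable functions and Lebesgue points\<close>

definition loc_integrable :: "('a::euclidean_space \<Rightarrow> real) \<Rightarrow> bool" where
  "loc_integrable f \<longleftrightarrow> f \<in> borel_measurable borel \<and> (\<forall>K. compact K \<longrightarrow> set_integrable lborel K f)"

lemma loc_integrable_measurable: "loc_integrable f \<Longrightarrow> f \<in> borel_measurable borel"
  by (simp add: loc_integrable_def)

lemma loc_integrable_mult_bounded: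
  fixes f k :: "'a::euclidean_space \<Rightarrow> real"
  assumes f: "loc_integrable f" and k: "k \<in> borel_measurable borel" and "compact K"
    and B: "\<And>x. x \<in> K \<Longrightarrow> \<bar>k x\<bar> \<le> B" and 0: "\<And>x. x \<notin> K \<Longrightarrow> k x = 0"
  shows "integrable lborel (\<lambda>x. f x * k x)"
proof (rule Bochner_Integration.integrable_bound)
  have "set_integrable lborel K f" using f \<open>compact K\<close> by (simp add: loc_integrable_def)
  then have "integrable lborel (\<lambda>x. indicator K x * f x)" by (simp add: set_integrable_def)
  then show "integrable lborel (\<lambda>x. B * (indicator K x * f x))" by auto
  show "(\<lambda>x. f x * k x) \<in> borel_measurable lborel"
    using k f by (auto simp: loc_integrable_def)
  show "AE x in lborel. norm (f x * k x) \<le> norm (B * (indicator K x * f x))"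
  proof (rule AE_I2)
    fix x
    show "norm (f x * k x) \<le> norm (B * (indicator K x * f x))"
    proof (cases "x \<in> K")
      case True
      then have "\<bar>k x\<bar> \<le> \<bar>B\<bar>" using B[of x] by linarith
      then show ?thesis using True by (simp add: abs_mult mult.commute[of _ "\<bar>k x\<bar>"] mult_right_mono)
    qed (simp add: 0)
  qed
qed

lemma integrable_cbox_of_loc_integrable:
  "loc_integrable f \<Longrightarrow> set_integrable lborel (cbox a b) f"
  by (simp add: loc_integrable_def compact_cbox)

lemma loc_integrable_const: "loc_integrable (\<lambda>_::'a::euclidean_space. q)"
  unfolding loc_integrable_def set_integrable_def
  by (auto simp del: scaleR_left.add real_scaleR_def integrable_mult_left_iff integrable_mult_right_iff
     intro!: borel_integrable_compact)

lemma measure_corner_cube: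
  "h \<ge> 0 \<Longrightarrow> measure lborel (cbox x (x + h *\<^sub>R One :: 'a::euclidean_space)) = h ^ DIM('a)"
  by (subst content_cbox) (auto simp: inner_add_left)

text \<open>Differentiation of cube averages is applied to |f - q| for every rational q. The
  countably many exceptional sets have a negligible union, and off it a rational q close to f x
  transfers the convergence to |f - f x|.\<close>

lemma AE_lebesgue_point:
  fixes f :: "'a::euclidean_space \<Rightarrow> real"
  assumes "loc_integrable f"
  shows "AE x in lborel. \<forall>e>0. \<exists>d>0. \<forall>h. 0 < h \<and> h < d \<longrightarrow>
     (LINT y:cbox x (x + h *\<^sub>R One)|lborel. \<bar>f y - f x\<bar>) / h ^ DIM('a) < e"
proof -
  have int: "set_integrable lborel (cbox a b) (\<lambda>y. \<bar>f y - q\<bar>)" for q and a b :: 'a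
    by (intro set_integrable_abs set_integral_diff integrable_cbox_of_loc_integrable assms
         loc_integrable_const)
  have cint: "set_integrable lborel (cbox a b) (\<lambda>y. q::real)" for q and a b :: 'a
    by (intro integrable_cbox_of_loc_integrable loc_integrable_const)
  have "\<exists>N. negligible N \<and> (\<forall>x e. x \<notin> N \<and> 0 < e \<longrightarrow> (\<exists>d>0. \<forall>h. 0 < h \<and> h < d \<longrightarrow>
      norm (integral (cbox x (x + h *\<^sub>R One)) (\<lambda>y. \<bar>f y - q\<bar>) /\<^sub>R h ^ DIM('a) - \<bar>f x - q\<bar>) < e))" for q
    by (rule integrable_ccontinuous_explicit[of "\<lambda>y. \<bar>f y - q\<bar>"])
       (use set_borel_integral_eq_integral(1)[OF int] in \<open>blast+\<close>)
  then obtain N where N: "\<And>q. negligible (N q)"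
    "\<And>q x e. x \<notin> N q \<Longrightarrow> 0 < e \<Longrightarrow> (\<exists>d>0. \<forall>h. 0 < h \<and> h < d \<longrightarrow>
      norm (integral (cbox x (x + h *\<^sub>R One)) (\<lambda>y. \<bar>f y - q\<bar>) /\<^sub>R h ^ DIM('a) - \<bar>f x - q\<bar>) < e)"
    by metis
  have neg: "negligible (\<Union>q\<in>\<rat>. N q)"
    by (rule negligible_countable_Union) (auto simp: countable_rat N)
  have pt: "\<exists>d>0. \<forall>h. 0 < h \<and> h < d \<longrightarrow>
     (LINT y:cbox x (x + h *\<^sub>R One)|lborel. \<bar>f y - f x\<bar>) / h ^ DIM('a) < e"
    if x: "x \<notin> (\<Union>q\<in>\<rat>. N q)" and e: "e > 0" for x e
  proof -
    \<comment> \<open>The quarter of \<open>e\<close> is spent three times: twice on |f x - q|, once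
      on the average of |f - q|.\<close>
    obtain q where q: "q \<in> \<rat>" "f x - e/4 < q" "q < f x + e/4"
      using Rats_dense_in_real[of "f x - e/4" "f x + e/4"] e by auto
    then have xq: "\<bar>f x - q\<bar> < e/4" by (auto simp: abs_if)
    obtain d where d: "d > 0" and dd: "\<And>h. 0 < h \<Longrightarrow> h < d \<Longrightarrow>
      \<bar>integral (cbox x (x + h *\<^sub>R One)) (\<lambda>y. \<bar>f y - q\<bar>) / h ^ DIM('a) - \<bar>f x - q\<bar>\<bar> < e/4"
      using N(2)[of x q "e/4"] x q(1) e by (auto simp: field_simps)
    have "(LINT y:cbox x (x + h *\<^sub>R One)|lborel. \<bar>f y - f x\<bar>) / h ^ DIM('a) < e"
      if h: "0 < h" "h < d" for h
    proof -
      let ?C = "cbox x (x + h *\<^sub>R One)"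
      have "(LINT y:?C|lborel. \<bar>f y - f x\<bar>) \<le> (LINT y:?C|lborel. \<bar>f y - q\<bar> + \<bar>f x - q\<bar>)"
        by (intro set_integral_mono int set_integral_add(1) cint) linarith
      also have "\<dots> = (LINT y:?C|lborel. \<bar>f y - q\<bar>) + (LINT y:?C|lborel. \<bar>f x - q\<bar>)"
        by (intro set_integral_add(2) int cint)
      also have "(LINT y:?C|lborel. \<bar>f x - q\<bar>) = \<bar>f x - q\<bar> * h ^ DIM('a)"
      proof -
        have "integrable lborel (indicat_real ?C)"
          by (rule integrable_real_indicator[OF _ emeasure_lborel_cbox_finite]) simp
        then show ?thesis using h measure_corner_cube[of h x]
          by (simp add: set_lebesgue_integral_def)
      qed
      also have "(LINT y:?C|lborel. \<bar>f y - q\<bar>) = integral ?C (\<lambda>y. \<bar>f y - q\<bar>)"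
        by (rule set_borel_integral_eq_integral(2)[OF int])
      finally have "(LINT y:?C|lborel. \<bar>f y - f x\<bar>) / h ^ DIM('a)
          \<le> (integral ?C (\<lambda>y. \<bar>f y - q\<bar>) + \<bar>f x - q\<bar> * h ^ DIM('a)) / h ^ DIM('a)"
        using h by (intro divide_right_mono) auto
      also have "\<dots> = integral ?C (\<lambda>y. \<bar>f y - q\<bar>) / h ^ DIM('a) + \<bar>f x - q\<bar>"
        using h by (simp add: field_simps)
      also have "\<dots> < e" using dd[OF h] xq by linarith
      finally show ?thesis .
    qed
    with d show ?thesis by blast
  qed
  have "(\<Union>q\<in>\<rat>. N q) \<in> null_sets lebesgue" using neg by (simp add: negligible_iff_null_sets)
  then have "AE x in lebesgue. x \<notin> (\<Union>q\<in>\<rat>. N q)" by (rule AE_not_in)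
  then have "AE x in lborel. x \<notin> (\<Union>q\<in>\<rat>. N q)" by (simp add: AE_completion_iff)
  then show ?thesis by eventually_elim (use pt in blast)
qed

text \<open>A correlation instead of a convolution: the kernel samples f on the cube with lower
  corner x, the one for which Lebesgue points are available. The price is a minus sign when the
  derivative falls on the kernel; it cancels against the sign in the definition of the weak
  gradient.\<close>

definition mollify :: "real \<Rightarrow> ('a::euclidean_space \<Rightarrow> real) \<Rightarrow> 'a \<Rightarrow> real" where
  "mollify h f x = (LINT y|lborel. f y * mollifier h (y - x))"

lemma mollifier_continuous: "h > 0 \<Longrightarrow> continuous_on A (mollifier h)"
  using smooth_order_mollifier[of h 0 0] by (auto intro: continuous_on_subset)

lemma mollifier_measurable[measurable]: "h > 0 \<Longrightarrow> mollifier h \<in> borel_measurable borel"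
  by (intro borel_measurable_continuous_onI mollifier_continuous)

lemma mollifier_shift_support:
  "h > 0 \<Longrightarrow> y \<notin> cbox x (x + h *\<^sub>R One) \<Longrightarrow> mollifier h (y - x) = 0"
proof (rule ccontr)
  assume h: "h > 0" "y \<notin> cbox x (x + h *\<^sub>R One)" and "mollifier h (y - x) \<noteq> 0"
  then have "y - x \<in> cbox 0 (h *\<^sub>R One)" using mollifier_support by blast
  then have "y \<in> cbox x (x + h *\<^sub>R One)"
    by (simp add: mem_box inner_diff_left inner_add_left diff_le_eq add.commute)
  with h show False by simp
qed

lemma integrable_mollify:
  fixes f :: "'a::euclidean_space \<Rightarrow> real"
  assumes "loc_integrable f" "h > 0"
  shows "integrable lborel (\<lambda>y. f y * mollifier h (y - x))"
  by (rule loc_integrable_mult_bounded[of f _ "cbox x (x + h *\<^sub>R One)" "(1 / integral\<^sup>L lborel (bump0 :: 'a \<Rightarrow> real)) / h ^ DIM('a)"])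
     (use assms mollifier_le[OF assms(2), where 'a='a] mollifier_nonneg[OF assms(2), where 'a='a] in \<open>auto simp: mollifier_shift_support compact_cbox
        intro!: measurable_compose[OF _ mollifier_measurable]\<close>)

lemma integral_shift_lborel:
  fixes f :: "'a::euclidean_space \<Rightarrow> real"
  assumes [measurable]: "f \<in> borel_measurable borel"
  shows "(LINT y|lborel. f (y - x)) = (LINT y|lborel. f y)"
proof -
  have "(LINT y|lborel. f y) = (LINT y|distr lborel borel (\<lambda>y. - x + y). f y)"
    by (subst lborel_distr_plus) simp
  also have "\<dots> = (LINT y|lborel. f (- x + y))" by (rule integral_distr) auto
  finally show ?thesis by simp
qed

lemma integral_mollifier_shift:
  "h > 0 \<Longrightarrow> (LINT y|lborel. mollifier h (y - x)) = 1"
  by (subst integral_shift_lborel) (auto simp: mollifier_integrable_integral)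

lemma integrable_mollifier_shift:
  "h > 0 \<Longrightarrow> integrable lborel (\<lambda>y. mollifier h (y - x))"
  using integral_mollifier_shift[of h x] not_integrable_integral_eq by fastforce

text \<open>The kernel has integral 1 and is at most a constant times the inverse volume of its
  cube, so the error at x is dominated by the average of |f - f x| over that cube.\<close>

lemma mollify_tendsto_AE:
  fixes f :: "'a::euclidean_space \<Rightarrow> real"
  assumes f: "loc_integrable f" and h: "\<And>n. h n > 0" "h \<longlonglongrightarrow> 0"
  shows "AE x in lborel. (\<lambda>n. mollify (h n) f x) \<longlonglongrightarrow> f x"
  using AE_lebesgue_point[OF f]
proof eventually_elim
  case (elim x)
  let ?c = "1 / integral\<^sup>L lborel (bump0 :: 'a \<Rightarrow> real)"
  have c: "?c > 0" using bump0_integral_pos[where 'a='a] by simp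
  have bd: "\<bar>mollify e f x - f x\<bar> \<le>
      ?c * ((LINT y:cbox x (x + e *\<^sub>R One)|lborel. \<bar>f y - f x\<bar>) / e ^ DIM('a))" if e: "e > 0" for e
  proof -
    let ?C = "cbox x (x + e *\<^sub>R One)"
    have int: "set_integrable lborel ?C (\<lambda>y. \<bar>f y - f x\<bar>)"
      by (intro set_integrable_abs set_integral_diff integrable_cbox_of_loc_integrable f
         loc_integrable_const)
    have "mollify e f x - f x = (LINT y|lborel. f y * mollifier e (y - x)) - (LINT y|lborel. f x * mollifier e (y - x))"
      by (simp add: mollify_def integral_mollifier_shift[OF e])
    also have "\<dots> = (LINT y|lborel. (f y - f x) * mollifier e (y - x))"
      using integrable_mollify[OF f e, of x] integrable_mollifier_shift[OF e, of x]
      by (subst Bochner_Integration.integral_diff[symmetric]) (auto simp: left_diff_distrib)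
    also have "\<bar>\<dots>\<bar> \<le> (LINT y|lborel. \<bar>(f y - f x) * mollifier e (y - x)\<bar>)"
      by (rule integral_abs_bound)
    also have "\<dots> \<le> (LINT y|lborel. (?c / e ^ DIM('a)) * (indicator ?C y * \<bar>f y - f x\<bar>))"
    proof (rule integral_mono_AE)
      have eq: "(\<lambda>y. \<bar>(f y - f x) * mollifier e (y - x)\<bar>) = (\<lambda>y. \<bar>f y * mollifier e (y - x) - f x * mollifier e (y - x)\<bar>)"
        by (simp add: left_diff_distrib)
      show "integrable lborel (\<lambda>y. \<bar>(f y - f x) * mollifier e (y - x)\<bar>)"
        unfolding eq
        by (intro integrable_abs Bochner_Integration.integrable_diff integrable_mollify f e
             integrable_mult_right integrable_mollifier_shift)
      show "integrable lborel (\<lambda>y. (?c / e ^ DIM('a)) * (indicator ?C y * \<bar>f y - f x\<bar>))"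
        using int by (intro integrable_mult_right) (auto simp: set_integrable_def)
      show "AE y in lborel. \<bar>(f y - f x) * mollifier e (y - x)\<bar> \<le> (?c / e ^ DIM('a)) * (indicator ?C y * \<bar>f y - f x\<bar>)"
      proof (rule AE_I2)
        fix y
        show "\<bar>(f y - f x) * mollifier e (y - x)\<bar> \<le> (?c / e ^ DIM('a)) * (indicator ?C y * \<bar>f y - f x\<bar>)"
        proof (cases "y \<in> ?C")
          case True
          have "\<bar>mollifier e (y - x)\<bar> \<le> ?c / e ^ DIM('a)"
            using mollifier_le[OF e, of "y - x"] mollifier_nonneg[OF e, of "y - x"] by simp
          from mult_right_mono[OF this, of "\<bar>f y - f x\<bar>"] True
          show ?thesis by (simp add: abs_mult mult.commute)
        qed (simp add: mollifier_shift_support[OF e])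
      qed
    qed
    also have "\<dots> = ?c * ((LINT y:?C|lborel. \<bar>f y - f x\<bar>) / e ^ DIM('a))"
      by (simp add: set_lebesgue_integral_def)
    finally show ?thesis .
  qed
  show ?case
  proof (rule LIMSEQ_I)
    fix r :: real assume "r > 0"
    then have "r / ?c > 0" using c by (rule divide_pos_pos)
    with elim obtain d where d: "d > 0" "\<And>e. 0 < e \<Longrightarrow> e < d \<Longrightarrow>
       (LINT y:cbox x (x + e *\<^sub>R One)|lborel. \<bar>f y - f x\<bar>) / e ^ DIM('a) < r / ?c"
      by blast
    have "eventually (\<lambda>n. h n < d) sequentially"
      using order_tendstoD(2)[OF h(2) d(1)] .
    then obtain n0 where n0: "\<And>n. n \<ge> n0 \<Longrightarrow> h n < d" by (auto simp: eventually_sequentially)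
    have "norm (mollify (h n) f x - f x) < r" if "n \<ge> n0" for n
    proof -
      have "?c * ((LINT y:cbox x (x + h n *\<^sub>R One)|lborel. \<bar>f y - f x\<bar>) / h n ^ DIM('a)) < ?c * (r / ?c)"
        using d(2)[OF h(1) n0[OF that]] c by (intro mult_strict_left_mono)
      then show ?thesis using bd[OF h(1), of n] c by simp
    qed
    then show "\<exists>n0. \<forall>n\<ge>n0. norm (mollify (h n) f x - f x) < r" by blast
  qed
qed

subsection \<open>Mollification of weak gradients\<close>

text \<open>The open set is carried along because a mollified function has the expected gradient
  only outside a ball around the origin; values off \<open>S\<close> are arbitrary.\<close>

definition C1_pair :: "'a::euclidean_space set \<Rightarrow> ('a \<Rightarrow> real) \<Rightarrow> ('a \<Rightarrow> 'a) \<Rightarrow> bool" where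
  "C1_pair S u G \<longleftrightarrow> open S \<and> continuous_on S G \<and>
     (\<forall>x\<in>S. (u has_derivative (\<lambda>v. G x \<bullet> v)) (at x))"

definition mollifier_grad :: "real \<Rightarrow> 'a::euclidean_space \<Rightarrow> 'a" where
  "mollifier_grad h z = (\<Sum>i\<in>Basis. frechet_derivative (mollifier h) (at z) i *\<^sub>R i)"

lemma mollifier_has_derivative:
  assumes "h > 0"
  shows "(mollifier h has_derivative (\<lambda>v. mollifier_grad h z \<bullet> v)) (at (z::'a::euclidean_space))"
proof -
  have "(mollifier h) differentiable (at z)"
    using smooth_order_mollifier[OF assms, of "Suc 0" "0::'a"] by simp
  then have d: "(mollifier h has_derivative frechet_derivative (mollifier h) (at z)) (at z)"
    by (simp add: frechet_derivative_works)
  interpret linear "frechet_derivative (mollifier h) (at z)"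
    using d by (rule has_derivative_linear)
  have "frechet_derivative (mollifier h) (at z) v = mollifier_grad h z \<bullet> v" for v
  proof -
    have "frechet_derivative (mollifier h) (at z) v =
        frechet_derivative (mollifier h) (at z) (\<Sum>i\<in>Basis. (v \<bullet> i) *\<^sub>R i)"
      by (simp add: euclidean_representation)
    also have "\<dots> = (\<Sum>i\<in>Basis. (v \<bullet> i) * frechet_derivative (mollifier h) (at z) i)"
      by (simp add: sum scale)
    finally show ?thesis
      by (simp add: mollifier_grad_def inner_sum_right inner_commute mult.commute)
  qed
  then have "frechet_derivative (mollifier h) (at z) = (\<lambda>v. mollifier_grad h z \<bullet> v)" by (rule ext)
  then show ?thesis using d by simp
qed

lemma mollifier_grad_continuous:
  assumes "h > 0"
  shows "continuous_on A (mollifier_grad h)"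
proof -
  have "continuous_on UNIV (\<lambda>x. frechet_derivative (mollifier h) (at x) v)" for v :: 'a
    using smooth_order_mollifier[OF assms, of "Suc 0" "0::'a"] by simp
  then have "continuous_on UNIV (mollifier_grad h :: 'a \<Rightarrow> 'a)"
    unfolding mollifier_grad_def[abs_def] by (intro continuous_intros)
  then show ?thesis by (rule continuous_on_subset) simp
qed

lemma mollifier_grad_measurable[measurable]:
  "h > 0 \<Longrightarrow> mollifier_grad h \<in> borel_measurable borel"
  by (intro borel_measurable_continuous_onI mollifier_grad_continuous)

lemma mollifier_eq_0: "h > 0 \<Longrightarrow> norm (z::'a::euclidean_space) > real DIM('a) * h \<Longrightarrow> mollifier h z = 0"
  using mollifier_support_norm[of h z] by force

lemma mollifier_grad_eq_0:
  assumes "h > 0" "norm (z::'a::euclidean_space) > real DIM('a) * h"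
  shows "mollifier_grad h z = 0"
proof -
  have "open {w::'a. norm w > real DIM('a) * h}" by (intro open_Collect_less continuous_intros)
  then have "(mollifier h has_derivative (\<lambda>v. 0)) (at z)"
    by (rule has_derivative_transform_within_open[OF has_derivative_const[of 0]])
       (use assms mollifier_eq_0[OF assms(1)] in auto)
  from has_derivative_unique[OF this mollifier_has_derivative[OF assms(1)]]
  have "mollifier_grad h z \<bullet> mollifier_grad h z = 0" by metis
  then show ?thesis by simp
qed

text \<open>The gradient of the kernel is continuous with compact support. Its bound also serves as
  a Lipschitz constant, and both uses together dominate the remainder in the derivative of
  \<open>mollify\<close>.\<close>

lemma mollifier_grad_bounded:
  assumes "h > 0"
  obtains L where "L > 0" "\<And>z::'a::euclidean_space. norm (mollifier_grad h z) \<le> L"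
    "\<And>z w::'a. \<bar>mollifier h z - mollifier h w\<bar> \<le> L * norm (z - w)"
proof -
  let ?K = "cball (0::'a) (real DIM('a) * h)"
  have "compact (mollifier_grad h ` ?K)"
    by (intro compact_continuous_image mollifier_grad_continuous assms) simp
  then obtain L where L: "L > 0" "\<And>y. y \<in> mollifier_grad h ` ?K \<Longrightarrow> norm y \<le> L"
    using compact_imp_bounded bounded_pos by metis
  have b: "norm (mollifier_grad h z) \<le> L" for z :: 'a
    using L mollifier_grad_eq_0[OF assms, of z] by (cases "z \<in> ?K") auto
  have "norm (mollifier h z - mollifier h w) \<le> L * norm (z - w)" for z w :: 'a
  proof (rule differentiable_bound[where S=UNIV and f'="\<lambda>x v. mollifier_grad h x \<bullet> v"])
    show "onorm ((\<bullet>) (mollifier_grad h x)) \<le> L" for x :: 'a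
    proof (rule onorm_le)
      fix v :: 'a
      show "norm (mollifier_grad h x \<bullet> v) \<le> L * norm v"
        using Cauchy_Schwarz_ineq2[of "mollifier_grad h x" v] mult_right_mono[OF b[of x], of "norm v"]
        by simp
    qed
  qed (use mollifier_has_derivative[OF assms] in auto)
  then show ?thesis using L b that by auto
qed

lemma mollifier_shift_integrable_grad:
  fixes f :: "'a::euclidean_space \<Rightarrow> real"
  assumes f: "loc_integrable f" and h: "h > 0"
  shows "integrable lborel (\<lambda>y. f y * (mollifier_grad h (y - x) \<bullet> v))"
proof -
  obtain L where L: "L > 0" "\<And>z::'a::euclidean_space. norm (mollifier_grad h z) \<le> L"
    using mollifier_grad_bounded[OF h] by metis
  show ?thesis
  proof (rule loc_integrable_mult_bounded[OF f, of _ "cball x (real DIM('a) * h)" "L * norm v"])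
    show "(\<lambda>y. mollifier_grad h (y - x) \<bullet> v) \<in> borel_measurable borel"
      by (intro borel_measurable_continuous_onI continuous_intros
           continuous_on_compose2[OF mollifier_grad_continuous[OF h, of UNIV]]) auto
    show "\<bar>mollifier_grad h (y - x) \<bullet> v\<bar> \<le> L * norm v" for y
      using Cauchy_Schwarz_ineq2[of "mollifier_grad h (y - x)" v] L(2)[of "y - x"]
      by (meson mult_right_mono norm_ge_zero order_trans)
    show "mollifier_grad h (y - x) \<bullet> v = 0" if "y \<notin> cball x (real DIM('a) * h)" for y
      using mollifier_grad_eq_0[OF h, of "y - x"] that by (simp add: dist_norm norm_minus_commute)
  qed simp
qed

text \<open>Differentiation under the integral sign, checked along sequences of increments so that
  dominated convergence applies. The remainder of the kernel divided by the length of the increment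
  is at most 2L and tends to 0 pointwise.\<close>

lemma mollify_has_derivative:
  fixes f :: "'a::euclidean_space \<Rightarrow> real"
  assumes f: "loc_integrable f" and h: "h > 0"
  shows "(mollify h f has_derivative (\<lambda>v. - (LINT y|lborel. f y * (mollifier_grad h (y - x) \<bullet> v)))) (at x)"
proof -
  obtain L where L: "L > 0" "\<And>z::'a::euclidean_space. norm (mollifier_grad h z) \<le> L"
    "\<And>z w::'a. \<bar>mollifier h z - mollifier h w\<bar> \<le> L * norm (z - w)"
    using mollifier_grad_bounded[OF h] by metis
  note [measurable] = loc_integrable_measurable[OF f] mollifier_measurable[OF h] mollifier_grad_measurable[OF h]
  let ?D = "\<lambda>v. - (LINT y|lborel. f y * (mollifier_grad h (y - x) \<bullet> v))"
  note int = mollifier_shift_integrable_grad[OF f h]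
  have lin: "linear ?D"
  proof (rule linearI)
    fix v w
    show "?D (v + w) = ?D v + ?D w"
      using int[of x v] int[of x w] by (simp add: inner_add_right ring_distribs)
    fix r :: real
    have "(LINT y|lborel. f y * (mollifier_grad h (y - x) \<bullet> (r *\<^sub>R v))) =
      (LINT y|lborel. r * (f y * (mollifier_grad h (y - x) \<bullet> v)))"
      by (intro Bochner_Integration.integral_cong) auto
    then show "?D (r *\<^sub>R v) = r *\<^sub>R ?D v" by simp
  qed
  have lim: "(\<lambda>n. norm (mollify h f (x + V n) - mollify h f x - ?D (V n)) / norm (V n)) \<longlonglongrightarrow> 0"
    if V0: "\<And>n. V n \<noteq> 0" and V: "V \<longlonglongrightarrow> 0" for V
  proof -
    define Q where "Q n y = (mollifier h (y - (x + V n)) - mollifier h (y - x) + mollifier_grad h (y - x) \<bullet> V n) / norm (V n)" for n y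
    have eq: "(mollify h f (x + V n) - mollify h f x - ?D (V n)) / norm (V n) = (LINT y|lborel. f y * Q n y)" for n
    proof -
      have "mollify h f (x + V n) - mollify h f x - ?D (V n) =
        (LINT y|lborel. f y * mollifier h (y - (x + V n)) - f y * mollifier h (y - x) + f y * (mollifier_grad h (y - x) \<bullet> V n))"
        unfolding mollify_def
        by (simp only: Bochner_Integration.integral_add Bochner_Integration.integral_diff
            Bochner_Integration.integrable_diff integrable_mollify[OF f h] int)
      then show ?thesis unfolding Q_def
        by (simp add: ring_distribs diff_divide_distrib add_divide_distrib flip: integral_divide_zero)
    qed
    \<comment> \<open>A bound for the increments keeps all shifted kernels inside one ball, on which
      f is integrable; the dominating function lives there.\<close>
    obtain B where B: "\<And>n. norm (V n) \<le> B" "B > 0"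
      using convergent_imp_Bseq[of V] V convergentI by (metis BseqE)
    have "(\<lambda>n. LINT y|lborel. f y * Q n y) \<longlonglongrightarrow> (LINT y|(lborel::'a measure). (0::real))"
    proof (rule integral_dominated_convergence[where w="\<lambda>y. 2 * L * \<bar>f y\<bar> * indicator (cball x (real DIM('a) * h + B)) y"])
      let ?w = "\<lambda>y. 2 * L * \<bar>f y\<bar> * indicator (cball x (real DIM('a) * h + B)) y"
      show "(\<lambda>y. 0::real) \<in> borel_measurable lborel" by simp
      show "\<And>n. (\<lambda>y. f y * Q n y) \<in> borel_measurable lborel"
        unfolding Q_def by measurable
      have "set_integrable lborel (cball x (real DIM('a) * h + B)) f"
        using f by (simp add: loc_integrable_def)
      then have "integrable lborel (\<lambda>y. 2 * L * \<bar>indicator (cball x (real DIM('a) * h + B)) y * f y\<bar>)"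
        by (intro integrable_mult_right integrable_abs) (simp add: set_integrable_def)
      then show "integrable lborel ?w" by (simp add: abs_mult mult_ac)
      show "AE y in lborel. norm (f y * Q n y) \<le> ?w y" for n
      proof (rule AE_I2)
        fix y
        show "norm (f y * Q n y) \<le> ?w y"
        proof (cases "y \<in> cball x (real DIM('a) * h + B)")
          case True
          have "\<bar>mollifier h (y - (x + V n)) - mollifier h (y - x) + mollifier_grad h (y - x) \<bullet> V n\<bar>
              \<le> L * norm (V n) + L * norm (V n)"
          proof -
            have "\<bar>mollifier h (y - (x + V n)) - mollifier h (y - x)\<bar> \<le> L * norm (V n)"
              using L(3)[of "y - (x + V n)" "y - x"] by simp
            moreover have "\<bar>mollifier_grad h (y - x) \<bullet> V n\<bar> \<le> L * norm (V n)"
              using Cauchy_Schwarz_ineq2[of "mollifier_grad h (y - x)" "V n"] L(2)[of "y - x"]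
              by (meson mult_right_mono norm_ge_zero order_trans)
            ultimately show ?thesis by linarith
          qed
          then have "\<bar>Q n y\<bar> \<le> 2 * L"
            using V0[of n] unfolding Q_def by (simp add: divide_le_eq)
          then have "\<bar>f y\<bar> * \<bar>Q n y\<bar> \<le> \<bar>f y\<bar> * (2 * L)" by (intro mult_left_mono) auto
          then show ?thesis using True by (simp add: abs_mult mult_ac)
        next
          case False
          then have g: "norm (y - x) > real DIM('a) * h + B" by (simp add: dist_norm norm_minus_commute)
          have "norm (y - x) \<le> norm (y - (x + V n)) + norm (V n)"
            using norm_triangle_ineq[of "y - (x + V n)" "V n"] by (simp add: algebra_simps)
          then have g2: "norm (y - (x + V n)) > real DIM('a) * h" using g B(1)[of n] by linarith
          have "Q n y = 0" unfolding Q_def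
            using mollifier_eq_0[OF h g2] mollifier_eq_0[OF h, of "y - x"] mollifier_grad_eq_0[OF h, of "y - x"] g B(2)
            by simp
          then show ?thesis using L(1) by simp
        qed
      qed
      show "AE y in lborel. (\<lambda>n. f y * Q n y) \<longlonglongrightarrow> 0"
      proof (rule AE_I2)
        fix y
        have "((\<lambda>w. mollifier h (y - w)) has_derivative (\<lambda>v. - (mollifier_grad h (y - x) \<bullet> v))) (at x)"
          using has_derivative_compose[OF has_derivative_diff[OF has_derivative_const[of y] has_derivative_ident], where g="mollifier h" and g'="\<lambda>v. mollifier_grad h (y - x) \<bullet> v" and x=x and s=UNIV]
            mollifier_has_derivative[OF h, of "y - x"] by simp
        then have "((\<lambda>v. norm (mollifier h (y - (x + v)) - mollifier h (y - x) + mollifier_grad h (y - x) \<bullet> v) / norm v) \<longlongrightarrow> 0) (at 0)"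
          by (simp add: has_derivative_at)
        then have "(\<lambda>n. norm (Q n y)) \<longlonglongrightarrow> 0"
          using V0 V unfolding tendsto_at_iff_sequentially Q_def by (auto simp: comp_def)
        then have "(\<lambda>n. Q n y) \<longlonglongrightarrow> 0" by (rule tendsto_norm_zero_cancel)
        then show "(\<lambda>n. f y * Q n y) \<longlonglongrightarrow> 0" by (rule tendsto_mult_right_zero)
      qed
    qed
    then have "(\<lambda>n. LINT y|lborel. f y * Q n y) \<longlonglongrightarrow> 0" by simp
    then have "(\<lambda>n. norm (LINT y|lborel. f y * Q n y)) \<longlonglongrightarrow> 0" by (rule tendsto_norm_zero)
    then show ?thesis by (simp flip: eq)
  qed
  show ?thesis
    unfolding has_derivative_at
  proof
    show "bounded_linear ?D" using lin by (simp add: linear_conv_bounded_linear)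
    show "((\<lambda>v. norm (mollify h f (x + v) - mollify h f x - ?D v) / norm v) \<longlongrightarrow> 0) (at 0)"
      unfolding tendsto_at_iff_sequentially using lim by (auto simp: comp_def)
  qed
qed

lemma mollify_continuous: "loc_integrable f \<Longrightarrow> h > 0 \<Longrightarrow> continuous_on A (mollify h f)"
  using mollify_has_derivative has_derivative_continuous
  by (fastforce intro: continuous_at_imp_continuous_on)

section \<open>Weak gradients on the punctured space\<close>

lemma mollify_eqI:
  assumes "h > 0" "\<And>y. y \<in> cbox x (x + h *\<^sub>R One) \<Longrightarrow> f y = g y"
  shows "mollify h f x = mollify h g x"
  unfolding mollify_def
  by (rule Bochner_Integration.integral_cong) (use assms mollifier_shift_support[OF assms(1)] in force)+

text \<open>The weak gradient for Borel representatives and \<open>lborel\<close>: Fubini arguments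
  and compositions with shifts are carried out there, while the function spaces are stated with
  Lebesgue measurable functions.\<close>

definition borel_weak_gradient :: "('a::euclidean_space \<Rightarrow> real) \<Rightarrow> ('a \<Rightarrow> 'a) \<Rightarrow> bool" where
  "borel_weak_gradient u G \<longleftrightarrow>
     u \<in> borel_measurable borel \<and> G \<in> borel_measurable borel \<and>
     (\<forall>K. compact K \<and> K \<subseteq> - {0} \<longrightarrow> set_integrable lborel K u \<and> set_integrable lborel K G) \<and>
     (\<forall>\<phi>\<in>test_functions (- {0}). \<forall>i\<in>Basis.
        (LINT x|lborel. u x * frechet_derivative \<phi> (at x) i) = - (LINT x|lborel. (G x \<bullet> i) * \<phi> x))"

lemma mollifier_test_function:
  assumes "h > 0" "norm (x::'a::euclidean_space) > real DIM('a) * h"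
  shows "(\<lambda>y. mollifier h (y - x)) \<in> test_functions (- {0})"
proof -
  have "{y. mollifier h (y - x) \<noteq> 0} \<subseteq> cball x (real DIM('a) * h)"
    using mollifier_eq_0[OF assms(1)] by (force simp: dist_norm norm_minus_commute)
  then have c: "closure {y. mollifier h (y - x) \<noteq> 0} \<subseteq> cball x (real DIM('a) * h)"
    by (rule closure_minimal) simp
  moreover have "0 \<notin> cball x (real DIM('a) * h)" using assms by simp
  moreover have "compact (closure {y. mollifier h (y - x) \<noteq> 0})"
    using bounded_subset[OF bounded_cball c] by (simp add: compact_eq_bounded_closed)
  ultimately show ?thesis using smooth_order_mollifier[OF assms(1)]
    by (auto simp: test_functions_def)
qed

text \<open>Removing a ball around the origin turns any compact set into a compact subset of the
  punctured space, so local integrability extends to the whole space.\<close>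

lemma loc_integrable_truncate:
  fixes u :: "'a::euclidean_space \<Rightarrow> real"
  assumes "u \<in> borel_measurable borel" "c > 0"
    "\<And>K. compact K \<Longrightarrow> K \<subseteq> - {0} \<Longrightarrow> set_integrable lborel K u"
  shows "loc_integrable (\<lambda>y. indicator {y. c \<le> norm y} y * u y)"
proof -
  have cl: "closed {y::'a. c \<le> norm y}" by (intro closed_Collect_le continuous_intros)
  have "set_integrable lborel K (\<lambda>y. indicator {y. c \<le> norm y} y * u y)" if "compact K" for K
  proof -
    have "set_integrable lborel (K \<inter> {y. c \<le> norm y}) u"
      using assms(2) cl that by (intro assms(3)) (auto intro: compact_Int_closed)
    then show ?thesis by (simp add: set_integrable_def indicator_inter_arith mult_ac)
  qed
  moreover have "(\<lambda>y. indicator {y. c \<le> norm y} y * u y) \<in> borel_measurable borel"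
    using assms(1) cl by (intro borel_measurable_times borel_measurable_indicator) auto
  ultimately show ?thesis by (simp add: loc_integrable_def)
qed

definition mollify_vec :: "real \<Rightarrow> ('a::euclidean_space \<Rightarrow> 'a) \<Rightarrow> 'a \<Rightarrow> 'a" where
  "mollify_vec h G x = (\<Sum>i\<in>Basis. mollify h (\<lambda>y. G y \<bullet> i) x *\<^sub>R i)"

lemma frechet_derivative_mollifier_shift:
  "h > 0 \<Longrightarrow> frechet_derivative (\<lambda>y. mollifier h (y - x)) (at y) i = mollifier_grad h (y - x) \<bullet> i"
proof -
  assume h: "h > 0"
  have "((\<lambda>y. mollifier h (y - x)) has_derivative (\<lambda>v. mollifier_grad h (y - x) \<bullet> v)) (at y)"
    using has_derivative_compose[OF has_derivative_diff[OF has_derivative_ident has_derivative_const[of x]], where g="mollifier h" and g'="\<lambda>v. mollifier_grad h (y - x) \<bullet> v" and x=y and s=UNIV]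
      mollifier_has_derivative[OF h, of "y - x"] by simp
  from frechet_derivative_at[OF this, symmetric] show ?thesis by simp
qed

lemma cbox_corner_norm:
  assumes "h > 0" "y \<in> cbox x (x + h *\<^sub>R One)"
  shows "norm (y - x :: 'a::euclidean_space) \<le> real DIM('a) * h"
  by (rule norm_le_of_mem_cbox[OF assms(1)])
     (use assms in \<open>auto simp: mem_box inner_diff_left inner_add_left diff_le_eq add.commute\<close>)

lemma borel_weak_gradient_truncate:
  assumes "borel_weak_gradient u G" "c > 0"
  shows "loc_integrable (\<lambda>y. indicator {y. c \<le> norm y} y * u y)"
    "loc_integrable (\<lambda>y. indicator {y. c \<le> norm y} y * (G y \<bullet> i))"
proof -
  have m[measurable]: "u \<in> borel_measurable borel" "G \<in> borel_measurable borel"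
    and K: "\<And>K. compact K \<Longrightarrow> K \<subseteq> - {0} \<Longrightarrow> set_integrable lborel K u"
      "\<And>K. compact K \<Longrightarrow> K \<subseteq> - {0} \<Longrightarrow> set_integrable lborel K G"
    using assms(1) by (auto simp: borel_weak_gradient_def)
  show "loc_integrable (\<lambda>y. indicator {y. c \<le> norm y} y * u y)"
    by (intro loc_integrable_truncate assms m K)
  have "set_integrable lborel K (\<lambda>y. G y \<bullet> i)" if "compact K" "K \<subseteq> - {0}" for K
    using integrable_inner_left[OF K(2)[OF that, unfolded set_integrable_def], of i]
    by (simp add: set_integrable_def)
  then show "loc_integrable (\<lambda>y. indicator {y. c \<le> norm y} y * (G y \<bullet> i))"
    by (intro loc_integrable_truncate assms) simp_all
qed

text \<open>If |x| > 2Nh, the kernel at x lives where |y| >= Nh. Hence truncating u below that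
  radius does not change \<open>mollify h u\<close> near x, and the shifted kernel is a test
  function on the punctured space; the derivative on the kernel is then moved to u by the definition
  of the weak gradient.\<close>

lemma C1_pair_mollify:
  fixes u :: "'a::euclidean_space \<Rightarrow> real"
  assumes w: "borel_weak_gradient u G" and h: "h > 0"
  shows "C1_pair {x. norm x > 2 * real DIM('a) * h} (mollify h u) (mollify_vec h G)"
proof -
  let ?c = "real DIM('a) * h"
  let ?S = "{x::'a. norm x > 2 * real DIM('a) * h}"
  let ?t = "\<lambda>f y. indicator {y::'a. ?c \<le> norm y} y * f y :: real"
  have c: "?c > 0" using h by simp
  have S: "open ?S" by (intro open_Collect_less continuous_intros)
  have inc: "?c \<le> norm y" if "x \<in> ?S" "y \<in> cbox x (x + h *\<^sub>R One)" for x y :: 'a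
    using cbox_corner_norm[OF h that(2)] that(1) norm_triangle_ineq3[of y x] norm_triangle_ineq2[of x y]
    by (auto simp: norm_minus_commute)
  have eq: "mollify h f x = mollify h (?t f) x" if "x \<in> ?S" for f x
    by (rule mollify_eqI[OF h]) (use inc[OF that] in auto)
  have "continuous_on ?S (mollify_vec h G)"
  proof -
    have "continuous_on ?S (\<lambda>x. \<Sum>i\<in>Basis. mollify h (?t (\<lambda>y. G y \<bullet> i)) x *\<^sub>R i)"
      by (intro continuous_intros mollify_continuous borel_weak_gradient_truncate[OF w c] h)
    then show ?thesis
      by (rule continuous_on_eq) (simp add: mollify_vec_def eq[symmetric])
  qed
  moreover have "(mollify h u has_derivative (\<lambda>v. mollify_vec h G x \<bullet> v)) (at x)" if x: "x \<in> ?S" for x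
  proof -
    let ?D = "\<lambda>v. - (LINT y|lborel. ?t u y * (mollifier_grad h (y - x) \<bullet> v))"
    have D: "(mollify h (?t u) has_derivative ?D) (at x)"
      by (intro mollify_has_derivative borel_weak_gradient_truncate[OF w c] h)
    have D2: "(mollify h u has_derivative ?D) (at x)"
      by (rule has_derivative_transform_within_open[OF D S x]) (rule eq[symmetric])
    have Di: "?D i = mollify_vec h G x \<bullet> i" if i: "i \<in> Basis" for i
    proof -
      have "(LINT y|lborel. ?t u y * (mollifier_grad h (y - x) \<bullet> i)) = (LINT y|lborel. u y * (mollifier_grad h (y - x) \<bullet> i))"
      proof (rule Bochner_Integration.integral_cong[OF refl])
        fix y
        have "mollifier_grad h (y - x) = 0" if "norm y < ?c"
          using mollifier_grad_eq_0[OF h, of "y - x"] that x norm_triangle_ineq2[of x y]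
          by (simp add: norm_minus_commute)
        then show "?t u y * (mollifier_grad h (y - x) \<bullet> i) = u y * (mollifier_grad h (y - x) \<bullet> i)"
          by (cases "norm y < ?c") auto
      qed
      also have "\<dots> = (LINT y|lborel. u y * frechet_derivative (\<lambda>y. mollifier h (y - x)) (at y) i)"
        by (simp add: frechet_derivative_mollifier_shift[OF h])
      also have "\<dots> = - (LINT y|lborel. (G y \<bullet> i) * mollifier h (y - x))"
        using w i mollifier_test_function[OF h, of x] x c unfolding borel_weak_gradient_def by auto
      finally show ?thesis using i
        by (simp add: mollify_vec_def inner_sum_left inner_Basis mollify_def if_distrib[of "\<lambda>t. _ * t"] cong: if_cong)
    qed
    interpret linear ?D using D2 by (rule has_derivative_linear)
    have "?D v = mollify_vec h G x \<bullet> v" for v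
    proof -
      have "?D v = ?D (\<Sum>i\<in>Basis. (v \<bullet> i) *\<^sub>R i)" by (simp only: euclidean_representation)
      also have "\<dots> = (\<Sum>i\<in>Basis. (v \<bullet> i) * ?D i)" by (subst sum, subst scale) (simp only: real_scaleR_def)
      also have "\<dots> = (\<Sum>i\<in>Basis. (v \<bullet> i) * (mollify_vec h G x \<bullet> i))" by (intro sum.cong refl) (simp only: Di)
      also have "\<dots> = mollify_vec h G x \<bullet> v" by (subst euclidean_inner) (simp add: mult.commute)
      finally show ?thesis .
    qed
    then have "?D = (\<lambda>v. mollify_vec h G x \<bullet> v)" by (rule ext)
    then show ?thesis using D2 by simp
  qed
  ultimately show ?thesis using S by (auto simp: C1_pair_def)
qed

text \<open>The truncations at the radii 1/(m+1) share one null set. At a point x outside it, a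
  large m and locality of \<open>mollify\<close> give the limit for f itself.\<close>

lemma mollify_tendsto_AE_punctured:
  fixes f :: "'a::euclidean_space \<Rightarrow> real"
  assumes f: "f \<in> borel_measurable borel" "\<And>K. compact K \<Longrightarrow> K \<subseteq> - {0} \<Longrightarrow> set_integrable lborel K f"
    and h: "\<And>n. h n > 0" "h \<longlonglongrightarrow> 0"
  shows "AE x in lborel. (\<lambda>n. mollify (h n) f x) \<longlonglongrightarrow> f x"
proof -
  let ?t = "\<lambda>m y. indicator {y::'a. 1 / real (Suc m) \<le> norm y} y * f y :: real"
  have "AE x in lborel. (\<lambda>n. mollify (h n) (?t m) x) \<longlonglongrightarrow> ?t m x" for m
    by (intro mollify_tendsto_AE loc_integrable_truncate f h) auto
  then have "AE x in lborel. \<forall>m. (\<lambda>n. mollify (h n) (?t m) x) \<longlonglongrightarrow> ?t m x"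
    by (simp add: AE_all_countable)
  moreover have "AE x::'a in lborel. x \<noteq> 0"
    by (rule AE_lborel_singleton)
  ultimately show ?thesis
  proof eventually_elim
    case (elim x)
    then have nx: "norm x / 2 > 0" by simp
    then obtain m where m: "1 / real (Suc m) < norm x / 2"
      using reals_Archimedean[of "norm x / 2"] by (auto simp: inverse_eq_divide)
    have "(\<lambda>n. real DIM('a) * h n) \<longlonglongrightarrow> real DIM('a) * 0" by (intro tendsto_intros h)
    from order_tendstoD(2)[OF this, of "norm x / 2"] nx
    have "eventually (\<lambda>n. real DIM('a) * h n < norm x / 2) sequentially" by simp
    then have ev: "eventually (\<lambda>n. mollify (h n) (?t m) x = mollify (h n) f x) sequentially"
    proof eventually_elim
      case (elim n)
      show ?case
      proof (rule mollify_eqI[OF h(1)])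
        fix y assume "y \<in> cbox x (x + h n *\<^sub>R One)"
        from cbox_corner_norm[OF h(1) this] elim m norm_triangle_ineq2[of x y]
        have "1 / real (Suc m) \<le> norm y" by (simp add: norm_minus_commute del: of_nat_Suc)
        then show "?t m y = f y" by simp
      qed
    qed
    have "1 / real (Suc m) \<le> norm x" using m nx by linarith
    then have eq: "?t m x = f x" by simp
    have "(\<lambda>n. mollify (h n) (?t m) x) \<longlonglongrightarrow> ?t m x" using elim by blast
    from Lim_transform_eventually[OF this ev] show ?case by (simp only: eq)
  qed
qed

lemma set_integrable_inner:
  "set_integrable lborel K (G :: 'a::euclidean_space \<Rightarrow> 'a) \<Longrightarrow> set_integrable lborel K (\<lambda>y. G y \<bullet> i)"
  using integrable_inner_left[of i lborel "\<lambda>y. indicator K y *\<^sub>R G y"]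
  by (simp add: set_integrable_def)

lemma inverse_Suc_tendsto: "(\<lambda>n. 1 / real (Suc n)) \<longlonglongrightarrow> 0"
  using LIMSEQ_inverse_real_of_nat by (simp add: inverse_eq_divide)

lemma mollify_vec_tendsto_AE:
  assumes "borel_weak_gradient u G" "\<And>n. h n > 0" "h \<longlonglongrightarrow> 0"
  shows "AE x in lborel. \<forall>i\<in>Basis. (\<lambda>n. mollify (h n) (\<lambda>y. G y \<bullet> i) x) \<longlonglongrightarrow> G x \<bullet> i"
proof (rule AE_finite_allI)
  fix i :: 'a
  have [measurable]: "G \<in> borel_measurable borel" using assms(1) by (simp add: borel_weak_gradient_def)
  show "AE x in lborel. (\<lambda>n. mollify (h n) (\<lambda>y. G y \<bullet> i) x) \<longlonglongrightarrow> G x \<bullet> i"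
    by (rule mollify_tendsto_AE_punctured)
       (use assms in \<open>auto simp: borel_weak_gradient_def intro: set_integrable_inner\<close>)
qed simp

text \<open>Shifted kernels are test functions, so both fields have the same mollifications at x as
  soon as the support avoids the origin; almost everywhere these converge to the fields.\<close>

lemma borel_weak_gradient_unique:
  fixes u :: "'a::euclidean_space \<Rightarrow> real"
  assumes 1: "borel_weak_gradient u G" and 2: "borel_weak_gradient u G'"
  shows "AE x in lborel. G x = G' x"
proof -
  let ?h = "\<lambda>n. 1 / real (Suc n)"
  have h: "?h n > 0" for n by simp
  have "AE x::'a in lborel. x \<noteq> 0" by (rule AE_lborel_singleton)
  with mollify_vec_tendsto_AE[OF 1 h inverse_Suc_tendsto] mollify_vec_tendsto_AE[OF 2 h inverse_Suc_tendsto]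
  show ?thesis
  proof eventually_elim
    case (elim x)
    have "G x \<bullet> i = G' x \<bullet> i" if i: "i \<in> Basis" for i
    proof (rule LIMSEQ_unique)
      show "(\<lambda>n. mollify (?h n) (\<lambda>y. G' y \<bullet> i) x) \<longlonglongrightarrow> G' x \<bullet> i" using elim i by blast
      have "(\<lambda>n. real DIM('a) * ?h n) \<longlonglongrightarrow> real DIM('a) * 0" by (intro tendsto_intros inverse_Suc_tendsto)
      from order_tendstoD(2)[OF this, of "norm x"] elim(3)
      have "eventually (\<lambda>n. real DIM('a) * ?h n < norm x) sequentially" by simp
      then have "eventually (\<lambda>n. mollify (?h n) (\<lambda>y. G y \<bullet> i) x = mollify (?h n) (\<lambda>y. G' y \<bullet> i) x) sequentially"
      proof eventually_elim
        case (elim n)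
        from mollifier_test_function[OF h elim]
        have "- (LINT y|lborel. (G y \<bullet> i) * mollifier (?h n) (y - x)) = - (LINT y|lborel. (G' y \<bullet> i) * mollifier (?h n) (y - x))"
          using 1 2 i unfolding borel_weak_gradient_def by fastforce
        then show ?case by (simp add: mollify_def)
      qed
      moreover have "(\<lambda>n. mollify (?h n) (\<lambda>y. G y \<bullet> i) x) \<longlonglongrightarrow> G x \<bullet> i" using elim i by blast
      ultimately show "(\<lambda>n. mollify (?h n) (\<lambda>y. G' y \<bullet> i) x) \<longlonglongrightarrow> G x \<bullet> i"
        by (rule Lim_transform_eventually[rotated])
    qed
    then show ?case by (simp add: euclidean_eq_iff[of "G x"])
  qed
qed

section \<open>Borel representatives of Lebesgue measurable functions\<close>

lemma L1_loc_measurable: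
  fixes u :: "'a::euclidean_space \<Rightarrow> 'b::euclidean_space"
  assumes "u \<in> L1_loc (- {0})"
  shows "u \<in> borel_measurable lebesgue"
proof -
  let ?K = "\<lambda>n. {x::'a. 1 / real (Suc n) \<le> norm x \<and> norm x \<le> real (Suc n)}"
  have K: "compact (?K n)" "?K n \<subseteq> - {0}" for n
  proof -
    have "?K n = cball 0 (real (Suc n)) \<inter> {x. 1 / real (Suc n) \<le> norm x}" by auto
    moreover have "closed {x::'a. 1 / real (Suc n) \<le> norm x}"
      by (intro closed_Collect_le continuous_intros)
    ultimately show "compact (?K n)" by (metis compact_Int_closed compact_cball)
    show "?K n \<subseteq> - {0}" by (auto simp: field_simps)
  qed
  have 1: "(\<lambda>x. indicator (?K n) x *\<^sub>R u x) \<in> borel_measurable lebesgue" for n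
    using assms K unfolding L1_loc_def set_integrable_def by (blast intro: borel_measurable_integrable)
  have "(\<lambda>x. indicator (- {0}) x *\<^sub>R u x) \<in> borel_measurable lebesgue"
  proof (rule borel_measurable_LIMSEQ_metric[OF 1])
    fix x :: 'a
    show "(\<lambda>n. indicator (?K n) x *\<^sub>R u x) \<longlonglongrightarrow> indicator (- {0}) x *\<^sub>R u x"
    proof (cases "x = 0")
      case True then show ?thesis by (simp add: indicator_def)
    next
      case False
      have "eventually (\<lambda>n. 1 / real (Suc n) < norm x) sequentially"
        using order_tendstoD(2)[OF inverse_Suc_tendsto] False by simp
      moreover have "eventually (\<lambda>n. norm x \<le> real (Suc n)) sequentially"
      proof -
        obtain k where "norm x \<le> real k" using real_arch_simple by blast
        then show ?thesis by (intro eventually_sequentiallyI[of k]) simp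
      qed
      ultimately have "eventually (\<lambda>n. indicator (- {0}) x *\<^sub>R u x = indicator (?K n) x *\<^sub>R u x) sequentially"
        by eventually_elim (use False in \<open>auto simp: indicator_def\<close>)
      then show ?thesis by (rule Lim_transform_eventually[OF tendsto_const])
    qed
  qed
  \<comment> \<open>The compact shells exhaust only the punctured space; the value at the origin is
    put back by hand.\<close>
  then have "(\<lambda>x. indicator (- {0}) x *\<^sub>R u x + indicator {0} x *\<^sub>R u 0) \<in> borel_measurable lebesgue"
    by (rule borel_measurable_add) (intro borel_measurable_scaleR borel_measurable_indicator, auto)
  also have "(\<lambda>x. indicator (- {0}) x *\<^sub>R u x + indicator {0} x *\<^sub>R u 0) = u"
    by (auto simp: fun_eq_iff indicator_def)
  finally show ?thesis .
qed

lemma ex_borel_representative: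
  fixes u :: "'a::euclidean_space \<Rightarrow> 'b::euclidean_space"
  assumes "u \<in> borel_measurable lebesgue"
  shows "\<exists>u'. u' \<in> borel_measurable borel \<and> (AE x in lborel. u x = u' x)"
proof -
  have "\<exists>g. g \<in> borel_measurable lborel \<and> (AE x in lborel. u x \<bullet> i = g x)" for i
  proof -
    have "(\<lambda>x. u x \<bullet> i) \<in> borel_measurable lebesgue"
      using assms by (intro borel_measurable_inner) auto
    from completion_ex_borel_measurable_real[OF this] show ?thesis by blast
  qed
  then have "\<forall>i. \<exists>g. g \<in> borel_measurable lborel \<and> (AE x in lborel. u x \<bullet> i = g x)" by blast
  from choice[OF this] obtain g where
    g: "\<And>i. g i \<in> borel_measurable lborel" "\<And>i. AE x in lborel. u x \<bullet> i = g i x"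
    by blast
  have "AE x in lborel. \<forall>i\<in>Basis. u x \<bullet> i = g i x"
    by (rule AE_finite_allI) (use g in auto)
  then have "AE x in lborel. u x = (\<Sum>i\<in>Basis. g i x *\<^sub>R i)"
  proof eventually_elim
    case (elim x)
    have "(\<Sum>i\<in>Basis. g i x *\<^sub>R i) = (\<Sum>i\<in>Basis. (u x \<bullet> i) *\<^sub>R i)" using elim by simp
    then show ?case by (simp only: euclidean_representation)
  qed
  moreover have "(\<lambda>x. \<Sum>i\<in>Basis. g i x *\<^sub>R i) \<in> borel_measurable borel"
    using g(1) by simp
  ultimately show ?thesis by blast
qed

lemma L1_loc_representative:
  fixes u u' :: "'a::euclidean_space \<Rightarrow> 'b::euclidean_space"
  assumes u: "u \<in> L1_loc (- {0})" and ae: "AE x in lborel. u x = u' x"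
    and u': "u' \<in> borel_measurable borel" and K: "compact K" "K \<subseteq> - {0}"
  shows "set_integrable lborel K u'"
proof -
  have ae': "AE x in lebesgue. u x = u' x" using ae by (rule AE_completion)
  have "integrable lebesgue (\<lambda>x. indicator K x *\<^sub>R u x)"
    using u K by (auto simp: L1_loc_def set_integrable_def)
  then have "integrable lebesgue (\<lambda>x. indicator K x *\<^sub>R u' x)"
    by (rule integrable_cong_AE_imp)
      (use u' borel_compact[OF K(1)] ae' in \<open>auto intro!: borel_measurable_scaleR borel_measurable_indicator measurable_completion elim!: eventually_mono\<close>)
  then show ?thesis
    using u' borel_compact[OF K(1)] by (subst (asm) integrable_completion) (auto simp: set_integrable_def intro!: borel_measurable_scaleR borel_measurable_indicator)
qed

lemma smooth_order_measurable: "smooth_order k f \<Longrightarrow> f \<in> borel_measurable borel"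
proof (cases k)
  case 0 then show "smooth_order k f \<Longrightarrow> ?thesis" by (auto intro: borel_measurable_continuous_onI)
next
  case (Suc n) then show "smooth_order k f \<Longrightarrow> ?thesis"
    by (intro borel_measurable_continuous_onI differentiable_imp_continuous_on)
       (auto simp: differentiable_on_def intro: differentiable_at_withinI)
qed

text \<open>A change on null sets affects neither side of the defining identity, and for Borel
  integrands the integrals over \<open>lebesgue\<close> and \<open>lborel\<close> agree.\<close>

lemma borel_weak_gradient_of_distributional:
  fixes u u' :: "'a::euclidean_space \<Rightarrow> real"
  assumes d: "has_distributional_gradient (- {0}) u G"
    and u': "u' \<in> borel_measurable borel" "AE x in lborel. u x = u' x"
    and G': "G' \<in> borel_measurable borel" "AE x in lborel. G x = G' x"
  shows "borel_weak_gradient u' G'"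
proof -
  have uL: "u \<in> L1_loc (- {0})" "G \<in> L1_loc (- {0})"
    using d by (auto simp: has_distributional_gradient_def)
  note [measurable] = u'(1) G'(1)
  have "(LINT x|lborel. u' x * frechet_derivative \<phi> (at x) i) = - (LINT x|lborel. (G' x \<bullet> i) * \<phi> x)"
    if \<phi>: "\<phi> \<in> test_functions (- {0})" and i: "i \<in> Basis" for \<phi> i
  proof -
    have s: "smooth_order (Suc 0) \<phi>" using \<phi> unfolding test_functions_def by blast
    have m1[measurable]: "\<phi> \<in> borel_measurable borel" by (rule smooth_order_measurable[OF s])
    have m2[measurable]: "(\<lambda>x. frechet_derivative \<phi> (at x) i) \<in> borel_measurable borel"
      using s by (intro smooth_order_measurable[of 0]) simp
    note ml = measurable_completion[of _ lborel borel, simplified]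
    note L = L1_loc_measurable[OF uL(1)] L1_loc_measurable[OF uL(2)]
    have 1: "integral\<^sup>L lebesgue (\<lambda>x. u x * frechet_derivative \<phi> (at x) i) = integral\<^sup>L lebesgue (\<lambda>x. u' x * frechet_derivative \<phi> (at x) i)"
      by (rule integral_cong_AE)
         (use AE_completion[OF u'(2)] in
           \<open>auto intro!: borel_measurable_times L ml[OF m2] ml[OF u'(1)] elim!: eventually_mono\<close>)
    have 2: "integral\<^sup>L lebesgue (\<lambda>x. (G x \<bullet> i) * \<phi> x) = integral\<^sup>L lebesgue (\<lambda>x. (G' x \<bullet> i) * \<phi> x)"
      by (rule integral_cong_AE)
         (use AE_completion[OF G'(2)] in
           \<open>auto intro!: borel_measurable_times borel_measurable_inner L ml[OF m1] ml[OF G'(1)] elim!: eventually_mono\<close>)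
    have "integral\<^sup>L lebesgue (\<lambda>x. u x * frechet_derivative \<phi> (at x) i) = - integral\<^sup>L lebesgue (\<lambda>x. (G x \<bullet> i) * \<phi> x)"
      using d \<phi> i unfolding has_distributional_gradient_def by blast
    then show ?thesis unfolding 1 2 by (simp add: integral_completion)
  qed
  then show ?thesis
    using L1_loc_representative[OF uL(1) u'(2,1)] L1_loc_representative[OF uL(2) G'(2,1)] u' G'
    by (auto simp: borel_weak_gradient_def)
qed

lemma distributional_gradient_unique:
  fixes u :: "'a::euclidean_space \<Rightarrow> real"
  assumes 1: "has_distributional_gradient (- {0}) u G" and 2: "has_distributional_gradient (- {0}) u H"
  shows "AE x in lborel. G x = H x"
proof -
  have L: "u \<in> L1_loc (- {0})" "G \<in> L1_loc (- {0})" "H \<in> L1_loc (- {0})"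
    using 1 2 by (simp_all add: has_distributional_gradient_def)
  obtain u' where u': "u' \<in> borel_measurable borel" "AE x in lborel. u x = u' x" 
    using ex_borel_representative[OF L1_loc_measurable[OF L(1)]] by blast
  obtain G' where G': "G' \<in> borel_measurable borel" "AE x in lborel. G x = G' x" 
    using ex_borel_representative[OF L1_loc_measurable[OF L(2)]] by blast
  obtain H' where H': "H' \<in> borel_measurable borel" "AE x in lborel. H x = H' x" 
    using ex_borel_representative[OF L1_loc_measurable[OF L(3)]] by blast
  have "AE x in lborel. G' x = H' x"
    by (rule borel_weak_gradient_unique[OF borel_weak_gradient_of_distributional[OF 1 u' G']
        borel_weak_gradient_of_distributional[OF 2 u' H']])
  with G'(2) H'(2) show ?thesis by eventually_elim simp
qed

section \<open>Bounds for mollified functions\<close>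

lemma nn_integral_shift_lborel:
  fixes f :: "'a::euclidean_space \<Rightarrow> ennreal"
  assumes [measurable]: "f \<in> borel_measurable borel"
  shows "(\<integral>\<^sup>+x. f (t + x) \<partial>lborel) = (\<integral>\<^sup>+x. f x \<partial>lborel)"
proof -
  have "(\<integral>\<^sup>+x. f x \<partial>lborel) = (\<integral>\<^sup>+x. f x \<partial>distr lborel borel (\<lambda>x. t + x))"
    by (subst lborel_distr_plus) simp
  also have "\<dots> = (\<integral>\<^sup>+x. f (t + x) \<partial>lborel)" by (rule nn_integral_distr) auto
  finally show ?thesis by simp
qed

lemma nn_integral_scale_lborel:
  fixes f :: "'a::euclidean_space \<Rightarrow> ennreal"
  assumes [measurable]: "f \<in> borel_measurable borel" and c: "c \<noteq> 0"
  shows "(\<integral>\<^sup>+x. f x \<partial>lborel) = ennreal (\<bar>c\<bar> ^ DIM('a)) * (\<integral>\<^sup>+x. f (t + c *\<^sub>R x) \<partial>lborel)"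
proof -
  have "(\<integral>\<^sup>+x. f x \<partial>lborel) = (\<integral>\<^sup>+x. f x \<partial>density (distr lborel borel (\<lambda>x. t + c *\<^sub>R x)) (\<lambda>_. ennreal (\<bar>c\<bar> ^ DIM('a))))"
    using lborel_affine[OF c, of t] by (simp add: ennreal_power)
  also have "\<dots> = ennreal (\<bar>c\<bar> ^ DIM('a)) * (\<integral>\<^sup>+x. f x \<partial>distr lborel borel (\<lambda>x. t + c *\<^sub>R x))"
    by (simp add: nn_integral_density nn_integral_cmult)
  also have "(\<integral>\<^sup>+x. f x \<partial>distr lborel borel (\<lambda>x. t + c *\<^sub>R x)) = (\<integral>\<^sup>+x. f (t + c *\<^sub>R x) \<partial>lborel)"
    by (rule nn_integral_distr) auto
  finally show ?thesis .
qed

lemma nn_integral_mollifier: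
  assumes "h > 0"
  shows "(\<integral>\<^sup>+z. ennreal (mollifier h (z::'a::euclidean_space)) \<partial>lborel) = 1"
  using nn_integral_eq_integral[OF mollifier_integrable_integral(1)[OF assms, where 'a='a]]
    mollifier_integrable_integral(2)[OF assms, where 'a='a] mollifier_nonneg[OF assms, where 'a='a] by simp

text \<open>The weight |x|^b changes at most by the factor 2^|b| between points of comparable norm,
  whatever the sign of b. All weights are moved between nearby points in this way.\<close>

lemma powr_abs_le_of_ratio:
  assumes "x > 0" "y > 0" "x \<le> 2 * y" "y \<le> 2 * (x::real)"
  shows "x powr b \<le> 2 powr \<bar>b\<bar> * y powr b"
proof (cases "b \<ge> 0")
  case True
  have "x powr b \<le> (2 * y) powr b" using assms True by (intro powr_mono2) auto
  then show ?thesis using assms True by (simp add: powr_mult)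
next
  case False
  have "x powr b \<le> (y / 2) powr b" using assms False by (intro powr_mono2') auto
  then show ?thesis using assms False by (simp add: powr_divide powr_minus_divide)
qed

text \<open>The kernel at x sees only points with |y| >= |x|/2, which costs the factor 2^a.\<close>

lemma mollify_abs_bound:
  fixes u :: "'a::euclidean_space \<Rightarrow> real"
  assumes u: "AE y in lborel. \<bar>u y\<bar> \<le> M * norm y powr (- a)" and a: "a \<ge> 0" and h: "h > 0" and M: "M \<ge> 0"
    and x: "norm x > 2 * real DIM('a) * h"
  shows "\<bar>mollify h u x\<bar> \<le> 2 powr a * M * norm x powr (- a)"
proof -
  let ?B = "2 powr a * M * norm x powr (- a)"
  have x0: "norm x > 0" using x h by (smt (verit) mult_nonneg_nonneg of_nat_0_le_iff)
  have "\<bar>mollify h u x\<bar> \<le> (LINT y|lborel. \<bar>u y * mollifier h (y - x)\<bar>)"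
    unfolding mollify_def by (rule integral_abs_bound)
  also have "\<dots> \<le> (LINT y|lborel. ?B * mollifier h (y - x))"
  proof (rule integral_mono_AE')
    show "integrable lborel (\<lambda>y. ?B * mollifier h (y - x))"
      by (intro integrable_mult_right integrable_mollifier_shift h)
    show "AE y in lborel. \<bar>u y * mollifier h (y - x)\<bar> \<le> ?B * mollifier h (y - x)"
      using u
    proof eventually_elim
      case (elim y)
      show ?case
      proof (cases "mollifier h (y - x) = 0")
        case False
        then have "norm (y - x) \<le> real DIM('a) * h" using mollifier_support_norm[OF h] by blast
        then have y: "norm x / 2 \<le> norm y" using x norm_triangle_ineq2[of x y]
          by (simp add: norm_minus_commute)
        have "norm y powr (- a) \<le> (norm x / 2) powr (- a)"
          using y x0 a by (intro powr_mono2') auto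
        also have "\<dots> = 2 powr a * norm x powr (- a)"
          using x0 by (simp add: powr_divide powr_minus_divide)
        finally have "M * norm y powr (- a) \<le> ?B" using M by (simp add: mult_left_mono mult_ac)
        then have "\<bar>u y\<bar> \<le> ?B" using elim by linarith
        then show ?thesis using mollifier_nonneg[OF h, of "y - x"]
          by (simp add: abs_mult mult_right_mono)
      qed simp
    qed
    show "AE y in lborel. 0 \<le> ?B * mollifier h (y - x)"
      using M mollifier_nonneg[OF h, where 'a='a] by (intro AE_I2) simp
  qed
  also have "\<dots> = ?B" by (simp add: integral_mollifier_shift[OF h])
  finally show ?thesis .
qed

lemma le_powr_add_1: "0 \<le> t \<Longrightarrow> 1 \<le> p \<Longrightarrow> t \<le> t powr p + (1::real)"
  using powr_mono[of 1 p t] by (cases "t \<le> 1") (auto simp: add_increasing)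

text \<open>A Jensen inequality with a spurious factor \<open>2\<close>, from \<open>t \<le> t\<^sup>p + 1\<close>.\<close>

lemma nn_integral_jensen_powr:
  assumes [measurable]: "g \<in> borel_measurable M" "k \<in> borel_measurable M"
    and g: "\<And>x. 0 \<le> g x" and k: "\<And>x. 0 \<le> k x" "(\<integral>\<^sup>+x. ennreal (k x) \<partial>M) = 1"
    and p: "1 \<le> p" and B: "0 < B" "(\<integral>\<^sup>+x. ennreal (g x powr p * k x) \<partial>M) \<le> ennreal B"
  shows "(\<integral>\<^sup>+x. ennreal (g x * k x) \<partial>M) \<le> ennreal (2 * B powr (1 / p))"
proof -
  let ?c = "B powr (1 / p)"
  have c: "?c > 0" "?c powr p = B" using B p by (auto simp: powr_powr)
  have "g x * k x \<le> ?c * ((g x powr p * k x) / B + k x)" for x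
  proof -
    have "g x / ?c \<le> (g x / ?c) powr p + 1" using g c p by (intro le_powr_add_1) auto
    also have "(g x / ?c) powr p = g x powr p / B" using g c by (simp add: powr_divide)
    finally have "g x \<le> ?c * (g x powr p / B + 1)" using c by (simp add: field_simps)
    from mult_right_mono[OF this k(1)[of x]] show ?thesis by (simp add: algebra_simps)
  qed
  then have "(\<integral>\<^sup>+x. ennreal (g x * k x) \<partial>M) \<le> (\<integral>\<^sup>+x. ennreal (?c / B) * ennreal (g x powr p * k x) + ennreal ?c * ennreal (k x) \<partial>M)"
    using g k c B by (intro nn_integral_mono)
      (auto simp: ennreal_mult[symmetric] ennreal_plus[symmetric] simp del: ennreal_plus intro!: ennreal_leI, simp add: algebra_simps)
  also have "\<dots> = ennreal (?c / B) * (\<integral>\<^sup>+x. ennreal (g x powr p * k x) \<partial>M) + ennreal ?c"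
    by (simp add: nn_integral_add nn_integral_cmult k)
  also have "\<dots> \<le> ennreal (?c / B) * ennreal B + ennreal ?c"
    using B by (intro add_right_mono mult_left_mono) auto
  also have "\<dots> = ennreal (2 * ?c)"
    using B c by (simp add: ennreal_mult[symmetric] ennreal_plus[symmetric] del: ennreal_plus)
  finally show ?thesis .
qed

text \<open>Jensen's inequality for each coordinate. In the constant, the 2 is the loss in that
  inequality and the dimension comes from adding up the coordinates.\<close>

lemma mollify_vec_norm_bound:
  fixes G :: "'a::euclidean_space \<Rightarrow> 'a"
  assumes [measurable]: "G \<in> borel_measurable borel" and h: "h > 0" and p: "1 \<le> p"
  shows "ennreal (norm (mollify_vec h G x) powr p) \<le>
     ennreal ((2 * real DIM('a)) powr p) * (\<integral>\<^sup>+y. ennreal (norm (G y) powr p * mollifier h (y - x)) \<partial>lborel)"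
proof -
  note [measurable] = mollifier_measurable[OF h]
  let ?A = "\<integral>\<^sup>+y. ennreal (norm (G y) powr p * mollifier h (y - x)) \<partial>lborel"
  let ?N = "real DIM('a)"
  have nn1: "(\<integral>\<^sup>+y. ennreal (mollifier h (y - x)) \<partial>lborel) = 1"
    using nn_integral_shift_lborel[of "\<lambda>y. ennreal (mollifier h y)" "- x"] nn_integral_mollifier[OF h, where 'a='a]
    by (simp add: algebra_simps)
  show ?thesis
  proof (cases "?A = \<infinity>")
    case True
    then show ?thesis using p by (simp add: ennreal_mult_top)
  next
    case False
    then obtain A where A: "?A = ennreal A" "A \<ge> 0" by (cases ?A) auto
    \<comment> \<open>The Jensen inequality asks for a positive bound, but the integral
      \<open>A\<close> may vanish; hence a small \<open>e\<close> that tends to 0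
      afterwards.\<close>
    have "norm (mollify_vec h G x) powr p \<le> (2 * ?N) powr p * (A + e)" if e: "e > 0" for e
    proof -
      let ?B = "A + e"
      have B: "?B > 0" using A e by simp
      have J: "(\<integral>\<^sup>+y. ennreal (norm (G y) * mollifier h (y - x)) \<partial>lborel) \<le> ennreal (2 * ?B powr (1 / p))"
        by (rule nn_integral_jensen_powr)
          (use p B A e mollifier_nonneg[OF h, where 'a='a] nn1 in \<open>auto simp: ennreal_leI\<close>)
      have "\<bar>mollify h (\<lambda>y. G y \<bullet> i) x\<bar> \<le> 2 * ?B powr (1 / p)" if i: "i \<in> Basis" for i
      proof -
        have "ennreal \<bar>mollify h (\<lambda>y. G y \<bullet> i) x\<bar> \<le> (\<integral>\<^sup>+y. ennreal (norm ((G y \<bullet> i) * mollifier h (y - x))) \<partial>lborel)"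
          unfolding mollify_def
          using integral_norm_bound_ennreal[of lborel "\<lambda>y. (G y \<bullet> i) * mollifier h (y - x)"]
          by (cases "integrable lborel (\<lambda>y. (G y \<bullet> i) * mollifier h (y - x))")
            (simp_all add: not_integrable_integral_eq)
        also have "\<dots> \<le> (\<integral>\<^sup>+y. ennreal (norm (G y) * mollifier h (y - x)) \<partial>lborel)"
          using mollifier_nonneg[OF h, where 'a='a] Basis_le_norm[OF i]
          by (intro nn_integral_mono ennreal_leI) (auto simp: abs_mult intro!: mult_right_mono)
        also note J
        finally show ?thesis by (subst (asm) ennreal_le_iff) auto
      qed
      then have "(\<Sum>i\<in>(Basis::'a set). \<bar>mollify h (\<lambda>y. G y \<bullet> i) x\<bar>) \<le> (\<Sum>i\<in>(Basis::'a set). 2 * ?B powr (1 / p))"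
        by (rule sum_mono)
      moreover have "norm (mollify_vec h G x) \<le> (\<Sum>i\<in>Basis. \<bar>mollify h (\<lambda>y. G y \<bullet> i) x\<bar>)"
        unfolding mollify_vec_def by (rule order_trans[OF norm_sum]) simp
      ultimately have "norm (mollify_vec h G x) \<le> (2 * ?N) * ?B powr (1 / p)" by simp
      then have "norm (mollify_vec h G x) powr p \<le> ((2 * ?N) * ?B powr (1 / p)) powr p"
        using p by (intro powr_mono2) auto
      also have "\<dots> = (2 * ?N) powr p * ?B" using p B by (simp add: powr_mult powr_powr)
      finally show ?thesis .
    qed
    then have lim: "norm (mollify_vec h G x) powr p \<le> (2 * ?N) powr p * A + (2 * ?N) powr p * e" if "e > 0" for e
      using that by (simp add: ring_distribs)
    have "norm (mollify_vec h G x) powr p \<le> (2 * ?N) powr p * A"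
    proof (rule field_le_epsilon)
      fix e :: real assume "e > 0"
      have k: "(2 * ?N) powr p > 0" by simp
      show "norm (mollify_vec h G x) powr p \<le> (2 * ?N) powr p * A + e"
        using lim[of "e / (2 * ?N) powr p"] \<open>e > 0\<close> k by (simp add: field_simps)
    qed
    then show ?thesis using A by (simp add: ennreal_mult[symmetric] ennreal_leI)
  qed
qed

text \<open>On the support of the kernel |z| <= |x|/2, so the weights at x and x + z are comparable.
  With the weight moved to x + z, Fubini and translation invariance leave the integral of the
  kernel, which is 1.\<close>

lemma mollify_vec_weighted_bound:
  fixes G :: "'a::euclidean_space \<Rightarrow> 'a"
  assumes [measurable]: "G \<in> borel_measurable borel" and h: "h > 0" and p: "1 \<le> p"
  shows "(\<integral>\<^sup>+x. indicator {x. norm x > 2 * real DIM('a) * h} x * ennreal (norm x powr b * norm (mollify_vec h G x) powr p) \<partial>lborel)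
     \<le> ennreal ((2 * real DIM('a)) powr p * 2 powr \<bar>b\<bar>) * (\<integral>\<^sup>+y. ennreal (norm y powr b * norm (G y) powr p) \<partial>lborel)"
proof -
  note [measurable] = mollifier_measurable[OF h]
  let ?S = "{x::'a. norm x > 2 * real DIM('a) * h}"
  let ?K = "(2 * real DIM('a)) powr p"
  let ?F = "\<lambda>y. norm y powr b * norm (G y) powr p"
  have "(\<integral>\<^sup>+x. indicator ?S x * ennreal (norm x powr b * norm (mollify_vec h G x) powr p) \<partial>lborel)
    \<le> (\<integral>\<^sup>+x. ennreal (?K * 2 powr \<bar>b\<bar>) * (\<integral>\<^sup>+z. ennreal (?F (x + z) * mollifier h z) \<partial>lborel) \<partial>lborel)"
  proof (rule nn_integral_mono)
    fix x :: 'a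
    show "indicator ?S x * ennreal (norm x powr b * norm (mollify_vec h G x) powr p)
      \<le> ennreal (?K * 2 powr \<bar>b\<bar>) * (\<integral>\<^sup>+z. ennreal (?F (x + z) * mollifier h z) \<partial>lborel)"
    proof (cases "x \<in> ?S")
      case True
      have x0: "norm x > 0" using True h by (smt (verit) mult_nonneg_nonneg of_nat_0_le_iff mem_Collect_eq)
      have "indicator ?S x * ennreal (norm x powr b * norm (mollify_vec h G x) powr p) =
        ennreal (norm x powr b) * ennreal (norm (mollify_vec h G x) powr p)"
        using True by (simp add: ennreal_mult)
      also have "\<dots> \<le> ennreal (norm x powr b) * (ennreal ?K * (\<integral>\<^sup>+y. ennreal (norm (G y) powr p * mollifier h (y - x)) \<partial>lborel))"
        by (intro mult_left_mono mollify_vec_norm_bound h p) auto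
      also have "(\<integral>\<^sup>+y. ennreal (norm (G y) powr p * mollifier h (y - x)) \<partial>lborel) = (\<integral>\<^sup>+z. ennreal (norm (G (x + z)) powr p * mollifier h z) \<partial>lborel)"
        using nn_integral_shift_lborel[of "\<lambda>y. ennreal (norm (G y) powr p * mollifier h (y - x))" x] by simp
      also have "ennreal (norm x powr b) * (ennreal ?K * (\<integral>\<^sup>+z. ennreal (norm (G (x + z)) powr p * mollifier h z) \<partial>lborel))
         = (\<integral>\<^sup>+z. ennreal (norm x powr b * ?K * (norm (G (x + z)) powr p * mollifier h z)) \<partial>lborel)"
        using mollifier_nonneg[OF h, where 'a='a]
        by (subst mult.assoc[symmetric], subst ennreal_mult[symmetric], simp, simp, subst nn_integral_cmult[symmetric])
           (auto intro!: nn_integral_cong ennreal_mult[symmetric] mult_nonneg_nonneg)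
      also have "\<dots> \<le> (\<integral>\<^sup>+z. ennreal (?K * 2 powr \<bar>b\<bar> * (?F (x + z) * mollifier h z)) \<partial>lborel)"
      proof (intro nn_integral_mono ennreal_leI)
        fix z :: 'a
        show "norm x powr b * ?K * (norm (G (x + z)) powr p * mollifier h z) \<le> ?K * 2 powr \<bar>b\<bar> * (?F (x + z) * mollifier h z)"
        proof (cases "mollifier h z = 0")
          case False
          then have z: "norm z \<le> real DIM('a) * h" using mollifier_support_norm[OF h] by blast
          have "norm x powr b \<le> 2 powr \<bar>b\<bar> * norm (x + z) powr b"
          proof (rule powr_abs_le_of_ratio)
            show "norm x \<le> 2 * norm (x + z)" using z True norm_diff_ineq[of x z] by simp
            then show "norm (x + z) > 0" using x0 by linarith
            have "2 * norm z \<le> norm x" using z True by simp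
            then show "norm (x + z) \<le> 2 * norm x" using norm_triangle_ineq[of x z] norm_ge_zero[of x] by linarith
          qed (use x0 in simp)
          then have "norm x powr b * (?K * (norm (G (x + z)) powr p * mollifier h z)) \<le> (2 powr \<bar>b\<bar> * norm (x + z) powr b) * (?K * (norm (G (x + z)) powr p * mollifier h z))"
            using mollifier_nonneg[OF h, where 'a='a] by (intro mult_right_mono) auto
          then show ?thesis by (simp add: mult_ac)
        qed simp
      qed
      also have "\<dots> = ennreal (?K * 2 powr \<bar>b\<bar>) * (\<integral>\<^sup>+z. ennreal (?F (x + z) * mollifier h z) \<partial>lborel)"
        using mollifier_nonneg[OF h, where 'a='a]
        by (subst nn_integral_cmult[symmetric]) (auto simp: ennreal_mult intro!: nn_integral_cong)
      finally show ?thesis .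
    qed simp
  qed
  also have "\<dots> = ennreal (?K * 2 powr \<bar>b\<bar>) * (\<integral>\<^sup>+x. (\<integral>\<^sup>+z. ennreal (?F (x + z) * mollifier h z) \<partial>lborel) \<partial>lborel)"
    by (rule nn_integral_cmult) measurable
  also have "(\<integral>\<^sup>+x. (\<integral>\<^sup>+z. ennreal (?F (x + z) * mollifier h z) \<partial>lborel) \<partial>lborel)
     = (\<integral>\<^sup>+z. (\<integral>\<^sup>+x. ennreal (?F (x + z) * mollifier h z) \<partial>lborel) \<partial>lborel)"
    by (rule lborel_pair.Fubini'[symmetric]) measurable
  also have "\<dots> = (\<integral>\<^sup>+z. (\<integral>\<^sup>+x. ennreal (?F x) \<partial>lborel) * ennreal (mollifier h (z::'a)) \<partial>lborel)"
  proof (rule nn_integral_cong)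
    fix z :: 'a
    have "(\<integral>\<^sup>+x. ennreal (?F (x + z) * mollifier h z) \<partial>lborel) = (\<integral>\<^sup>+x. ennreal (?F (z + x)) * ennreal (mollifier h z) \<partial>lborel)"
      by (rule nn_integral_cong) (simp add: ennreal_mult mollifier_nonneg[OF h, where 'a='a] add.commute)
    also have "\<dots> = (\<integral>\<^sup>+x. ennreal (?F (z + x)) \<partial>lborel) * ennreal (mollifier h z)"
      by (rule nn_integral_multc) measurable
    also have "(\<integral>\<^sup>+x. ennreal (?F (z + x)) \<partial>lborel) = (\<integral>\<^sup>+x. ennreal (?F x) \<partial>lborel)"
      by (rule nn_integral_shift_lborel) measurable
    finally show "(\<integral>\<^sup>+x. ennreal (?F (x + z) * mollifier h z) \<partial>lborel) = (\<integral>\<^sup>+x. ennreal (?F x) \<partial>lborel) * ennreal (mollifier h z)" .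
  qed
  also have "\<dots> = (\<integral>\<^sup>+x. ennreal (?F x) \<partial>lborel)"
    by (subst nn_integral_cmult) (auto simp: nn_integral_mollifier[OF h])
  finally show ?thesis .
qed

subsection \<open>A weak type Sobolev inequality\<close>

text \<open>\<open>g s\<close> stands for the measure of the directions v with z - s v in a set of
  measure \<open>m\<close>: it is at most the measure \<open>a\<close> of all directions, and at
  most m/s^N by scaling. Interpolating the two bounds gives a^(1-\<kappa>) (m/s^N)^\<kappa>,
  integrable near 0 when N\<kappa> < 1. At the endpoint N\<kappa> = 1 this diverges logarithmically,
  and the integral is split instead. It matters that the constant is chosen before \<open>m\<close>,
  \<open>L\<close> and \<open>g\<close>.\<close>

lemma ray_integral_bound:
  fixes N :: nat and \<kappa> a :: real
  assumes N: "N \<ge> 1" and \<kappa>: "0 \<le> \<kappa>" "\<kappa> < 1" "real N * \<kappa> \<le> 1" and a: "a > 0"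
  shows "\<exists>C>0. \<forall>m>0. \<forall>L>0. \<forall>g::real \<Rightarrow> ennreal. (\<forall>s. g s \<le> ennreal a) \<longrightarrow> (\<forall>s>0. g s \<le> ennreal (m / s ^ N)) \<longrightarrow>
    (\<integral>\<^sup>+s. indicator {0..L} s * g s \<partial>lborel) \<le> ennreal (C * L powr (1 - real N * \<kappa>) * m powr \<kappa>)"
proof (cases "real N * \<kappa> = 1")
  case False
  then have k: "real N * \<kappa> < 1" using \<kappa> by simp
  let ?e = "1 - real N * \<kappa>"
  have e: "?e > 0" using k by simp
  let ?C = "a powr (1 - \<kappa>) / ?e"
  show ?thesis
  proof (intro exI[of _ ?C] conjI allI impI)
    show "?C > 0" using a e by simp
    fix m L :: real and g :: "real \<Rightarrow> ennreal"
    assume m: "m > 0" and L: "L > 0" and g1: "\<forall>s. g s \<le> ennreal a" and g2: "\<forall>s>0. g s \<le> ennreal (m / s ^ N)"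
    let ?c = "a powr (1 - \<kappa>) * m powr \<kappa>"
    have "(\<integral>\<^sup>+s. indicator {0..L} s * g s \<partial>lborel) \<le> (\<integral>\<^sup>+s. ennreal ?c * ennreal (indicator {0..L} s * s powr (- (real N * \<kappa>))) \<partial>lborel)"
    proof (rule nn_integral_mono_AE)
      have "AE s::real in lborel. s \<noteq> 0" by (rule AE_lborel_singleton)
      then show "AE s in lborel. indicator {0..L} s * g s \<le> ennreal ?c * ennreal (indicator {0..L} s * s powr (- (real N * \<kappa>)))"
      proof eventually_elim
        case (elim s)
        show ?case
        proof (cases "s \<in> {0..L}")
          case True
          then have s: "s > 0" using elim by auto
          from g1 have "g s < top" using le_less_trans[of "g s" "ennreal a"] by auto
          then obtain t where t: "g s = ennreal t" "t \<ge> 0" by (cases "g s") auto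
          have t1: "t \<le> a" using g1 t a by (metis ennreal_le_iff less_imp_le)
          have ms: "m / s ^ N > 0" using m s by simp
          have t2: "t \<le> m / s ^ N" using g2 s t ms by (metis ennreal_le_iff less_imp_le)
          have "t = t powr (1 - \<kappa>) * t powr \<kappa>" using t by (cases "t = 0") (auto simp: powr_add[symmetric])
          also have "\<dots> \<le> a powr (1 - \<kappa>) * (m / s ^ N) powr \<kappa>"
            using t t1 t2 \<kappa> by (intro mult_mono powr_mono2) auto
          also have "(m / s ^ N) powr \<kappa> = m powr \<kappa> * s powr (- (real N * \<kappa>))"
            using m s by (simp add: powr_divide powr_powr powr_realpow[symmetric] powr_minus_divide)
          finally have "t \<le> ?c * s powr (- (real N * \<kappa>))" by (simp add: mult_ac)
          then show ?thesis using True t by (simp add: ennreal_mult[symmetric] ennreal_leI)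
        qed simp
      qed
    qed
    also have "\<dots> = ennreal ?c * (\<integral>\<^sup>+s. ennreal (indicator {0..L} s * s powr (- (real N * \<kappa>))) \<partial>lborel)"
      by (rule nn_integral_cmult) measurable
    also have "(\<integral>\<^sup>+s. ennreal (indicator {0..L} s * s powr (- (real N * \<kappa>))) \<partial>lborel) = ennreal (L powr ?e / ?e)"
      using has_integral_powr_from_0[of "- (real N * \<kappa>)" L] k L
      by (intro nn_integral_has_integral_lebesgue) auto
    also have "ennreal ?c * ennreal (L powr ?e / ?e) = ennreal (?C * L powr ?e * m powr \<kappa>)"
      using e by (subst ennreal_mult[symmetric]) (auto simp: mult_ac)
    finally show "(\<integral>\<^sup>+s. indicator {0..L} s * g s \<partial>lborel) \<le> ennreal (?C * L powr ?e * m powr \<kappa>)" .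
  qed
next
  case True
  then have k: "\<kappa> = 1 / real N" using N by (simp add: field_simps)
  with \<kappa>(2) have N1: "real N > 1" using N by (auto simp add: divide_less_eq_1)
  let ?C = "a + 1 / (real N - 1)"
  show ?thesis
  proof (intro exI[of _ ?C] conjI allI impI)
    show "?C > 0" using a N1 by (simp add: add_pos_pos)
    fix m L :: real and g :: "real \<Rightarrow> ennreal"
    assume m: "m > 0" and L: "L > 0" and g1: "\<forall>s. g s \<le> ennreal a" and g2: "\<forall>s>0. g s \<le> ennreal (m / s ^ N)"
    \<comment> \<open>The radius at which m/s^N equals 1. The bound \<open>a\<close> is used below
      it and m/s^N above it; the tail converges since \<kappa> = 1/N < 1 means N > 1.\<close>
    define \<sigma> where "\<sigma> = m powr \<kappa>"
    have \<sigma>: "\<sigma> > 0" "\<sigma> powr real N = m" using m N k by (auto simp: \<sigma>_def powr_powr)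
    have "(\<integral>\<^sup>+s. indicator {0..L} s * g s \<partial>lborel) \<le> (\<integral>\<^sup>+s. ennreal a * indicator {0..\<sigma>} s + ennreal m * ennreal (indicator {\<sigma>..} s * s powr (- real N)) \<partial>lborel)"
    proof (rule nn_integral_mono)
      fix s :: real
      show "indicator {0..L} s * g s \<le> ennreal a * indicator {0..\<sigma>} s + ennreal m * ennreal (indicator {\<sigma>..} s * s powr (- real N))"
      proof -
        consider "s < 0" | "0 \<le> s" "s \<le> \<sigma>" | "s > \<sigma>" by linarith
        then show ?thesis
        proof cases
          case 2
          then have "indicator {0..L} s * g s \<le> ennreal a * indicator {0..\<sigma>} s"
            using g1 by (auto simp: indicator_def)
          then show ?thesis by (simp add: add_increasing2)
        next
          case 3
          then have s: "s > 0" using \<sigma> by simp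
          have "m / s ^ N = m * s powr (- real N)" using s by (simp add: powr_minus_divide powr_realpow)
          then have "g s \<le> ennreal m * ennreal (indicator {\<sigma>..} s * s powr (- real N))"
            using g2[rule_format, OF s] 3 m by (simp add: ennreal_mult[symmetric])
          then have "indicator {0..L} s * g s \<le> ennreal m * ennreal (indicator {\<sigma>..} s * s powr (- real N))"
            by (auto simp: indicator_def)
          then show ?thesis by (simp add: add_increasing)
        qed simp
      qed
    qed
    also have "\<dots> = ennreal a * emeasure lborel {0..\<sigma>} + ennreal m * (\<integral>\<^sup>+s. ennreal (indicator {\<sigma>..} s * s powr (- real N)) \<partial>lborel)"
      by (subst nn_integral_add) (auto simp: nn_integral_cmult)
    also have "(\<integral>\<^sup>+s. ennreal (indicator {\<sigma>..} s * s powr (- real N)) \<partial>lborel) = ennreal (- (\<sigma> powr (- real N + 1)) / (- real N + 1))"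
      using has_integral_powr_to_inf[of "- real N" \<sigma>] \<sigma> N1
      by (intro nn_integral_has_integral_lebesgue) auto
    also have "- (\<sigma> powr (- real N + 1)) / (- real N + 1) = \<sigma> / m / (real N - 1)"
    proof -
      have "\<sigma> powr (- real N + 1) = \<sigma> / m"
        using \<sigma> powr_diff[of \<sigma> 1 "real N"] by simp
      then show ?thesis using minus_divide_divide[of "\<sigma> / m" "real N - 1"] by simp
    qed
    also have "ennreal a * emeasure lborel {0..\<sigma>} + ennreal m * ennreal (\<sigma> / m / (real N - 1)) = ennreal (a * \<sigma> + m * (\<sigma> / m / (real N - 1)))"
      using a m \<sigma> N1 by (simp add: ennreal_mult[symmetric] ennreal_plus[symmetric] del: ennreal_plus)
    also have "a * \<sigma> + m * (\<sigma> / m / (real N - 1)) = ?C * L powr (1 - real N * \<kappa>) * m powr \<kappa>"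
    proof -
      have "m * (\<sigma> / m / (real N - 1)) = \<sigma> / (real N - 1)" using m by simp
      then show ?thesis using L True by (simp add: \<sigma>_def ring_distribs)
    qed
    finally show "(\<integral>\<^sup>+s. indicator {0..L} s * g s \<partial>lborel) \<le> ennreal (?C * L powr (1 - real N * \<kappa>) * m powr \<kappa>)" .
  qed
qed

text \<open>A set of directions with positive volume instead of the unit sphere: averages over
  directions then need only Lebesgue measure.\<close>

definition annulus :: "'a::euclidean_space set" where
  "annulus = {v. 1 \<le> norm v \<and> norm v \<le> 2}"

lemma annulus_measurable[measurable]: "annulus \<in> sets borel"
  unfolding annulus_def by measurable

lemma emeasure_annulus:
  "emeasure lborel (annulus :: 'a::euclidean_space set) < \<infinity>" "emeasure lborel (annulus :: 'a set) > 0"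
proof -
  have "bounded (annulus :: 'a set)"
    by (rule bounded_subset[OF bounded_cball[of 0 2]]) (auto simp: annulus_def)
  then show "emeasure lborel (annulus :: 'a set) < \<infinity>" by (rule emeasure_bounded_finite)
  obtain e :: 'a where e: "e \<in> Basis" using nonempty_Basis by blast
  have "ball ((3/2) *\<^sub>R e) (1/2) \<subseteq> annulus"
  proof
    fix v assume "v \<in> ball ((3/2) *\<^sub>R e) (1/2)"
    then have "norm ((3/2) *\<^sub>R e - v) < 1/2" by (simp add: dist_norm)
    then show "v \<in> annulus"
      using norm_triangle_ineq2[of "(3/2) *\<^sub>R e" v] norm_triangle_ineq3[of "(3/2) *\<^sub>R e" v] e
      by (auto simp: annulus_def abs_le_iff)
  qed
  then have "emeasure lborel (ball ((3/2) *\<^sub>R e) (1/2)) \<le> emeasure lborel (annulus :: 'a set)"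
    by (intro emeasure_mono) auto
  moreover have "emeasure lborel (ball ((3/2) *\<^sub>R e) (1/2)) > 0"
    using content_ball_pos[of "1/2" "(3/2) *\<^sub>R e"] by (simp add: measure_def enn2real_positive_iff)
  ultimately show "emeasure lborel (annulus :: 'a set) > 0" by order
qed

text \<open>The reflection v -> -v preserves the annulus and exchanges the two half-spaces, which
  together cover it.\<close>

lemma half_annulus:
  fixes x :: "'a::euclidean_space"
  shows "emeasure lborel (annulus :: 'a set) \<le> 2 * (\<integral>\<^sup>+v. indicator annulus v * indicator {v. 0 \<le> x \<bullet> v} v \<partial>lborel)"
proof -
  let ?f = "\<lambda>v. indicator annulus v * indicator {v. 0 \<le> x \<bullet> v} v :: ennreal"
  have m[measurable]: "?f \<in> borel_measurable borel" by measurable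
  have "emeasure lborel (annulus :: 'a set) = (\<integral>\<^sup>+v. indicator (annulus :: 'a set) v \<partial>lborel)" by simp
  also have "\<dots> \<le> (\<integral>\<^sup>+v. ?f v + ?f (0 + (-1) *\<^sub>R v) \<partial>lborel)"
    by (intro nn_integral_mono) (auto simp: indicator_def annulus_def)
  also have "\<dots> = (\<integral>\<^sup>+v. ?f v \<partial>lborel) + (\<integral>\<^sup>+v. ?f (0 + (-1) *\<^sub>R v) \<partial>lborel)"
    by (rule nn_integral_add) (measurable)
  also have "(\<integral>\<^sup>+v. ?f (0 + (-1) *\<^sub>R v) \<partial>lborel) = (\<integral>\<^sup>+v. ?f v \<partial>lborel)"
  proof -
    have "(-1::real) \<noteq> 0" by simp
    from nn_integral_scale_lborel[OF m this, of 0] show ?thesis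
      by (simp only: abs_neg_one power_one ennreal_1 mult_1_left)
  qed
  finally show ?thesis by (simp add: mult_2)
qed

text \<open>If x and v form no obtuse angle, the norm along x + s v never drops below |x|, so the
  ray stays in the domain of w. It ends where w vanishes, and the fundamental theorem of calculus
  applies; the factor 2 bounds |v|.\<close>

lemma ray_bound:
  fixes w :: "'a::euclidean_space \<Rightarrow> real"
  assumes C1: "C1_pair {x. norm x > \<rho>} w H" and R: "\<And>y. norm y \<ge> R \<Longrightarrow> w y = 0"
    and x: "norm x > \<rho>" and v: "v \<in> annulus" "0 \<le> x \<bullet> v"
  shows "ennreal \<bar>w x\<bar> \<le> 2 * (\<integral>\<^sup>+s. indicator {0..} s * (indicator {x. norm x > \<rho>} (x + s *\<^sub>R v) * ennreal (norm (H (x + s *\<^sub>R v)))) \<partial>lborel)"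
proof -
  have nv: "1 \<le> norm v" "norm v \<le> 2" using v by (auto simp: annulus_def)
  have out: "norm (x + s *\<^sub>R v) > \<rho>" if "s \<ge> 0" for s
  proof -
    have "(norm x)\<^sup>2 \<le> (norm (x + s *\<^sub>R v))\<^sup>2"
      using that v by (simp add: power2_norm_eq_inner inner_add_left inner_add_right inner_commute)
    then have "norm x \<le> norm (x + s *\<^sub>R v)" by (rule power2_le_imp_le) simp
    then show ?thesis using x by linarith
  qed
  \<comment> \<open>Since |v| >= 1, a ray of this length ends at a point of norm at least
    |R|.\<close>
  let ?S = "\<bar>R\<bar> + norm x"
  let ?f = "\<lambda>s. H (x + s *\<^sub>R v) \<bullet> v"
  have S: "w (x + ?S *\<^sub>R v) = 0"
  proof (rule R)
    have "?S * 1 \<le> ?S * norm v" using nv by (intro mult_left_mono) auto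
    then have "?S \<le> norm (?S *\<^sub>R v)" by simp
    moreover have "norm (?S *\<^sub>R v) - norm x \<le> norm (x + ?S *\<^sub>R v)"
      using norm_diff_ineq[of "?S *\<^sub>R v" x] by (simp add: add.commute)
    ultimately show "R \<le> norm (x + ?S *\<^sub>R v)" by linarith
  qed
  have S0: "0 \<le> ?S" by simp
  have der: "((\<lambda>s. w (x + s *\<^sub>R v)) has_real_derivative ?f s) (at s)" if "0 \<le> s" for s
  proof -
    have 1: "((\<lambda>s. x + s *\<^sub>R v) has_derivative (\<lambda>t. t *\<^sub>R v)) (at s)"
      by (auto intro!: derivative_eq_intros)
    have 2: "(w has_derivative (\<lambda>y. H (x + s *\<^sub>R v) \<bullet> y)) (at (x + s *\<^sub>R v))"
      using C1 out[OF that] by (auto simp: C1_pair_def)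
    have "(\<lambda>t. H (x + s *\<^sub>R v) \<bullet> (t *\<^sub>R v)) = (*) (H (x + s *\<^sub>R v) \<bullet> v)"
      by (auto simp: fun_eq_iff mult.commute)
    with has_derivative_compose[OF 1 2] show ?thesis
      by (simp only: has_field_derivative_def)
  qed
  have cont: "isCont ?f s" if "0 \<le> s" for s
  proof -
    have 2: "isCont H (x + s *\<^sub>R v)"
      using C1 out[OF that] continuous_on_eq_continuous_at by (auto simp: C1_pair_def)
    have 1: "isCont (\<lambda>s. x + s *\<^sub>R v) s" by simp
    show ?thesis by (intro continuous_inner continuous_const isCont_o2[OF 1 2])
  qed
  have F: "has_bochner_integral lborel (\<lambda>s. ?f s * indicator {0..?S} s) (w (x + ?S *\<^sub>R v) - w (x + 0 *\<^sub>R v))"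
    by (rule has_bochner_integral_FTC_Icc_real[OF S0])
       (use der cont in auto)
  then have "ennreal \<bar>w x\<bar> = ennreal (norm (integral\<^sup>L lborel (\<lambda>s. ?f s * indicator {0..?S} s)))"
    using S by (simp add: has_bochner_integral_iff)
  also have "\<dots> \<le> (\<integral>\<^sup>+s. ennreal (norm (?f s * indicator {0..?S} s)) \<partial>lborel)"
    using F by (intro integral_norm_bound_ennreal) (simp add: has_bochner_integral_iff)
  also have "\<dots> \<le> (\<integral>\<^sup>+s. 2 * (indicator {0..} s * (indicator {x. norm x > \<rho>} (x + s *\<^sub>R v) * ennreal (norm (H (x + s *\<^sub>R v))))) \<partial>lborel)"
  proof (rule nn_integral_mono)
    fix s :: real
    show "ennreal (norm (?f s * indicator {0..?S} s)) \<le> 2 * (indicator {0..} s * (indicator {x. norm x > \<rho>} (x + s *\<^sub>R v) * ennreal (norm (H (x + s *\<^sub>R v)))))"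
    proof (cases "s \<in> {0..?S}")
      case True
      have "\<bar>?f s\<bar> \<le> norm (H (x + s *\<^sub>R v)) * norm v" by (rule Cauchy_Schwarz_ineq2)
      also have "\<dots> \<le> norm (H (x + s *\<^sub>R v)) * 2" using nv by (intro mult_left_mono) auto
      finally have "ennreal \<bar>?f s\<bar> \<le> ennreal (2 * norm (H (x + s *\<^sub>R v)))" by (intro ennreal_leI) simp
      then show ?thesis using True out[of s] by (simp add: ennreal_mult)
    qed simp
  qed
  also have "\<dots> = 2 * (\<integral>\<^sup>+s. indicator {0..} s * (indicator {x. norm x > \<rho>} (x + s *\<^sub>R v) * ennreal (norm (H (x + s *\<^sub>R v)))) \<partial>lborel)"
  proof (rule nn_integral_cmult)
    have "(\<lambda>x. indicator {x. norm x > \<rho>} x *\<^sub>R H x) \<in> borel_measurable borel"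
      using C1 by (intro borel_measurable_continuous_on_indicator) (auto simp: C1_pair_def)
    then have [measurable]: "(\<lambda>x. ennreal (norm (indicator {x. norm x > \<rho>} x *\<^sub>R H x))) \<in> borel_measurable borel" by measurable
    have "(\<lambda>s. indicator {0..} s * ennreal (norm (indicator {x. norm x > \<rho>} (x + s *\<^sub>R v) *\<^sub>R H (x + s *\<^sub>R v)))) \<in> borel_measurable lborel"
      by measurable
    then show "(\<lambda>s. indicator {0..} s * (indicator {x. norm x > \<rho>} (x + s *\<^sub>R v) * ennreal (norm (H (x + s *\<^sub>R v))))) \<in> borel_measurable lborel"
      by (simp add: ennreal_mult ennreal_indicator)
  qed
  finally show ?thesis .
qed

text \<open>Every point of \<open>E\<close> is joined to infinity by the rays \<open>x + s v\<close> with \<open>v\<close> in a half annulus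
  pointing away from the origin; substituting \<open>z = x + s v\<close> bounds \<open>|E|\<close> by the integral of \<open>|H(z)|\<close>
  against the measure of the set of pairs \<open>(s, v)\<close> with \<open>z - s v \<in> E\<close>.\<close>

lemma measure_superlevel_rays:
  fixes w :: "'a::euclidean_space \<Rightarrow> real"
  assumes C1: "C1_pair {x. norm x > \<rho>} w H" and R: "\<And>y. norm y \<ge> R \<Longrightarrow> w y = 0"
    and E[measurable]: "E \<in> sets borel" and EE: "\<And>x. x \<in> E \<Longrightarrow> norm x > \<rho> \<and> 1 \<le> w x"
  shows "emeasure lborel (annulus :: 'a set) * emeasure lborel E \<le>
    4 * (\<integral>\<^sup>+z. (indicator {x. norm x > \<rho>} z * ennreal (norm (H z))) *
      (\<integral>\<^sup>+s. indicator {0..norm z} s * (\<integral>\<^sup>+v. indicator annulus v * indicator E (z - s *\<^sub>R v) \<partial>lborel) \<partial>lborel) \<partial>lborel)"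
proof -
  let ?S = "{x::'a. norm x > \<rho>}"
  let ?Hn = "\<lambda>z. indicator ?S z * ennreal (norm (H z))"
  let ?a = "emeasure lborel (annulus :: 'a set)"
  have Hm[measurable]: "?Hn \<in> borel_measurable borel"
  proof -
    have "(\<lambda>x. indicator ?S x *\<^sub>R H x) \<in> borel_measurable borel"
      using C1 by (intro borel_measurable_continuous_on_indicator) (auto simp: C1_pair_def)
    then have "(\<lambda>x. ennreal (norm (indicator ?S x *\<^sub>R H x))) \<in> borel_measurable borel" by measurable
    also have "(\<lambda>x. ennreal (norm (indicator ?S x *\<^sub>R H x))) = ?Hn"
      by (auto simp: indicator_def)
    finally show ?thesis .
  qed
  define J where "J u v = (indicator {0..} (u \<bullet> v) :: ennreal)" for u v :: 'a
  have J[measurable]: "(\<lambda>y. J (f y) (g y)) \<in> borel_measurable M"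
    if [measurable]: "f \<in> borel_measurable M" "g \<in> borel_measurable M" for f g and M :: "'c measure"
    unfolding J_def by measurable
  define I where "I x v s = indicator E x * (indicator annulus v * (J x v * (indicator {0..} s * ?Hn (x + s *\<^sub>R v))))" for x v :: 'a and s :: real
  have Im[measurable]: "(\<lambda>y. I (f y) (g y) (h y)) \<in> borel_measurable M"
    if [measurable]: "f \<in> borel_measurable M" "g \<in> borel_measurable M" "h \<in> borel_measurable M" for f g h and M :: "'c measure"
    unfolding I_def by measurable
  have 1: "?a * indicator E x \<le> 4 * (\<integral>\<^sup>+v. (\<integral>\<^sup>+s. I x v s \<partial>lborel) \<partial>lborel)" for x
  proof (cases "x \<in> E")
    case True
    have "?a \<le> 2 * (\<integral>\<^sup>+v. indicator annulus v * indicator {v. 0 \<le> x \<bullet> v} v \<partial>lborel)" by (rule half_annulus)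
    also have "(\<integral>\<^sup>+v. indicator annulus v * indicator {v. 0 \<le> x \<bullet> v} v \<partial>lborel) \<le> (\<integral>\<^sup>+v. 2 * (\<integral>\<^sup>+s. I x v s \<partial>lborel) \<partial>lborel)"
    proof (rule nn_integral_mono)
      fix v
      show "indicator annulus v * indicator {v. 0 \<le> x \<bullet> v} v \<le> 2 * (\<integral>\<^sup>+s. I x v s \<partial>lborel)"
      proof (cases "v \<in> annulus \<and> 0 \<le> x \<bullet> v")
        case v: True
        have "1 \<le> ennreal \<bar>w x\<bar>" using EE[OF True] by (simp add: ennreal_ge_1)
        also have "\<dots> \<le> 2 * (\<integral>\<^sup>+s. indicator {0..} s * ?Hn (x + s *\<^sub>R v) \<partial>lborel)"
          by (rule ray_bound[OF C1, of R]) (use R EE[OF True] v in auto)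
        also have "(\<integral>\<^sup>+s. indicator {0..} s * ?Hn (x + s *\<^sub>R v) \<partial>lborel) = (\<integral>\<^sup>+s. I x v s \<partial>lborel)"
          using True v by (intro nn_integral_cong) (simp add: I_def J_def)
        finally show ?thesis using v by simp
      qed (auto simp: indicator_def)
    qed
    also have "\<dots> = 2 * (\<integral>\<^sup>+v. (\<integral>\<^sup>+s. I x v s \<partial>lborel) \<partial>lborel)"
      by (rule nn_integral_cmult) measurable
    finally show ?thesis using True by (simp add: mult.assoc[symmetric] mult_left_mono)
  qed simp
  have "?a * emeasure lborel E = (\<integral>\<^sup>+x. ?a * indicator E x \<partial>lborel)"
    by (subst nn_integral_cmult) auto
  also have "\<dots> \<le> (\<integral>\<^sup>+x. 4 * (\<integral>\<^sup>+v. (\<integral>\<^sup>+s. I x v s \<partial>lborel) \<partial>lborel) \<partial>lborel)"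
    by (rule nn_integral_mono) (rule 1)
  also have "\<dots> = 4 * (\<integral>\<^sup>+x. (\<integral>\<^sup>+v. (\<integral>\<^sup>+s. I x v s \<partial>lborel) \<partial>lborel) \<partial>lborel)"
    by (rule nn_integral_cmult) measurable
  also have "(\<integral>\<^sup>+x. (\<integral>\<^sup>+v. (\<integral>\<^sup>+s. I x v s \<partial>lborel) \<partial>lborel) \<partial>lborel) = (\<integral>\<^sup>+v. (\<integral>\<^sup>+x. (\<integral>\<^sup>+s. I x v s \<partial>lborel) \<partial>lborel) \<partial>lborel)"
    by (rule lborel_pair.Fubini'[symmetric]) measurable
  also have "\<dots> = (\<integral>\<^sup>+v. (\<integral>\<^sup>+s. (\<integral>\<^sup>+x. I x v s \<partial>lborel) \<partial>lborel) \<partial>lborel)"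
    by (rule nn_integral_cong, rule lborel_pair.Fubini'[symmetric]) measurable
  also have "\<dots> = (\<integral>\<^sup>+v. (\<integral>\<^sup>+s. (\<integral>\<^sup>+z. I (z - s *\<^sub>R v) v s \<partial>lborel) \<partial>lborel) \<partial>lborel)"
  proof (rule nn_integral_cong, rule nn_integral_cong)
    fix v :: 'a and s :: real
    show "(\<integral>\<^sup>+x. I x v s \<partial>lborel) = (\<integral>\<^sup>+z. I (z - s *\<^sub>R v) v s \<partial>lborel)"
      using nn_integral_shift_lborel[of "\<lambda>x. I x v s" "- (s *\<^sub>R v)"] by simp
  qed
  also have "\<dots> = (\<integral>\<^sup>+v. (\<integral>\<^sup>+z. (\<integral>\<^sup>+s. I (z - s *\<^sub>R v) v s \<partial>lborel) \<partial>lborel) \<partial>lborel)"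
    by (rule nn_integral_cong, rule lborel_pair.Fubini'[symmetric]) measurable
  also have "\<dots> = (\<integral>\<^sup>+z. (\<integral>\<^sup>+v. (\<integral>\<^sup>+s. I (z - s *\<^sub>R v) v s \<partial>lborel) \<partial>lborel) \<partial>lborel)"
    by (rule lborel_pair.Fubini'[symmetric]) measurable
  also have "\<dots> = (\<integral>\<^sup>+z. (\<integral>\<^sup>+s. (\<integral>\<^sup>+v. I (z - s *\<^sub>R v) v s \<partial>lborel) \<partial>lborel) \<partial>lborel)"
    by (rule nn_integral_cong, rule lborel_pair.Fubini'[symmetric]) measurable
  also have "\<dots> \<le> (\<integral>\<^sup>+z. ?Hn z * (\<integral>\<^sup>+s. indicator {0..norm z} s * (\<integral>\<^sup>+v. indicator annulus v * indicator E (z - s *\<^sub>R v) \<partial>lborel) \<partial>lborel) \<partial>lborel)"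
  proof (rule nn_integral_mono)
    fix z :: 'a
    have "(\<integral>\<^sup>+s. (\<integral>\<^sup>+v. I (z - s *\<^sub>R v) v s \<partial>lborel) \<partial>lborel)
      \<le> (\<integral>\<^sup>+s. (\<integral>\<^sup>+v. ?Hn z * (indicator {0..norm z} s * (indicator annulus v * indicator E (z - s *\<^sub>R v))) \<partial>lborel) \<partial>lborel)"
    proof (intro nn_integral_mono)
      fix s :: real and v :: 'a
      show "I (z - s *\<^sub>R v) v s \<le> ?Hn z * (indicator {0..norm z} s * (indicator annulus v * indicator E (z - s *\<^sub>R v)))"
      proof (cases "v \<in> annulus \<and> s \<ge> 0 \<and> (z - s *\<^sub>R v) \<bullet> v \<ge> 0")
        case True
        then have nv: "1 \<le> norm v" by (simp add: annulus_def)
        \<comment> \<open>Seen from the end point z, the condition that the ray moved outwards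
          forces s <= |z|. This cut of the s-integral at |z| is the source of the weight
          |z|^\<beta>.\<close>
        have "s * (norm v * norm v) \<le> z \<bullet> v"
          using True by (simp add: inner_diff_left power2_norm_eq_inner[symmetric] power2_eq_square)
        also have "\<dots> \<le> norm z * norm v" by (rule norm_cauchy_schwarz)
        finally have "(s * norm v) * norm v \<le> norm z * norm v" by (simp add: mult_ac)
        then have "s * norm v \<le> norm z" by (rule mult_right_le_imp_le) (use nv in linarith)
        moreover have "s * 1 \<le> s * norm v" using True nv by (intro mult_left_mono) auto
        ultimately have "s \<in> {0..norm z}" using True by simp
        then show ?thesis using True by (simp add: I_def J_def mult.commute)
      qed (auto simp: I_def J_def)
    qed
    also have "\<dots> = (\<integral>\<^sup>+s. ?Hn z * (indicator {0..norm z} s * (\<integral>\<^sup>+v. indicator annulus v * indicator E (z - s *\<^sub>R v) \<partial>lborel)) \<partial>lborel)"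
    proof (rule nn_integral_cong)
      fix s :: real
      have "(\<integral>\<^sup>+v. ?Hn z * (indicator {0..norm z} s * (indicator annulus v * indicator E (z - s *\<^sub>R v))) \<partial>lborel)
        = ?Hn z * (\<integral>\<^sup>+v. indicator {0..norm z} s * (indicator annulus v * indicator E (z - s *\<^sub>R v)) \<partial>lborel)"
        by (rule nn_integral_cmult) measurable
      also have "(\<integral>\<^sup>+v. indicator {0..norm z} s * (indicator annulus v * indicator E (z - s *\<^sub>R v)) \<partial>lborel)
        = indicator {0..norm z} s * (\<integral>\<^sup>+v. indicator annulus v * indicator E (z - s *\<^sub>R v) \<partial>lborel)"
        by (rule nn_integral_cmult) measurable
      finally show "(\<integral>\<^sup>+v. ?Hn z * (indicator {0..norm z} s * (indicator annulus v * indicator E (z - s *\<^sub>R v))) \<partial>lborel)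
        = ?Hn z * (indicator {0..norm z} s * (\<integral>\<^sup>+v. indicator annulus v * indicator E (z - s *\<^sub>R v) \<partial>lborel))" .
    qed
    also have "\<dots> = ?Hn z * (\<integral>\<^sup>+s. indicator {0..norm z} s * (\<integral>\<^sup>+v. indicator annulus v * indicator E (z - s *\<^sub>R v) \<partial>lborel) \<partial>lborel)"
      by (rule nn_integral_cmult) measurable
    finally show "(\<integral>\<^sup>+s. (\<integral>\<^sup>+v. I (z - s *\<^sub>R v) v s \<partial>lborel) \<partial>lborel) \<le> ?Hn z * (\<integral>\<^sup>+s. indicator {0..norm z} s * (\<integral>\<^sup>+v. indicator annulus v * indicator E (z - s *\<^sub>R v) \<partial>lborel) \<partial>lborel)" .
  qed
  finally show ?thesis by (simp add: mult_left_mono)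
qed

text \<open>One constant serves every radius \<rho> of the excluded ball, so the estimate survives
  \<rho> -> 0. The real-valued \<open>measure\<close> loses nothing: w vanishes outside a ball, so E
  has finite measure.\<close>

definition weak_sobolev_const :: "'a::euclidean_space itself \<Rightarrow> real \<Rightarrow> real \<Rightarrow> bool" where
  "weak_sobolev_const T q C \<longleftrightarrow> C > 0 \<and> (\<forall>\<rho>>0. \<forall>w H. \<forall>R. \<forall>E::'a set. C1_pair {x. norm x > \<rho>} w H \<longrightarrow>
     (\<forall>y. norm y \<ge> R \<longrightarrow> w y = 0) \<longrightarrow> E \<in> sets borel \<longrightarrow> (\<forall>x\<in>E. norm x > \<rho> \<and> 1 \<le> w x) \<longrightarrow>
     ennreal (measure lborel E powr (1 / q)) \<le>
       ennreal C * (\<integral>\<^sup>+z. indicator {x. norm x > \<rho>} z * ennreal (norm z powr (1 - real DIM('a) * (1 - 1 / q)) * norm (H z)) \<partial>lborel))"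

text \<open>With \<kappa> = 1 - 1/q the ray integral contributes |z|^\<beta> |E|^\<kappa>. Dividing
  |E| by |E|^\<kappa>, which is legitimate as |E| is finite and may be taken positive, leaves
  |E|^(1/q).\<close>

lemma ex_weak_sobolev_const:
  assumes q: "1 \<le> q" "real DIM('a) * (1 - 1 / q) \<le> 1"
  shows "\<exists>C. weak_sobolev_const TYPE('a::euclidean_space) q C"
proof -
  let ?N = "DIM('a)"
  let ?\<kappa> = "1 - 1 / q"
  let ?\<beta> = "1 - real ?N * ?\<kappa>"
  define a where "a = measure lborel (annulus :: 'a set)"
  have ea: "emeasure lborel (annulus :: 'a set) = ennreal a"
    using emeasure_annulus(1)[where 'a='a] by (simp add: a_def emeasure_eq_ennreal_measure top.not_eq_extremum)
  have a: "a > 0" using emeasure_annulus(2)[where 'a='a] by (simp add: ea)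
  have N1: "?N \<ge> 1" by (simp add: Suc_leI)
  have k: "0 \<le> ?\<kappa>" "?\<kappa> < 1" using q by (auto simp: field_simps)
  from ray_integral_bound[OF N1 k q(2) a] obtain K where K: "K > 0"
    and K': "\<forall>m>0. \<forall>L>0. \<forall>g::real \<Rightarrow> ennreal. (\<forall>s. g s \<le> ennreal a) \<longrightarrow> (\<forall>s>0. g s \<le> ennreal (m / s ^ ?N)) \<longrightarrow>
    (\<integral>\<^sup>+s. indicator {0..L} s * g s \<partial>lborel) \<le> ennreal (K * L powr ?\<beta> * m powr ?\<kappa>)"
    by (elim exE conjE) (rule that)
  have "weak_sobolev_const TYPE('a) q (4 * K / a)"
    unfolding weak_sobolev_const_def
  proof (intro conjI allI impI)
    show "4 * K / a > 0" using K a by simp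
    fix \<rho> R :: real and w H and E :: "'a set"
    assume \<rho>: "\<rho> > 0" and C1: "C1_pair {x. norm x > \<rho>} w H" and R: "\<forall>y. norm y \<ge> R \<longrightarrow> w y = 0"
      and E[measurable]: "E \<in> sets borel" and EE: "\<forall>x\<in>E. norm x > \<rho> \<and> 1 \<le> w x"
    define m where "m = measure lborel E"
    have "norm x < R" if "x \<in> E" for x
      using R EE that by (metis not_le not_one_le_zero)
    then have "E \<subseteq> ball 0 R" by auto
    then have "emeasure lborel E < \<infinity>" by (intro emeasure_bounded_finite bounded_subset[OF bounded_ball])
    then have em: "emeasure lborel E = ennreal m"
      by (simp add: m_def emeasure_eq_ennreal_measure top.not_eq_extremum)
    let ?I = "\<integral>\<^sup>+z. indicator {x. norm x > \<rho>} z * ennreal (norm z powr ?\<beta> * norm (H z)) \<partial>lborel"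
    show "ennreal (measure lborel E powr (1 / q)) \<le> ennreal (4 * K / a) * ?I"
    proof (cases "m = 0")
      case True then show ?thesis by (simp add: m_def)
    next
      case False
      then have m: "m > 0" by (simp add: m_def zero_less_measure_iff)
      let ?g = "\<lambda>z s. (\<integral>\<^sup>+v. indicator annulus v * indicator E (z - s *\<^sub>R v) \<partial>lborel)"
      let ?Hn = "\<lambda>z. indicator {x::'a. norm x > \<rho>} z * ennreal (norm (H z))"
      have g1: "?g z s \<le> ennreal a" for z s
      proof -
        have "?g z s \<le> (\<integral>\<^sup>+v. indicator (annulus :: 'a set) v \<partial>lborel)"
          by (intro nn_integral_mono) (auto simp: indicator_def)
        then show ?thesis by (simp add: ea)
      qed
      \<comment> \<open>The map v -> z - s v multiplies volumes by s^N, so the preimage of E has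
        measure exactly m/s^N.\<close>
      have g2: "?g z s \<le> ennreal (m / s ^ ?N)" if s: "s > 0" for z s
      proof -
        have "ennreal m = (\<integral>\<^sup>+v. indicator E v \<partial>lborel)" by (simp add: em)
        also have "\<dots> = ennreal (\<bar>- s\<bar> ^ ?N) * (\<integral>\<^sup>+v. indicator E (z + (- s) *\<^sub>R v) \<partial>lborel)"
          by (rule nn_integral_scale_lborel) (use s in auto)
        finally have "ennreal m = ennreal (s ^ ?N) * (\<integral>\<^sup>+v. indicator E (z - s *\<^sub>R v) \<partial>lborel)"
          using s by simp
        then have "ennreal (inverse (s ^ ?N)) * ennreal m = (ennreal (inverse (s ^ ?N)) * ennreal (s ^ ?N)) * (\<integral>\<^sup>+v. indicator E (z - s *\<^sub>R v) \<partial>lborel)"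
          by (simp add: mult.assoc)
        also have "ennreal (inverse (s ^ ?N)) * ennreal (s ^ ?N) = 1"
          using s by (simp add: ennreal_mult[symmetric])
        finally have "(\<integral>\<^sup>+v. indicator E (z - s *\<^sub>R v) \<partial>lborel) = ennreal (m / s ^ ?N)"
          using s m by (simp add: ennreal_mult[symmetric] field_simps)
        moreover have "?g z s \<le> (\<integral>\<^sup>+v. indicator E (z - s *\<^sub>R v) \<partial>lborel)"
          by (intro nn_integral_mono) (auto simp: indicator_def)
        ultimately show ?thesis by simp
      qed
      have "ennreal a * ennreal m \<le> 4 * (\<integral>\<^sup>+z. ?Hn z * (\<integral>\<^sup>+s. indicator {0..norm z} s * ?g z s \<partial>lborel) \<partial>lborel)"
        using measure_superlevel_rays[OF C1 _ E, of R] R EE by (simp add: ea em)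
      also have "\<dots> \<le> 4 * (\<integral>\<^sup>+z. ennreal (K * m powr ?\<kappa>) * (indicator {x. norm x > \<rho>} z * ennreal (norm z powr ?\<beta> * norm (H z))) \<partial>lborel)"
      proof (intro mult_left_mono nn_integral_mono)
        fix z :: 'a
        show "?Hn z * (\<integral>\<^sup>+s. indicator {0..norm z} s * ?g z s \<partial>lborel) \<le> ennreal (K * m powr ?\<kappa>) * (indicator {x. norm x > \<rho>} z * ennreal (norm z powr ?\<beta> * norm (H z)))"
        proof (cases "norm z > \<rho>")
          case True
          then have "norm z > 0" using \<rho> by linarith
          then have "?Hn z * (\<integral>\<^sup>+s. indicator {0..norm z} s * ?g z s \<partial>lborel) \<le> ?Hn z * ennreal (K * norm z powr ?\<beta> * m powr ?\<kappa>)"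
            using g1 g2 m by (intro mult_left_mono K'[rule_format]) auto
          also have "\<dots> = ennreal (K * m powr ?\<kappa>) * (indicator {x. norm x > \<rho>} z * ennreal (norm z powr ?\<beta> * norm (H z)))"
            using True K by (simp add: ennreal_mult[symmetric] mult_ac)
          finally show ?thesis .
        qed simp
      qed simp
      also have "\<dots> = 4 * (ennreal (K * m powr ?\<kappa>) * ?I)"
      proof -
        have "(\<lambda>x. indicator {x. norm x > \<rho>} x *\<^sub>R H x) \<in> borel_measurable borel"
          using C1 by (intro borel_measurable_continuous_on_indicator) (auto simp: C1_pair_def)
        then have "(\<lambda>x. ennreal (norm x powr ?\<beta> * norm (indicator {x. norm x > \<rho>} x *\<^sub>R H x))) \<in> borel_measurable borel" by measurable
        also have "(\<lambda>x. ennreal (norm x powr ?\<beta> * norm (indicator {x. norm x > \<rho>} x *\<^sub>R H x))) = (\<lambda>z. indicator {x. norm x > \<rho>} z * ennreal (norm z powr ?\<beta> * norm (H z)))"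
          by (auto simp: indicator_def)
        finally show ?thesis by (subst nn_integral_cmult) auto
      qed
      also have "\<dots> = ennreal (4 * K * m powr ?\<kappa>) * ?I"
        using K by (simp add: ennreal_mult mult.assoc)
      finally have main: "ennreal (a * m) \<le> ennreal (4 * K * m powr ?\<kappa>) * ?I"
        using a m by (simp add: ennreal_mult)
      have "m powr (1 / q) = inverse (a * m powr ?\<kappa>) * (a * m)"
      proof -
        have "m powr (1 / q) * m powr ?\<kappa> = m" using m by (simp add: powr_add[symmetric])
        then show ?thesis using a m by (simp add: field_simps)
      qed
      then have "ennreal (m powr (1 / q)) = ennreal (inverse (a * m powr ?\<kappa>)) * ennreal (a * m)"
        using a m by (simp add: ennreal_mult)
      also have "\<dots> \<le> ennreal (inverse (a * m powr ?\<kappa>)) * (ennreal (4 * K * m powr ?\<kappa>) * ?I)"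
        by (intro mult_left_mono main) simp
      also have "\<dots> = ennreal (4 * K / a) * ?I"
        using a m K by (subst mult.assoc[symmetric], subst ennreal_mult[symmetric]) (auto simp: field_simps)
      finally show ?thesis by (simp add: m_def)
    qed
  qed
  then show ?thesis by blast
qed

subsection \<open>From weak to strong type by truncation\<close>

text \<open>The squared positive part is the simplest C^1 substitute for a kink; the cutoffs and the
  bumps below are built from it.\<close>

lemma max_square_deriv: "((\<lambda>t::real. (max 0 t)\<^sup>2) has_real_derivative 2 * max 0 t) (at t)"
proof -
  consider "t > 0" | "t < 0" | "t = 0" by linarith
  then show ?thesis
  proof cases
    case 1
    have "((\<lambda>t::real. t\<^sup>2) has_real_derivative 2 * max 0 t) (at t)"
      using 1 by (auto intro!: derivative_eq_intros)
    then show ?thesis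
      by (rule has_field_derivative_transform_within_open[where S="{0<..}"]) (use 1 in auto)
  next
    case 2
    have "((\<lambda>t::real. 0) has_real_derivative 2 * max 0 t) (at t)" using 2 by simp
    then show ?thesis
      by (rule has_field_derivative_transform_within_open[where S="{..<0}"]) (use 2 in auto)
  next
    case 3
    have "((\<lambda>h::real. max 0 h) \<longlongrightarrow> max 0 0) (at 0)"
      by (intro tendsto_max tendsto_const tendsto_ident_at)
    then have A: "((\<lambda>h::real. max 0 h) \<longlongrightarrow> 0) (at 0)" by simp
    have "((\<lambda>h::real. ((max 0 (0 + h))\<^sup>2 - (max 0 0)\<^sup>2) / h) \<longlongrightarrow> 0) (at 0)"
      by (rule Lim_transform_eventually[OF A])
         (auto simp: eventually_at_filter max_def power2_eq_square)
    then show ?thesis using 3 by (simp add: DERIV_def)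
  qed
qed

lemma max_square_deriv_compose:
  "(f has_real_derivative D) (at x) \<Longrightarrow>
    ((\<lambda>x. (max 0 (f x))\<^sup>2) has_real_derivative (2 * max 0 (f x)) * D) (at x)"
  by (rule DERIV_chain2[OF max_square_deriv])

text \<open>An even C^1 step: 0 for |s| <= 1 and 1 for |s| >= 2. The inner quotient runs from 1 at
  |s| = 1 to 0 at |s| = 2, and the two squared positive parts remove the corners at both
  ends.\<close>

definition level_cut :: "real \<Rightarrow> real" where
  "level_cut s = (max 0 (1 - (max 0 ((4 - s\<^sup>2) / 3))\<^sup>2))\<^sup>2"

definition level_cut_deriv :: "real \<Rightarrow> real" where
  "level_cut_deriv s = (2 * max 0 (1 - (max 0 ((4 - s\<^sup>2) / 3))\<^sup>2)) * ((2 * max 0 ((4 - s\<^sup>2) / 3)) * (2 * s / 3))"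

lemma level_cut_has_derivative: "(level_cut has_real_derivative level_cut_deriv s) (at s)"
proof -
  have 1: "((\<lambda>s. (4 - s\<^sup>2) / 3) has_real_derivative (- (2 * s / 3))) (at s)"
    by (auto intro!: derivative_eq_intros)
  note 2 = max_square_deriv_compose[OF DERIV_diff[OF DERIV_const[of 1] max_square_deriv_compose[OF 1]]]
  show ?thesis unfolding level_cut_def[abs_def]
    by (rule DERIV_cong[OF 2]) (simp add: level_cut_deriv_def)
qed

lemma level_cut_deriv_continuous: "continuous_on A level_cut_deriv"
  unfolding level_cut_deriv_def[abs_def] by (intro continuous_intros) auto

lemma level_cut_0: "s\<^sup>2 \<le> 1 \<Longrightarrow> level_cut s = 0"
proof -
  assume "s\<^sup>2 \<le> 1"
  then have "1 \<le> (max 0 ((4 - s\<^sup>2) / 3))\<^sup>2" by (intro one_le_power) simp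
  then show ?thesis by (simp add: level_cut_def)
qed

lemma level_cut_1: "4 \<le> s\<^sup>2 \<Longrightarrow> level_cut s = 1"
  by (simp add: level_cut_def max_def)

lemma level_cut_deriv_eq_0: "s\<^sup>2 \<le> 1 \<or> 4 \<le> s\<^sup>2 \<Longrightarrow> level_cut_deriv s = 0"
proof -
  assume s: "s\<^sup>2 \<le> 1 \<or> 4 \<le> s\<^sup>2"
  from s show ?thesis
  proof
    assume "s\<^sup>2 \<le> 1"
    then have "1 \<le> (max 0 ((4 - s\<^sup>2) / 3))\<^sup>2" by (intro one_le_power) simp
    then have "max 0 (1 - (max 0 ((4 - s\<^sup>2) / 3))\<^sup>2) = 0" by (intro max_absorb1) linarith
    then show ?thesis by (simp only: level_cut_deriv_def) 
  next
    assume "4 \<le> s\<^sup>2"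
    then have "max 0 ((4 - s\<^sup>2) / 3) = 0" by (intro max_absorb1) simp
    then show ?thesis by (simp add: level_cut_deriv_def)
  qed
qed

lemma level_cut_deriv_bound: "\<bar>level_cut_deriv s\<bar> \<le> 6"
proof (cases "s\<^sup>2 \<le> 1 \<or> 4 \<le> s\<^sup>2")
  case True then show ?thesis by (simp add: level_cut_deriv_eq_0)
next
  case False
  then have "\<bar>s\<bar> \<le> 2" using abs_le_square_iff[of s 2] by simp
  have gen: "0 \<le> X \<Longrightarrow> \<bar>2 * max 0 (1 - X)\<bar> \<le> 2" for X :: real by (auto simp: max_def)
  have 1: "\<bar>2 * max 0 (1 - (max 0 ((4 - s\<^sup>2) / 3))\<^sup>2)\<bar> \<le> 2" by (rule gen) simp
  have 2: "\<bar>2 * max 0 ((4 - s\<^sup>2) / 3)\<bar> \<le> 2" using False by (simp add: max_def)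
  have 3: "\<bar>2 * s / 3\<bar> \<le> 4 / 3" using \<open>\<bar>s\<bar> \<le> 2\<close> by simp
  \<comment> \<open>The product is 16/3, rounded up to 6.\<close>
  have "\<bar>level_cut_deriv s\<bar> \<le> 2 * (2 * (4 / 3))"
    unfolding level_cut_deriv_def abs_mult[of "2 * max 0 (1 - (max 0 ((4 - s\<^sup>2) / 3))\<^sup>2)"] abs_mult[of "2 * max 0 ((4 - s\<^sup>2) / 3)"]
    by (intro mult_mono 1 2 3) auto
  then show ?thesis by simp
qed

lemma C1_pair_compose:
  assumes "C1_pair S u G" and F: "\<And>s. (F has_real_derivative F' s) (at s)" "continuous_on UNIV F'"
  shows "C1_pair S (\<lambda>x. F (u x)) (\<lambda>x. F' (u x) *\<^sub>R G x)"
  unfolding C1_pair_def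
proof (intro conjI ballI)
  show "open S" using assms by (simp add: C1_pair_def)
  have u: "continuous_on S u"
    using assms(1) by (auto simp: C1_pair_def intro!: continuous_at_imp_continuous_on has_derivative_continuous)
  have "continuous_on S (\<lambda>x. F' (u x))" by (rule continuous_on_compose2[OF F(2) u]) simp
  then show "continuous_on S (\<lambda>x. F' (u x) *\<^sub>R G x)"
    using assms(1) by (intro continuous_intros) (simp_all add: C1_pair_def)
  fix x assume "x \<in> S"
  then have "(u has_derivative (\<lambda>v. G x \<bullet> v)) (at x)" using assms(1) by (simp add: C1_pair_def)
  from has_derivative_compose[OF this F(1)[unfolded has_field_derivative_def]]
  show "((\<lambda>x. F (u x)) has_derivative (\<lambda>v. F' (u x) *\<^sub>R G x \<bullet> v)) (at x)" by simp
qed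

lemma C1_pair_continuous: "C1_pair S u G \<Longrightarrow> continuous_on S u"
  by (auto simp: C1_pair_def intro!: continuous_at_imp_continuous_on has_derivative_continuous)

text \<open>The inclusion of l^1 in l^q: each x_k^q is x_k times x_k^(q-1), and x_k is at most the
  total. This is how q >= 1 lets the weak estimates be summed over all levels.\<close>

lemma sum_powr_le_powr_sum:
  fixes x :: "nat \<Rightarrow> real"
  assumes "1 \<le> q" "\<And>k. 0 \<le> x k" "(\<Sum>k<K. x k) \<le> y"
  shows "(\<Sum>k<K. x k powr q) \<le> y powr q"
proof -
  have y: "0 \<le> y" 
  proof -
    have "0 \<le> (\<Sum>k<K. x k)" by (intro sum_nonneg) (use assms(2) in auto)
    then show ?thesis using assms(3) by linarith
  qed
  have "(\<Sum>k<K. x k powr q) \<le> (\<Sum>k<K. x k * y powr (q - 1))"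
  proof (rule sum_mono)
    fix k assume k: "k \<in> {..<K}"
    have "x k \<le> (\<Sum>k<K. x k)" using k assms(2) by (intro member_le_sum) auto
    then have "x k \<le> y" using assms(3) by linarith
    then have "x k powr (q - 1) \<le> y powr (q - 1)" using assms(1,2) by (intro powr_mono2) auto
    moreover have "x k powr q = x k * x k powr (q - 1)"
      using assms(2)[of k] by (cases "x k = 0") (auto simp: powr_mult_base)
    ultimately show "x k powr q \<le> x k * y powr (q - 1)" using assms(2) by (simp add: mult_left_mono)
  qed
  also have "\<dots> = (\<Sum>k<K. x k) * y powr (q - 1)" by (simp add: sum_distrib_right)
  also have "\<dots> \<le> y * y powr (q - 1)" using assms(3) by (intro mult_right_mono) auto
  also have "\<dots> = y powr q" using y by (cases "y = 0") (auto simp: powr_mult_base)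
  finally show ?thesis .
qed

lemma sum_dyadic_indicator_le:
  fixes t L :: real
  assumes "L > 0"
  shows "(\<Sum>k<K. indicator {L * 2 ^ k<..<2 * (L * 2 ^ k)} t :: ennreal) \<le> indicator {L<..<L * 2 ^ K} t"
proof (induction K)
  case (Suc K)
  have "(\<Sum>k<Suc K. indicator {L * 2 ^ k<..<2 * (L * 2 ^ k)} t :: ennreal)
      \<le> indicator {L<..<L * 2 ^ K} t + indicator {L * 2 ^ K<..<2 * (L * 2 ^ K)} t"
    using Suc by (simp add: add_right_mono)
  also have "\<dots> \<le> indicator {L<..<L * 2 ^ Suc K} t"
  proof -
    have "L * 1 \<le> L * 2 ^ K" using assms by (intro mult_left_mono) auto
    then have "L < t" if "L * 2 ^ K < t" using that by linarith
    then show ?thesis using assms by (auto simp: indicator_def)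
  qed
  finally show ?case .
qed simp

lemma borel_measurable_of_continuous_on:
  fixes f :: "'a::euclidean_space \<Rightarrow> 'b::euclidean_space"
  assumes "open S" "continuous_on S f"
  shows "(\<lambda>x. indicator S x *\<^sub>R f x) \<in> borel_measurable borel"
  by (rule borel_measurable_continuous_on_indicator[OF borel_open[OF assms(1)] assms(2)])

lemma dyadic_level_exists:
  fixes t L :: real
  assumes "L > 0" "2 * L \<le> t" "t < 2 * L * 2 ^ K"
  obtains k where "k < K" "2 * (L * 2 ^ k) \<le> t" "t < 4 * (L * 2 ^ k)"
proof -
  let ?P = "\<lambda>n. t < 2 * L * 2 ^ n"
  define n where "n = (LEAST n. ?P n)"
  have n: "?P n" unfolding n_def by (rule LeastI[of ?P, OF assms(3)])
  have nK: "n \<le> K" unfolding n_def by (rule Least_le[of ?P, OF assms(3)])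
  have "n \<noteq> 0"
  proof
    assume "n = 0"
    with n have "t < 2 * L * 2 ^ 0" by metis
    then show False using assms(2) by simp
  qed
  then obtain k where k: "n = Suc k" using not0_implies_Suc by blast
  have "\<not> ?P k" using not_less_Least[of k ?P] k by (simp add: n_def)
  then show ?thesis using that[of k] n nK k by simp
qed

text \<open>Maz'ya's truncation method. The weak estimate is applied to the smooth step of u between
  the levels l_k and 2 l_k. The gradient of this step is at most 6/l_k |grad u| and lives where l_k
  < |u| < 2 l_k; these regions are disjoint, so the right-hand sides add up to at most a multiple of
  \<open>y\<close>, and their q-th powers are summable. Each superlevel set controls |u|^r on the
  next dyadic layer, where |u| < 4 l_k.\<close>

lemma dyadic_weak_to_strong:
  fixes u :: "'a::euclidean_space \<Rightarrow> real"
  assumes W: "weak_sobolev_const TYPE('a) q C" and q: "1 \<le> q" "q \<le> r"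
    and \<rho>: "\<rho> > 0" and C1: "C1_pair {x. norm x > \<rho>} u G" and L: "L > 0"
    and R: "\<And>y. norm y \<ge> R \<Longrightarrow> \<bar>u y\<bar> \<le> L" and B: "\<And>x. norm x > \<rho> \<Longrightarrow> \<bar>u x\<bar> \<le> B"
    and y: "0 \<le> y" "(\<integral>\<^sup>+x. indicator {x. norm x > \<rho> \<and> \<bar>u x\<bar> > L} x *
      ennreal (norm x powr (1 - real DIM('a) * (1 - 1 / q)) * \<bar>u x\<bar> powr (r / q - 1) * norm (G x)) \<partial>lborel) \<le> ennreal y"
  shows "(\<integral>\<^sup>+x. indicator {x. norm x > \<rho> \<and> \<bar>u x\<bar> \<ge> 2 * L} x * ennreal (\<bar>u x\<bar> powr r) \<partial>lborel)
      \<le> ennreal (4 powr r * (6 * C) powr q * y powr q)"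
proof -
  let ?S = "{x::'a. norm x > \<rho>}"
  let ?\<beta> = "1 - real DIM('a) * (1 - 1 / q)"
  let ?\<gamma> = "r / q"
  define l where "l k = L * 2 ^ k" for k :: nat
  have l: "l k > 0" "L \<le> l k" for k
  proof -
    show "l k > 0" using L by (simp add: l_def)
    have "L * 1 \<le> L * 2 ^ k" using L by (intro mult_left_mono) auto
    then show "L \<le> l k" by (simp add: l_def)
  qed
  have C: "C > 0" using W by (simp add: weak_sobolev_const_def)
  have S: "open ?S" using C1 by (simp add: C1_pair_def)
  note uc = C1_pair_continuous[OF C1]
  have Gc: "continuous_on ?S G" using C1 by (simp add: C1_pair_def)
  define u' where "u' x = indicator ?S x *\<^sub>R u x" for x
  define G' where "G' x = indicator ?S x *\<^sub>R G x" for x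
  have [measurable]: "u' \<in> borel_measurable borel" "G' \<in> borel_measurable borel" "?S \<in> sets borel"
    using borel_measurable_of_continuous_on[OF S uc] borel_measurable_of_continuous_on[OF S Gc] S
    by (auto simp: u'_def[abs_def] G'_def[abs_def])
  define E where "E k = {x \<in> ?S. 2 * l k \<le> \<bar>u' x\<bar>}" for k
  have E: "E k \<in> sets borel" for k unfolding E_def by measurable
  define Q where "Q x = ennreal (norm x powr ?\<beta> * \<bar>u' x\<bar> powr (?\<gamma> - 1) * norm (G' x))" for x
  have Q[measurable]: "Q \<in> borel_measurable borel" unfolding Q_def by measurable
  define g where "g k = (\<integral>\<^sup>+x. indicator {l k<..<2 * l k} \<bar>u' x\<bar> * Q x \<partial>lborel)" for k
  have gsum: "(\<Sum>k<K. g k) \<le> ennreal y" for K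
  proof -
    have "(\<Sum>k<K. g k) = (\<integral>\<^sup>+x. (\<Sum>k<K. indicator {l k<..<2 * l k} \<bar>u' x\<bar> * Q x) \<partial>lborel)"
      unfolding g_def by (subst nn_integral_sum) auto
    also have "\<dots> \<le> (\<integral>\<^sup>+x. indicator {x. norm x > \<rho> \<and> \<bar>u x\<bar> > L} x *
      ennreal (norm x powr ?\<beta> * \<bar>u x\<bar> powr (?\<gamma> - 1) * norm (G x)) \<partial>lborel)"
    proof (rule nn_integral_mono)
      fix x :: 'a
      show "(\<Sum>k<K. indicator {l k<..<2 * l k} \<bar>u' x\<bar> * Q x) \<le> indicator {x. norm x > \<rho> \<and> \<bar>u x\<bar> > L} x *
         ennreal (norm x powr ?\<beta> * \<bar>u x\<bar> powr (?\<gamma> - 1) * norm (G x))"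
      proof (cases "x \<in> ?S")
        case True
        have "(\<Sum>k<K. indicator {l k<..<2 * l k} \<bar>u' x\<bar> * Q x) = (\<Sum>k<K. indicator {l k<..<2 * l k} \<bar>u' x\<bar>) * Q x"
          by (rule sum_distrib_right[symmetric])
        also have "\<dots> \<le> indicator {L<..<L * 2 ^ K} \<bar>u' x\<bar> * Q x"
          using sum_dyadic_indicator_le[OF L, of \<open>\<bar>u' x\<bar>\<close> K] by (intro mult_right_mono) (auto simp: l_def)
        also have "\<dots> \<le> indicator {x. norm x > \<rho> \<and> \<bar>u x\<bar> > L} x * Q x"
          using True by (auto simp: indicator_def u'_def)
        finally show ?thesis using True by (simp add: Q_def u'_def G'_def)
      qed (auto simp: Q_def G'_def)
    qed
    also note y(2)
    finally show ?thesis .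
  qed
  have gfin: "g k < \<infinity>" for k
  proof -
    have "g k \<le> (\<Sum>k<Suc k. g k)" by (rule member_le_sum) auto
    also note gsum
    finally show ?thesis by (simp add: le_less_trans)
  qed
  define xx where "xx k = enn2real (g k)" for k
  have xx: "g k = ennreal (xx k)" "0 \<le> xx k" for k using gfin[of k] by (auto simp: xx_def)
  have xsum: "(\<Sum>k<K. xx k) \<le> y" for K
    using gsum[of K] y(1) by (simp add: xx sum_ennreal)
  have Efin: "emeasure lborel (E k) = ennreal (measure lborel (E k))" for k
  proof -
    have "norm x < R" if "x \<in> E k" for x
    proof (rule ccontr)
      assume "\<not> norm x < R"
      then have "\<bar>u x\<bar> \<le> L" using R by simp
      moreover have "2 * l k \<le> \<bar>u x\<bar>" using that by (auto simp: E_def u'_def)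
      ultimately show False using l[of k] by linarith
    qed
    then have "E k \<subseteq> ball 0 R" by auto
    then have "emeasure lborel (E k) < \<infinity>" by (intro emeasure_bounded_finite bounded_subset[OF bounded_ball])
    then show ?thesis by (intro emeasure_eq_ennreal_measure) auto
  qed
  have key: "(4 * l k) powr r * measure lborel (E k) \<le> 4 powr r * (6 * C) powr q * xx k powr q" for k
  proof -
    let ?w = "\<lambda>x. level_cut ((1 / l k) * u x)"
    let ?H = "\<lambda>x. (level_cut_deriv ((1 / l k) * u x) * (1 / l k)) *\<^sub>R G x"
    have wC1: "C1_pair ?S ?w ?H"
    proof (rule C1_pair_compose[OF C1, of "\<lambda>s. level_cut ((1 / l k) * s)" "\<lambda>s. level_cut_deriv ((1 / l k) * s) * (1 / l k)"])
      show "((\<lambda>s. level_cut ((1 / l k) * s)) has_real_derivative level_cut_deriv ((1 / l k) * s) * (1 / l k)) (at s)" for s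
        by (rule DERIV_chain2[OF level_cut_has_derivative]) (rule DERIV_cmult_Id)
      show "continuous_on UNIV (\<lambda>s. level_cut_deriv ((1 / l k) * s) * (1 / l k))"
        by (intro continuous_intros continuous_on_compose2[OF level_cut_deriv_continuous[of UNIV]]) auto
    qed
    have sq: "((1 / l k) * t)\<^sup>2 = t\<^sup>2 / (l k)\<^sup>2" for t by (simp add: power_divide)
    have w0: "?w z = 0" if "R \<le> norm z" for z
    proof (rule level_cut_0)
      have "\<bar>u z\<bar> \<le> \<bar>l k\<bar>" using R[OF that] l[of k] by linarith
      then have "(u z)\<^sup>2 \<le> (l k)\<^sup>2" by (simp add: abs_le_square_iff)
      then show "((1 / l k) * u z)\<^sup>2 \<le> 1" unfolding sq using l[of k] by (simp add: divide_le_eq_1)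
    qed
    have w1: "norm x > \<rho> \<and> 1 \<le> ?w x" if "x \<in> E k" for x
    proof -
      have "\<bar>2 * l k\<bar> \<le> \<bar>u x\<bar>" using that l[of k] by (auto simp add: E_def u'_def)
      then have "(2 * l k)\<^sup>2 \<le> (u x)\<^sup>2" by (simp only: abs_le_square_iff)
      then have "4 \<le> ((1 / l k) * u x)\<^sup>2" unfolding sq using l[of k] by (simp add: le_divide_eq power_mult_distrib)
      then have "?w x = 1" by (rule level_cut_1)
      then show ?thesis using that by (simp add: E_def)
    qed
    have "ennreal (measure lborel (E k) powr (1 / q)) \<le>
       ennreal C * (\<integral>\<^sup>+z. indicator ?S z * ennreal (norm z powr ?\<beta> * norm (?H z)) \<partial>lborel)"
      using W[unfolded weak_sobolev_const_def, THEN conjunct2, rule_format, OF \<rho> wC1, of R "E k"] w0 w1 E by blast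
    also have "\<dots> \<le> ennreal C * (\<integral>\<^sup>+z. ennreal (6 * l k powr (- ?\<gamma>)) * (indicator {l k<..<2 * l k} \<bar>u' z\<bar> * Q z) \<partial>lborel)"
    proof (intro mult_left_mono nn_integral_mono)
      fix z :: 'a
      show "indicator ?S z * ennreal (norm z powr ?\<beta> * norm (?H z)) \<le> ennreal (6 * l k powr (- ?\<gamma>)) * (indicator {l k<..<2 * l k} \<bar>u' z\<bar> * Q z)"
      proof (cases "z \<in> ?S \<and> l k < \<bar>u z\<bar> \<and> \<bar>u z\<bar> < 2 * l k")
        case True
        then have z: "u' z = u z" "G' z = G z" by (auto simp: u'_def G'_def)
        have "\<bar>level_cut_deriv ((1 / l k) * u z)\<bar> * (1 / l k) \<le> 6 * (1 / l k)"
          using l[of k] level_cut_deriv_bound by (intro mult_right_mono) auto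
        also have "6 * (1 / l k) \<le> 6 * (l k powr (- ?\<gamma>) * \<bar>u z\<bar> powr (?\<gamma> - 1))"
        proof -
          \<comment> \<open>The second factor has nonnegative exponent since q <= r, so it may be
            replaced by the same power of |u| > l_k. The first one disappears later because (r/q) q
            = r.\<close>
          have e: "1 / l k = l k powr (- ?\<gamma>) * l k powr (?\<gamma> - 1)"
            using l[of k] by (subst powr_add[symmetric]) (simp add: powr_minus_divide)
          show ?thesis unfolding e
            using l[of k] True q by (intro mult_left_mono powr_mono2) (auto simp: le_divide_eq)
        qed
        finally have d: "\<bar>level_cut_deriv ((1 / l k) * u z)\<bar> * (1 / l k) \<le> 6 * (l k powr (- ?\<gamma>) * \<bar>u z\<bar> powr (?\<gamma> - 1))" .
        have "norm (?H z) = (\<bar>level_cut_deriv ((1 / l k) * u z)\<bar> * (1 / l k)) * norm (G z)"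
          using l[of k] by (simp add: abs_mult)
        also have "\<dots> \<le> (6 * (l k powr (- ?\<gamma>) * \<bar>u z\<bar> powr (?\<gamma> - 1))) * norm (G z)"
          by (rule mult_right_mono[OF d norm_ge_zero])
        finally have "norm z powr ?\<beta> * norm (?H z) \<le> norm z powr ?\<beta> * ((6 * (l k powr (- ?\<gamma>) * \<bar>u z\<bar> powr (?\<gamma> - 1))) * norm (G z))"
          by (intro mult_left_mono) auto
        also have "\<dots> = (6 * l k powr (- ?\<gamma>)) * (norm z powr ?\<beta> * \<bar>u' z\<bar> powr (?\<gamma> - 1) * norm (G' z))"
          by (simp add: z)
        finally have "ennreal (norm z powr ?\<beta> * norm (?H z)) \<le> ennreal (6 * l k powr (- ?\<gamma>)) * Q z"
          unfolding Q_def by (subst ennreal_mult[symmetric]) (auto intro!: ennreal_leI)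
        then show ?thesis using True z by simp
      next
        case False
        show ?thesis
        proof (cases "z \<in> ?S")
          case zS: True
          have "((1 / l k) * u z)\<^sup>2 \<le> 1 \<or> 4 \<le> ((1 / l k) * u z)\<^sup>2"
          proof (cases "\<bar>u z\<bar> \<le> l k")
            case True
            then have "\<bar>u z\<bar> \<le> \<bar>l k\<bar>" using l[of k] by linarith
            then have "(u z)\<^sup>2 \<le> (l k)\<^sup>2" by (simp add: abs_le_square_iff)
            then show ?thesis unfolding sq using l[of k] by (simp add: divide_le_eq_1)
          next
            case 2: False
            then have "\<bar>2 * l k\<bar> \<le> \<bar>u z\<bar>" using l[of k] False zS by auto
            then have "(2 * l k)\<^sup>2 \<le> (u z)\<^sup>2" by (simp only: abs_le_square_iff)
            then show ?thesis unfolding sq using l[of k] by (simp add: le_divide_eq power_mult_distrib)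
          qed
          then have "level_cut_deriv ((1 / l k) * u z) = 0" by (rule level_cut_deriv_eq_0)
          then have "?H z = 0" by (simp only: mult_zero_left scaleR_zero_left)
          then show ?thesis by (simp only: norm_zero mult_zero_right ennreal_0) simp
        qed simp
      qed
    qed simp
    also have "\<dots> = ennreal C * (ennreal (6 * l k powr (- ?\<gamma>)) * g k)"
      unfolding g_def by (subst nn_integral_cmult) auto
    also have "\<dots> = ennreal (C * (6 * l k powr (- ?\<gamma>) * xx k))"
      using C by (simp add: xx ennreal_mult[symmetric])
    finally have a: "measure lborel (E k) powr (1 / q) \<le> C * (6 * l k powr (- ?\<gamma>) * xx k)"
      using C xx(2)[of k] by (subst (asm) ennreal_le_iff) auto
    then have "(measure lborel (E k) powr (1 / q)) powr q \<le> (C * (6 * l k powr (- ?\<gamma>) * xx k)) powr q"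
      using q by (intro powr_mono2) auto
    also have "(measure lborel (E k) powr (1 / q)) powr q = measure lborel (E k)"
      using q by (simp add: powr_powr)
    also have "(C * (6 * l k powr (- ?\<gamma>) * xx k)) powr q = ((6 * C) * l k powr (- ?\<gamma>) * xx k) powr q" by (simp add: mult_ac)
    also have "\<dots> = (6 * C) powr q * l k powr (- r) * xx k powr q"
      using C xx(2)[of k] q by (simp add: powr_mult powr_powr)
    finally have "measure lborel (E k) \<le> (6 * C) powr q * l k powr (- r) * xx k powr q" .
    then have "(4 * l k) powr r * measure lborel (E k) \<le> (4 * l k) powr r * ((6 * C) powr q * l k powr (- r) * xx k powr q)"
      by (intro mult_left_mono) auto
    also have "\<dots> = 4 powr r * (6 * C) powr q * xx k powr q"
      using l[of k] by (simp add: powr_mult powr_minus)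
    finally show ?thesis .
  qed
  \<comment> \<open>Boundedness of u makes finitely many levels sufficient; the final bound does not
    involve their number.\<close>
  obtain K where K: "B < 2 * L * 2 ^ K"
  proof -
    obtain n where "B / (2 * L) < 2 ^ n" using real_arch_pow[of 2 "B / (2 * L)"] by auto
    then show ?thesis using that[of n] L by (simp add: field_simps)
  qed
  have "(\<integral>\<^sup>+x. indicator {x. norm x > \<rho> \<and> \<bar>u x\<bar> \<ge> 2 * L} x * ennreal (\<bar>u x\<bar> powr r) \<partial>lborel)
    \<le> (\<integral>\<^sup>+x. (\<Sum>k<K. ennreal ((4 * l k) powr r) * indicator (E k) x) \<partial>lborel)"
  proof (rule nn_integral_mono)
    fix x :: 'a
    show "indicator {x. norm x > \<rho> \<and> \<bar>u x\<bar> \<ge> 2 * L} x * ennreal (\<bar>u x\<bar> powr r) \<le> (\<Sum>k<K. ennreal ((4 * l k) powr r) * indicator (E k) x)"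
    proof (cases "norm x > \<rho> \<and> \<bar>u x\<bar> \<ge> 2 * L")
      case True
      have "\<bar>u x\<bar> < 2 * L * 2 ^ K" using B[of x] True K by linarith
      with True L obtain k where k: "k < K" "2 * (L * 2 ^ k) \<le> \<bar>u x\<bar>" "\<bar>u x\<bar> < 4 * (L * 2 ^ k)"
        using dyadic_level_exists[of L "\<bar>u x\<bar>" K] by blast
      have "\<bar>u x\<bar> powr r \<le> (4 * l k) powr r" using k q by (intro powr_mono2) (auto simp: l_def)
      then have "ennreal (\<bar>u x\<bar> powr r) \<le> ennreal ((4 * l k) powr r) * indicator (E k) x"
        using True k by (simp add: E_def u'_def l_def ennreal_leI)
      also have "\<dots> \<le> (\<Sum>k<K. ennreal ((4 * l k) powr r) * indicator (E k) x)"
        by (rule member_le_sum) (use k in auto)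
      finally show ?thesis using True by simp
    qed simp
  qed
  also have "\<dots> = (\<Sum>k<K. ennreal ((4 * l k) powr r) * emeasure lborel (E k))"
    using E by (subst nn_integral_sum) (auto simp: nn_integral_cmult)
  also have "\<dots> = (\<Sum>k<K. ennreal ((4 * l k) powr r * measure lborel (E k)))"
    by (simp add: Efin ennreal_mult)
  also have "\<dots> \<le> (\<Sum>k<K. ennreal (4 powr r * (6 * C) powr q * xx k powr q))"
    by (intro sum_mono ennreal_leI key)
  also have "\<dots> = ennreal (4 powr r * (6 * C) powr q * (\<Sum>k<K. xx k powr q))"
    by (subst sum_ennreal) (auto simp: sum_distrib_left)
  also have "\<dots> \<le> ennreal (4 powr r * (6 * C) powr q * y powr q)"
    using sum_powr_le_powr_sum[OF q(1) xx(2) xsum] by (intro ennreal_leI mult_left_mono) auto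
  finally show ?thesis .
qed

subsection \<open>Absorption and a priori bounds\<close>

text \<open>Hoelder's inequality in pointwise form: a weighted geometric mean is at most the
  maximum, hence at most the sum. When the integral of T is at most z, integrating gives z^(1-1/p)
  times the integral of f^p plus 1, and p = 1 needs no separate treatment.\<close>

lemma young_scaled:
  fixes f T z p :: real
  assumes "0 \<le> f" "0 \<le> T" "1 \<le> z" "1 \<le> p"
  shows "f * T powr (1 - 1 / p) \<le> z powr (1 - 1 / p) * (f powr p + T / z)"
proof -
  let ?A = "f powr p" and ?B = "T / z"
  let ?m = "max ?A ?B"
  have "f = ?A powr (1 / p)" using assms by (simp add: powr_powr)
  then have "f * ?B powr (1 - 1 / p) = ?A powr (1 / p) * ?B powr (1 - 1 / p)" by simp
  also have "\<dots> \<le> ?m powr (1 / p) * ?m powr (1 - 1 / p)"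
    using assms by (intro mult_mono powr_mono2) auto
  also have "\<dots> = ?m"
  proof -
    have "0 \<le> ?m" by (simp add: le_max_iff_disj)
    then show ?thesis by (subst powr_add[symmetric]) simp
  qed
  also have "\<dots> \<le> ?A + ?B" using assms by simp
  finally have "z powr (1 - 1 / p) * (f * ?B powr (1 - 1 / p)) \<le> z powr (1 - 1 / p) * (?A + ?B)"
    by (intro mult_left_mono) auto
  moreover have "T powr (1 - 1 / p) = z powr (1 - 1 / p) * ?B powr (1 - 1 / p)"
    using assms by (subst powr_mult[symmetric]) auto
  ultimately show ?thesis by (simp add: mult_ac)
qed

text \<open>As z >= 1, the additive constant is also at most c z^\<theta>, and everything can be
  divided by z^\<theta>.\<close>

lemma absorb_powr:
  fixes z K \<theta> :: real
  assumes "1 \<le> z" "\<theta> < 1" "0 \<le> \<theta>" "0 \<le> c" "0 \<le> K" "z \<le> c + K * z powr \<theta>"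
  shows "z \<le> (c + K) powr (1 / (1 - \<theta>))"
proof -
  have zt: "1 \<le> z powr \<theta>" using assms by (intro ge_one_powr_ge_zero) auto
  then have "c * 1 \<le> c * z powr \<theta>" using assms by (intro mult_left_mono) auto
  then have "z \<le> (c + K) * z powr \<theta>" using assms(6) by (simp add: ring_distribs)
  moreover have "z = z powr (1 - \<theta>) * z powr \<theta>" using assms by (simp add: powr_add[symmetric])
  ultimately have "z powr (1 - \<theta>) * z powr \<theta> \<le> (c + K) * z powr \<theta>" by linarith
  then have "z powr (1 - \<theta>) \<le> c + K" by (rule mult_right_le_imp_le) (use zt in linarith)
  then have "(z powr (1 - \<theta>)) powr (1 / (1 - \<theta>)) \<le> (c + K) powr (1 / (1 - \<theta>))"
    using assms by (intro powr_mono2) auto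
  then show ?thesis using assms by (simp add: powr_powr)
qed

lemma ennreal_mult_add_mult_add:
  "0 \<le> c \<Longrightarrow> 0 \<le> P \<Longrightarrow> 0 \<le> e \<Longrightarrow> 0 \<le> V \<Longrightarrow> 0 \<le> W \<Longrightarrow>
    ennreal (c * (P + e * (V + W))) = ennreal c * (ennreal P + ennreal e * (ennreal V + ennreal W))"
  by (simp add: ennreal_mult)

text \<open>The point is the list of what the bound does not contain: \<rho>, \<open>R\<close>,
  \<open>B\<close>, and \<open>L\<close> except through \<open>c3\<close>. The function \<zeta>
  supplies the extra room for r < p and is 0 in the other ranges. The strip L < |u| < 2L escapes the
  truncation argument and is charged to \<open>c3\<close>.\<close>

lemma a_priori_bound:
  fixes u :: "'a::euclidean_space \<Rightarrow> real"
  assumes W: "weak_sobolev_const TYPE('a) q C" and q: "1 \<le> q" "q \<le> r" and p: "1 \<le> p" "q * (1 - 1 / p) < 1"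
    and nn: "0 \<le> c1" "0 \<le> c2" "0 \<le> c3" "0 \<le> \<Gamma>"
    and \<rho>: "\<rho> > 0" and C1: "C1_pair {x. norm x > \<rho>} u G" and L: "L > 0"
    and R: "\<And>y. norm y \<ge> R \<Longrightarrow> \<bar>u y\<bar> \<le> L" and B: "\<And>x. norm x > \<rho> \<Longrightarrow> \<bar>u x\<bar> \<le> B"
    and \<zeta>: "\<zeta> \<in> borel_measurable borel" "\<And>x. 0 \<le> \<zeta> x"
    and pt: "\<And>x. norm x > \<rho> \<Longrightarrow> \<bar>u x\<bar> > L \<Longrightarrow>
      norm x powr (1 - real DIM('a) * (1 - 1 / q)) * \<bar>u x\<bar> powr (r / q - 1)
        \<le> c1 * norm x powr (b / p) * (\<bar>u x\<bar> powr r + \<zeta> x) powr (1 - 1 / p)"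
    and i2: "(\<integral>\<^sup>+x. indicator {x. norm x > \<rho> \<and> \<bar>u x\<bar> > L} x * ennreal (\<zeta> x) \<partial>lborel) \<le> ennreal c2"
    and i\<Gamma>: "(\<integral>\<^sup>+x. indicator {x. norm x > \<rho> \<and> \<bar>u x\<bar> > L} x * ennreal (norm x powr b * norm (G x) powr p) \<partial>lborel) \<le> ennreal \<Gamma>"
    and i3: "(\<integral>\<^sup>+x. indicator {x. norm x > \<rho> \<and> L < \<bar>u x\<bar> \<and> \<bar>u x\<bar> < 2 * L} x * ennreal (\<bar>u x\<bar> powr r) \<partial>lborel) \<le> ennreal c3"
  shows "(\<integral>\<^sup>+x. indicator {x. norm x > \<rho> \<and> \<bar>u x\<bar> > L} x * ennreal (\<bar>u x\<bar> powr r) \<partial>lborel)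
      \<le> ennreal ((1 + c2 + c3 + 4 powr r * (6 * C) powr q * (c1 * (\<Gamma> + 1)) powr q) powr (1 / (1 - q * (1 - 1 / p))))"
proof -
  let ?S = "{x::'a. norm x > \<rho>}"
  let ?\<beta> = "1 - real DIM('a) * (1 - 1 / q)"
  let ?T = "{x. norm x > \<rho> \<and> \<bar>u x\<bar> > L}"
  let ?p' = "1 - 1 / p"
  have p': "0 \<le> ?p'" using p by simp
  have S: "open ?S" using C1 by (simp add: C1_pair_def)
  note uc = C1_pair_continuous[OF C1]
  have Gc: "continuous_on ?S G" using C1 by (simp add: C1_pair_def)
  define u' where "u' x = indicator ?S x *\<^sub>R u x" for x
  define G' where "G' x = indicator ?S x *\<^sub>R G x" for x
  have [measurable]: "u' \<in> borel_measurable borel" "G' \<in> borel_measurable borel" "?S \<in> sets borel"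
    using borel_measurable_of_continuous_on[OF S uc] borel_measurable_of_continuous_on[OF S Gc] S
    by (auto simp: u'_def[abs_def] G'_def[abs_def])
  note [measurable] = \<zeta>(1)
  define A where "A = {x \<in> ?S. L < \<bar>u' x\<bar>}"
  have AT: "?T = A" by (auto simp: A_def u'_def)
  have A[measurable]: "A \<in> sets borel" unfolding A_def by measurable
  define U where "U x = indicator A x * ennreal (\<bar>u' x\<bar> powr r)" for x
  have U: "indicator ?T x * ennreal (\<bar>u x\<bar> powr r) = U x" for x
    unfolding AT by (auto simp: U_def A_def u'_def indicator_def)
  have [measurable]: "U \<in> borel_measurable borel" unfolding U_def by measurable
  let ?X = "\<integral>\<^sup>+x. U x \<partial>lborel"
  have "norm x < R" if "x \<in> A" for x
    using R[of x] that by (force simp: A_def u'_def not_less[symmetric])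
  then have "A \<subseteq> ball 0 R" by auto
  then have Afin: "emeasure lborel A < \<infinity>" by (intro emeasure_bounded_finite bounded_subset[OF bounded_ball])
  \<comment> \<open>Absorption requires the integral to be finite beforehand. The crude bound used
    for this, a height times the measure of a bounded set, leaves no trace in the result.\<close>
  have "?X \<le> (\<integral>\<^sup>+x. ennreal (\<bar>B\<bar> powr r) * indicator A x \<partial>lborel)"
  proof (rule nn_integral_mono)
    fix x
    show "U x \<le> ennreal (\<bar>B\<bar> powr r) * indicator A x"
    proof (cases "x \<in> A")
      case True
      then have "\<bar>u' x\<bar> \<le> \<bar>B\<bar>" using B[of x] by (auto simp: A_def u'_def)
      then have "\<bar>u' x\<bar> powr r \<le> \<bar>B\<bar> powr r" using q by (intro powr_mono2) auto
      then show ?thesis using True by (simp add: U_def ennreal_leI)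
    qed (simp add: U_def)
  qed
  also have "\<dots> < \<infinity>" using Afin by (simp add: nn_integral_cmult ennreal_mult_less_top)
  finally obtain X where X: "?X = ennreal X" "0 \<le> X" by (cases ?X) auto
  \<comment> \<open>This dominates the integral of |u|^r + \<zeta> over the superlevel set, as the
    pointwise Hoelder step wants, and is at least 1, as the absorption wants.\<close>
  define z where "z = 1 + X + c2"
  have z: "1 \<le> z" using X nn by (simp add: z_def)
  define y where "y = c1 * z powr ?p' * (\<Gamma> + 1)"
  have y0: "0 \<le> y" using nn by (simp add: y_def)
  have Y: "(\<integral>\<^sup>+x. indicator ?T x * ennreal (norm x powr ?\<beta> * \<bar>u x\<bar> powr (r / q - 1) * norm (G x)) \<partial>lborel) \<le> ennreal y"
  proof -
    have "(\<integral>\<^sup>+x. indicator ?T x * ennreal (norm x powr ?\<beta> * \<bar>u x\<bar> powr (r / q - 1) * norm (G x)) \<partial>lborel)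
      \<le> (\<integral>\<^sup>+x. ennreal (c1 * z powr ?p') * (indicator A x * ennreal (norm x powr b * norm (G' x) powr p)
           + ennreal (1 / z) * (U x + indicator A x * ennreal (\<zeta> x))) \<partial>lborel)"
    proof (rule nn_integral_mono)
      fix x :: 'a
      show "indicator ?T x * ennreal (norm x powr ?\<beta> * \<bar>u x\<bar> powr (r / q - 1) * norm (G x))
        \<le> ennreal (c1 * z powr ?p') * (indicator A x * ennreal (norm x powr b * norm (G' x) powr p)
           + ennreal (1 / z) * (U x + indicator A x * ennreal (\<zeta> x)))"
      proof (cases "x \<in> A")
        case True
        then have x: "norm x > \<rho>" "\<bar>u x\<bar> > L" "u' x = u x" "G' x = G x"
          by (auto simp: A_def u'_def G'_def)
        let ?f = "norm x powr (b / p) * norm (G x)"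
        let ?V = "\<bar>u x\<bar> powr r + \<zeta> x"
        have fp: "?f powr p = norm x powr b * norm (G x) powr p"
          using p by (simp add: powr_mult powr_powr)
        have "norm x powr ?\<beta> * \<bar>u x\<bar> powr (r / q - 1) * norm (G x) \<le> c1 * norm x powr (b / p) * ?V powr ?p' * norm (G x)"
          using pt[OF x(1,2)] by (intro mult_right_mono) auto
        also have "\<dots> = c1 * (?f * ?V powr ?p')" by simp
        also have "\<dots> \<le> c1 * (z powr ?p' * (?f powr p + ?V / z))"
          using nn z p \<zeta> by (intro mult_left_mono young_scaled) auto
        also have "\<dots> = (c1 * z powr ?p') * (norm x powr b * norm (G x) powr p + (1 / z) * ?V)"
          by (simp add: fp)
        finally have "ennreal (norm x powr ?\<beta> * \<bar>u x\<bar> powr (r / q - 1) * norm (G x)) \<le>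
          ennreal ((c1 * z powr ?p') * (norm x powr b * norm (G x) powr p + (1 / z) * ?V))" by (rule ennreal_leI)
        also have "\<dots> = ennreal (c1 * z powr ?p') * (ennreal (norm x powr b * norm (G' x) powr p)
           + ennreal (1 / z) * (U x + ennreal (\<zeta> x)))"
          using nn z \<zeta>(2)[of x] True x
          by (subst ennreal_mult_add_mult_add) (auto simp: U_def)
        finally show ?thesis using True AT by simp
      qed (simp add: AT)
    qed
    also have "\<dots> = ennreal (c1 * z powr ?p') * ((\<integral>\<^sup>+x. indicator A x * ennreal (norm x powr b * norm (G' x) powr p) \<partial>lborel)
           + ennreal (1 / z) * (?X + (\<integral>\<^sup>+x. indicator A x * ennreal (\<zeta> x) \<partial>lborel)))"
      by (subst nn_integral_cmult, measurable, subst nn_integral_add, measurable, subst nn_integral_cmult, measurable, subst nn_integral_add, measurable)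
    also have "\<dots> \<le> ennreal (c1 * z powr ?p') * (ennreal \<Gamma> + ennreal (1 / z) * (ennreal X + ennreal c2))"
    proof (intro mult_left_mono add_mono)
      have "(\<integral>\<^sup>+x. indicator A x * ennreal (norm x powr b * norm (G' x) powr p) \<partial>lborel) = (\<integral>\<^sup>+x. indicator ?T x * ennreal (norm x powr b * norm (G x) powr p) \<partial>lborel)"
        unfolding AT by (intro nn_integral_cong) (auto simp: A_def G'_def indicator_def)
      then show "(\<integral>\<^sup>+x. indicator A x * ennreal (norm x powr b * norm (G' x) powr p) \<partial>lborel) \<le> ennreal \<Gamma>"
        using i\<Gamma> by simp
      show "(\<integral>\<^sup>+x. indicator A x * ennreal (\<zeta> x) \<partial>lborel) \<le> ennreal c2" using i2 unfolding AT .
    qed (use X in auto)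
    also have "\<dots> = ennreal (c1 * z powr ?p' * (\<Gamma> + 1 / z * (X + c2)))"
      using nn X z by (subst ennreal_mult_add_mult_add) auto
    also have "\<dots> \<le> ennreal y"
    proof -
      have "1 / z * (X + c2) \<le> 1" using z by (simp add: z_def field_simps)
      then show ?thesis unfolding y_def using nn by (intro ennreal_leI mult_left_mono) auto
    qed
    finally show ?thesis .
  qed
  note D = dyadic_weak_to_strong[OF W q \<rho> C1 L R B y0 Y]
  have "?X \<le> (\<integral>\<^sup>+x. indicator {x. norm x > \<rho> \<and> \<bar>u x\<bar> \<ge> 2 * L} x * ennreal (\<bar>u x\<bar> powr r)
     + indicator {x. norm x > \<rho> \<and> L < \<bar>u x\<bar> \<and> \<bar>u x\<bar> < 2 * L} x * ennreal (\<bar>u x\<bar> powr r) \<partial>lborel)"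
    unfolding U[symmetric] by (intro nn_integral_mono) (auto simp: indicator_def)
  also have "\<dots> = (\<integral>\<^sup>+x. indicator {x. norm x > \<rho> \<and> \<bar>u x\<bar> \<ge> 2 * L} x * ennreal (\<bar>u x\<bar> powr r) \<partial>lborel)
     + (\<integral>\<^sup>+x. indicator {x. norm x > \<rho> \<and> L < \<bar>u x\<bar> \<and> \<bar>u x\<bar> < 2 * L} x * ennreal (\<bar>u x\<bar> powr r) \<partial>lborel)"
  proof (rule nn_integral_add)
    have "(\<lambda>x. indicator {x \<in> ?S. \<bar>u' x\<bar> \<ge> 2 * L} x * ennreal (\<bar>u' x\<bar> powr r)) \<in> borel_measurable lborel"
      by measurable
    also have "(\<lambda>x. indicator {x \<in> ?S. \<bar>u' x\<bar> \<ge> 2 * L} x * ennreal (\<bar>u' x\<bar> powr r)) = (\<lambda>x. indicator {x. norm x > \<rho> \<and> \<bar>u x\<bar> \<ge> 2 * L} x * ennreal (\<bar>u x\<bar> powr r))"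
      by (auto simp: fun_eq_iff indicator_def u'_def)
    finally show "(\<lambda>x. indicator {x. norm x > \<rho> \<and> \<bar>u x\<bar> \<ge> 2 * L} x * ennreal (\<bar>u x\<bar> powr r)) \<in> borel_measurable lborel" .
    have "(\<lambda>x. indicator {x \<in> ?S. L < \<bar>u' x\<bar> \<and> \<bar>u' x\<bar> < 2 * L} x * ennreal (\<bar>u' x\<bar> powr r)) \<in> borel_measurable lborel"
      by measurable
    also have "(\<lambda>x. indicator {x \<in> ?S. L < \<bar>u' x\<bar> \<and> \<bar>u' x\<bar> < 2 * L} x * ennreal (\<bar>u' x\<bar> powr r)) = (\<lambda>x. indicator {x. norm x > \<rho> \<and> L < \<bar>u x\<bar> \<and> \<bar>u x\<bar> < 2 * L} x * ennreal (\<bar>u x\<bar> powr r))"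
      by (auto simp: fun_eq_iff indicator_def u'_def)
    finally show "(\<lambda>x. indicator {x. norm x > \<rho> \<and> L < \<bar>u x\<bar> \<and> \<bar>u x\<bar> < 2 * L} x * ennreal (\<bar>u x\<bar> powr r)) \<in> borel_measurable lborel" .
  qed
  also have "\<dots> \<le> ennreal (4 powr r * (6 * C) powr q * y powr q) + ennreal c3"
    by (intro add_mono D i3)
  finally have "X \<le> 4 powr r * (6 * C) powr q * y powr q + c3"
    using X nn by (simp add: ennreal_plus[symmetric] del: ennreal_plus)
  moreover have "y powr q = (c1 * (\<Gamma> + 1)) powr q * z powr (q * ?p')"
  proof -
    have "y = (c1 * (\<Gamma> + 1)) * z powr ?p'" by (simp add: y_def)
    then show ?thesis using nn z by (simp add: powr_mult powr_powr mult.commute)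
  qed
  ultimately have "z \<le> (1 + c2 + c3) + (4 powr r * (6 * C) powr q * (c1 * (\<Gamma> + 1)) powr q) * z powr (q * ?p')"
    by (simp add: z_def mult_ac)
  from absorb_powr[OF z p(2) _ _ _ this]
  have "z \<le> (1 + c2 + c3 + 4 powr r * (6 * C) powr q * (c1 * (\<Gamma> + 1)) powr q) powr (1 / (1 - q * ?p'))"
    using nn q p' by simp
  then have "X \<le> (1 + c2 + c3 + 4 powr r * (6 * C) powr q * (c1 * (\<Gamma> + 1)) powr q) powr (1 / (1 - q * ?p'))"
    using nn by (simp add: z_def)
  then show ?thesis unfolding U X(1) by (rule ennreal_leI)
qed

text \<open>With m the positive part of |s| - \<tau> this is sqrt(\<tau>^2 + m^2) - \<tau>, a C^1
  version of soft thresholding of |s|. It vanishes for |s| <= \<tau>, differs from |s| by at most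
  2\<tau> and is 1-Lipschitz, so it gives a function that tends to 0 at infinity a bounded support
  without increasing its gradient.\<close>

definition soft_cut :: "real \<Rightarrow> real \<Rightarrow> real" where
  "soft_cut \<tau> s = sqrt (\<tau>\<^sup>2 + ((max 0 (s - \<tau>))\<^sup>2 + (max 0 (- s - \<tau>))\<^sup>2)) - \<tau>"

definition soft_cut_deriv :: "real \<Rightarrow> real \<Rightarrow> real" where
  "soft_cut_deriv \<tau> s = (2 * max 0 (s - \<tau>) - 2 * max 0 (- s - \<tau>)) /
     (2 * sqrt (\<tau>\<^sup>2 + ((max 0 (s - \<tau>))\<^sup>2 + (max 0 (- s - \<tau>))\<^sup>2)))"

lemma soft_cut_radicand_pos: "\<tau> > 0 \<Longrightarrow> \<tau>\<^sup>2 + ((max 0 (s - \<tau>))\<^sup>2 + (max 0 (- s - \<tau>))\<^sup>2) > (0::real)"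
  by (intro add_pos_nonneg) auto

lemma soft_cut_has_derivative:
  assumes "\<tau> > 0"
  shows "(soft_cut \<tau> has_real_derivative soft_cut_deriv \<tau> s) (at s)"
proof -
  have 1: "((\<lambda>s. s - \<tau>) has_real_derivative 1) (at s)" "((\<lambda>s. - s - \<tau>) has_real_derivative - 1) (at s)"
    by (auto intro!: derivative_eq_intros)
  note 2 = DERIV_add[OF DERIV_const[of "\<tau>\<^sup>2"] DERIV_add[OF max_square_deriv_compose[OF 1(1)] max_square_deriv_compose[OF 1(2)]]]
  note 3 = DERIV_chain2[OF DERIV_real_sqrt[OF soft_cut_radicand_pos[OF assms]] 2]
  have e: "inverse X / 2 * (0 + (2 * A * 1 + 2 * B * - 1)) - 0 = (2 * A - 2 * B) / (2 * X)" for A B X :: real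
    by (cases "X = 0") (simp_all add: field_simps)
  show ?thesis unfolding soft_cut_def[abs_def]
    by (rule DERIV_cong[OF DERIV_diff[OF 3 DERIV_const]]) (simp only: soft_cut_deriv_def e)
qed

lemma soft_cut_deriv_continuous: "\<tau> > 0 \<Longrightarrow> continuous_on A (soft_cut_deriv \<tau>)"
proof -
  assume "\<tau> > 0"
  from soft_cut_radicand_pos[OF this]
  have ne: "2 * sqrt (\<tau>\<^sup>2 + ((max 0 (s - \<tau>))\<^sup>2 + (max 0 (- s - \<tau>))\<^sup>2)) \<noteq> 0" for s
    by (metis less_irrefl mult_eq_0_iff real_sqrt_eq_zero_cancel_iff zero_neq_numeral)
  show ?thesis unfolding soft_cut_deriv_def[abs_def]
    by (intro continuous_intros ballI ne)
qed

lemma soft_cut_cases: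
  assumes "\<tau> > 0"
  obtains m where "m = max 0 (\<bar>s\<bar> - \<tau>)" "soft_cut \<tau> s = sqrt (\<tau>\<^sup>2 + m\<^sup>2) - \<tau>"
    "\<bar>soft_cut_deriv \<tau> s\<bar> = m / sqrt (\<tau>\<^sup>2 + m\<^sup>2)"
proof (cases "s \<ge> 0")
  case True
  then have "max 0 (- s - \<tau>) = 0" "max 0 (s - \<tau>) = max 0 (\<bar>s\<bar> - \<tau>)" using assms by auto
  then show ?thesis using that[of "max 0 (\<bar>s\<bar> - \<tau>)"] by (simp add: soft_cut_def soft_cut_deriv_def)
next
  case False
  then have "max 0 (s - \<tau>) = 0" "max 0 (- s - \<tau>) = max 0 (\<bar>s\<bar> - \<tau>)" using assms by auto
  then show ?thesis using that[of "max 0 (\<bar>s\<bar> - \<tau>)"] by (simp add: soft_cut_def soft_cut_deriv_def)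
qed

lemma soft_cut_bounds:
  assumes "\<tau> > 0"
  shows "0 \<le> soft_cut \<tau> s" "soft_cut \<tau> s \<le> \<bar>s\<bar>" "\<bar>s\<bar> - 2 * \<tau> \<le> soft_cut \<tau> s"
    "\<bar>soft_cut_deriv \<tau> s\<bar> \<le> 1" "\<bar>s\<bar> \<le> \<tau> \<Longrightarrow> soft_cut \<tau> s = 0"
proof -
  obtain m where m: "m = max 0 (\<bar>s\<bar> - \<tau>)" "soft_cut \<tau> s = sqrt (\<tau>\<^sup>2 + m\<^sup>2) - \<tau>"
    "\<bar>soft_cut_deriv \<tau> s\<bar> = m / sqrt (\<tau>\<^sup>2 + m\<^sup>2)"
    using soft_cut_cases[OF assms] by blast
  have m0: "0 \<le> m" by (simp add: m(1))
  have le: "sqrt (\<tau>\<^sup>2 + m\<^sup>2) \<le> \<tau> + m" using sqrt_sum_squares_le_sum[of \<tau> m] assms m0 by simp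
  have ge: "\<tau> \<le> sqrt (\<tau>\<^sup>2 + m\<^sup>2)" "m \<le> sqrt (\<tau>\<^sup>2 + m\<^sup>2)"
    using assms m0 by (auto intro!: real_le_rsqrt)
  show "0 \<le> soft_cut \<tau> s" using ge m(2) by linarith
  have "m \<le> \<bar>s\<bar>" using assms m(1) by auto
  then show "soft_cut \<tau> s \<le> \<bar>s\<bar>" using le m(2) by linarith
  have "\<bar>s\<bar> - \<tau> \<le> m" using m(1) by simp
  then show "\<bar>s\<bar> - 2 * \<tau> \<le> soft_cut \<tau> s" using ge m(2) by linarith
  have "sqrt (\<tau>\<^sup>2 + m\<^sup>2) > 0" using ge assms by linarith
  then show "\<bar>soft_cut_deriv \<tau> s\<bar> \<le> 1" using ge(2) by (simp only: m(3) divide_le_eq_1_pos)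
  show "soft_cut \<tau> s = 0" if "\<bar>s\<bar> \<le> \<tau>"
  proof -
    have "m = 0" using that m(1) by simp
    then show ?thesis using m(2) assms by simp
  qed
qed

section \<open>Integrability of powers of the norm\<close>

lemma dyadic_radius_exists:
  fixes t :: real
  assumes "1 \<le> t"
  obtains k :: nat where "2 ^ k \<le> t" "t < 2 * 2 ^ k"
proof -
  obtain K where "t / 2 < 2 ^ K" using real_arch_pow[of 2 "t / 2"] by auto
  moreover have "2 * (1 / 2) \<le> t" using assms by simp
  ultimately have "t / 1 < 2 * 1 * 2 ^ K" by simp
  obtain k where "k < Suc K" "2 * (1 / 2 * 2 ^ k) \<le> t" "t < 4 * (1 / 2 * 2 ^ k)"
    using dyadic_level_exists[of "1/2" t "Suc K"] assms \<open>t / 1 < 2 * 1 * 2 ^ K\<close> by auto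
  then show ?thesis using that[of k] by simp
qed

lemma nn_integral_suminf_cballs:
  "(\<integral>\<^sup>+x. (\<Sum>k. ennreal (c k) * indicator (cball (0::'a::euclidean_space) (R k)) x) \<partial>lborel)
      = (\<Sum>k. ennreal (c k) * emeasure lborel (cball (0::'a) (R k)))"
proof -
  have "(\<lambda>x. ennreal (c k) * indicator (cball (0::'a) (R k)) x) \<in> borel_measurable lborel" for k
    by (intro borel_measurable_times_ennreal borel_measurable_const borel_measurable_indicator) simp
  then have "(\<integral>\<^sup>+x. (\<Sum>k. ennreal (c k) * indicator (cball (0::'a) (R k)) x) \<partial>lborel)
      = (\<Sum>k. \<integral>\<^sup>+x. ennreal (c k) * indicator (cball (0::'a) (R k)) x \<partial>lborel)"
    by (rule nn_integral_suminf)
  also have "\<dots> = (\<Sum>k. ennreal (c k) * emeasure lborel (cball (0::'a) (R k)))"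
    by (intro suminf_cong nn_integral_cmult_indicator) simp
  finally show ?thesis .
qed

lemma ennreal_le_suminf: "F k \<le> (\<Sum>k. F k :: ennreal)"
  using sum_le_suminf[of F "{k}"] by simp

text \<open>A dyadic covering instead of polar coordinates: the ball of radius 2 * 2^(sk)
  contributes a constant times the k-th power of 2^(s(\<sigma>+N)) < 1. It is used with s = 1 for
  the exterior and with s = -1 for the interior of the unit ball.\<close>

lemma radial_powr_integral_finite:
  fixes \<sigma> s :: real and D :: "'a::euclidean_space set"
  assumes D: "\<And>x. x \<in> D \<Longrightarrow> \<exists>k::nat. 2 powr (s * real k) \<le> 2 * norm x \<and> norm x \<le> 2 * 2 powr (s * real k)"
    and s: "s * (\<sigma> + real DIM('a)) < 0"
  shows "(\<integral>\<^sup>+x. indicator D x * ennreal (norm x powr \<sigma>) \<partial>lborel) < \<infinity>"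
proof -
  let ?N = "DIM('a)"
  let ?V = "unit_ball_vol (real ?N)"
  define t where "t = 2 powr (s * (\<sigma> + real ?N))"
  have t: "0 < t" "t < 1" using powr_less_mono[OF s, of 2] by (simp_all add: t_def)
  define R where "R k = 2 powr (s * real k)" for k
  have R: "R k > 0" for k by (simp add: R_def)
  have "(\<integral>\<^sup>+x. indicator D x * ennreal (norm x powr \<sigma>) \<partial>lborel)
    \<le> (\<integral>\<^sup>+x. (\<Sum>k. ennreal (2 powr \<bar>\<sigma>\<bar> * R k powr \<sigma>) * indicator (cball (0::'a) (2 * R k)) x) \<partial>lborel)"
  proof (rule nn_integral_mono)
    fix x :: 'a
    show "indicator D x * ennreal (norm x powr \<sigma>) \<le> (\<Sum>k. ennreal (2 powr \<bar>\<sigma>\<bar> * R k powr \<sigma>) * indicator (cball (0::'a) (2 * R k)) x)"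
    proof (cases "x \<in> D")
      case True
      then obtain k where k: "R k \<le> 2 * norm x" "norm x \<le> 2 * R k" using D by (auto simp: R_def)
      have "norm x > 0" using k R[of k] by linarith
      then have "norm x powr \<sigma> \<le> 2 powr \<bar>\<sigma>\<bar> * R k powr \<sigma>"
        using k R[of k] by (intro powr_abs_le_of_ratio) auto
      then have "indicator D x * ennreal (norm x powr \<sigma>) \<le> ennreal (2 powr \<bar>\<sigma>\<bar> * R k powr \<sigma>) * indicator (cball (0::'a) (2 * R k)) x"
        using True k by (simp add: ennreal_leI)
      also have "\<dots> \<le> (\<Sum>k. ennreal (2 powr \<bar>\<sigma>\<bar> * R k powr \<sigma>) * indicator (cball (0::'a) (2 * R k)) x)"
        by (rule ennreal_le_suminf)
      finally show ?thesis .
    next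
      case False
      then have "indicator D x * ennreal (norm x powr \<sigma>) = 0" by simp
      then show ?thesis using zero_le by (rule ord_eq_le_trans)
    qed
  qed
  also have "\<dots> = (\<Sum>k. ennreal (2 powr \<bar>\<sigma>\<bar> * R k powr \<sigma>) * emeasure lborel (cball (0::'a) (2 * R k)))"
    by (rule nn_integral_suminf_cballs)
  also have "\<dots> = (\<Sum>k. ennreal (2 powr \<bar>\<sigma>\<bar> * ?V * 2 ^ ?N * t ^ k))"
  proof (rule suminf_cong)
    fix k
    have "R k powr \<sigma> * R k ^ ?N = t ^ k"
    proof -
      have "R k powr \<sigma> * R k ^ ?N = R k powr (\<sigma> + real ?N)" using R[of k] by (simp add: powr_add powr_realpow)
      also have "\<dots> = t powr real k" by (simp add: R_def t_def powr_powr mult_ac)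
      finally show ?thesis using t by (simp add: powr_realpow)
    qed
    moreover have "2 powr \<bar>\<sigma>\<bar> * R k powr \<sigma> * (?V * (2 * R k) ^ ?N) = 2 powr \<bar>\<sigma>\<bar> * ?V * 2 ^ ?N * (R k powr \<sigma> * R k ^ ?N)"
      by (simp add: power_mult_distrib)
    ultimately have 1: "2 powr \<bar>\<sigma>\<bar> * R k powr \<sigma> * (?V * (2 * R k) ^ ?N) = 2 powr \<bar>\<sigma>\<bar> * ?V * 2 ^ ?N * t ^ k"
      by (simp only:)
    have 2: "emeasure lborel (cball (0::'a) (2 * R k)) = ennreal (?V * (2 * R k) ^ ?N)"
      using R[of k] by (intro emeasure_cball) auto
    show "ennreal (2 powr \<bar>\<sigma>\<bar> * R k powr \<sigma>) * emeasure lborel (cball (0::'a) (2 * R k)) = ennreal (2 powr \<bar>\<sigma>\<bar> * ?V * 2 ^ ?N * t ^ k)"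
      unfolding 1[symmetric] 2 by (rule ennreal_mult'[symmetric]) simp
  qed
  also have "\<dots> < \<infinity>"
  proof -
    have sm: "summable (\<lambda>k. 2 powr \<bar>\<sigma>\<bar> * ?V * 2 ^ ?N * t ^ k)" using t by (intro summable_mult summable_geometric) auto
    have nn: "0 \<le> 2 powr \<bar>\<sigma>\<bar> * ?V * 2 ^ ?N * t ^ k" for k using t by simp
    show ?thesis by (subst suminf_ennreal2[OF nn sm]) simp
  qed
  finally show ?thesis .
qed

lemma radial_powr_integral_outer:
  assumes "\<sigma> < - real DIM('a)"
  shows "(\<integral>\<^sup>+x. indicator {x::'a::euclidean_space. 1 \<le> norm x} x * ennreal (norm x powr \<sigma>) \<partial>lborel) < \<infinity>"
proof (rule radial_powr_integral_finite[where s=1])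
  fix x :: 'a assume "x \<in> {x. 1 \<le> norm x}"
  then obtain k :: nat where "2 ^ k \<le> norm x" "norm x < 2 * 2 ^ k" using dyadic_radius_exists[of "norm x"] by auto
  then show "\<exists>k::nat. 2 powr (1 * real k) \<le> 2 * norm x \<and> norm x \<le> 2 * 2 powr (1 * real k)"
    by (intro exI[of _ k]) (auto simp: powr_realpow)
qed (use assms in simp)

lemma radial_powr_integral_inner:
  assumes "\<sigma> > - real DIM('a)"
  shows "(\<integral>\<^sup>+x. indicator {x::'a::euclidean_space. 0 < norm x \<and> norm x \<le> 1} x * ennreal (norm x powr \<sigma>) \<partial>lborel) < \<infinity>"
proof (rule radial_powr_integral_finite[where s="-1"])
  fix x :: 'a assume "x \<in> {x. 0 < norm x \<and> norm x \<le> 1}"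
  then have x: "0 < norm x" "norm x \<le> 1" by simp_all
  have "1 \<le> 1 / norm x" using x by (simp only: le_divide_eq_1_pos)
  from dyadic_radius_exists[OF this] obtain k :: nat
    where k: "2 ^ k \<le> 1 / norm x" "1 / norm x < 2 * 2 ^ k" by blast
  have e: "2 powr (- 1 * real k) = 1 / 2 ^ k" by (simp add: powr_minus_divide powr_realpow)
  show "\<exists>k::nat. 2 powr (- 1 * real k) \<le> 2 * norm x \<and> norm x \<le> 2 * 2 powr (- 1 * real k)"
  proof (intro exI[of _ k] conjI)
    have "norm x * 2 ^ k \<le> 1" "1 < norm x * (2 * 2 ^ k)" using k x by (auto simp: field_simps)
    then show "2 powr (- 1 * real k) \<le> 2 * norm x" "norm x \<le> 2 * 2 powr (- 1 * real k)"
      unfolding e by (simp_all add: field_simps)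
  qed
qed (use assms in simp)

section \<open>Uniform bounds for normalized functions, by mollification and Fatou's lemma\<close>

lemma nn_integral_le_of_tendsto:
  fixes f :: "nat \<Rightarrow> 'a \<Rightarrow> ennreal"
  assumes f: "\<And>n. f n \<in> borel_measurable M" "\<And>n. (\<integral>\<^sup>+x. f n x \<partial>M) \<le> K"
    and lim: "AE x in M. (\<lambda>n. f n x) \<longlonglongrightarrow> g x"
  shows "(\<integral>\<^sup>+x. g x \<partial>M) \<le> K"
proof -
  have "(\<integral>\<^sup>+x. g x \<partial>M) = (\<integral>\<^sup>+x. liminf (\<lambda>n. f n x) \<partial>M)"
    using lim by (intro nn_integral_cong_AE) (auto elim!: eventually_mono dest!: lim_imp_Liminf[rotated])
  also have "\<dots> \<le> liminf (\<lambda>n. \<integral>\<^sup>+x. f n x \<partial>M)" by (rule nn_integral_liminf) (rule f)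
  also have "\<dots> \<le> liminf (\<lambda>n::nat. K)" by (intro Liminf_mono always_eventually allI f(2))
  also have "\<dots> = K" by (simp add: Liminf_const)
  finally show ?thesis .
qed

definition normalized_pair :: "real \<Rightarrow> real \<Rightarrow> real \<Rightarrow> ('a::euclidean_space \<Rightarrow> real) \<Rightarrow> ('a \<Rightarrow> 'a) \<Rightarrow> bool" where
  "normalized_pair a b p u G \<longleftrightarrow> borel_weak_gradient u G \<and> (AE x in lborel. \<bar>u x\<bar> \<le> norm x powr (- a)) \<and>
     (\<integral>\<^sup>+x. ennreal (norm x powr b * norm (G x) powr p) \<partial>lborel) \<le> 1"

definition mollified_energy :: "'a::euclidean_space itself \<Rightarrow> real \<Rightarrow> real \<Rightarrow> real" where
  "mollified_energy T b p = (2 * real DIM('a)) powr p * 2 powr \<bar>b\<bar>"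

lemma C1_pair_subset: "C1_pair S u G \<Longrightarrow> open T \<Longrightarrow> T \<subseteq> S \<Longrightarrow> C1_pair T u G"
  by (auto simp: C1_pair_def intro: continuous_on_subset)

lemma normalized_pair_mollify:
  fixes u :: "'a::euclidean_space \<Rightarrow> real"
  assumes n: "normalized_pair a b p u G" and a: "0 \<le> a" and p: "1 \<le> p" and h: "h > 0" "2 * real DIM('a) * h \<le> \<rho>"
  shows "C1_pair {x. norm x > \<rho>} (mollify h u) (mollify_vec h G)"
    and "\<And>x. norm x > \<rho> \<Longrightarrow> \<bar>mollify h u x\<bar> \<le> 2 powr a * norm x powr (- a)"
    and "(\<integral>\<^sup>+x. indicator {x. norm x > \<rho>} x * ennreal (norm x powr b * norm (mollify_vec h G x) powr p) \<partial>lborel)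
        \<le> ennreal (mollified_energy TYPE('a) b p)"
proof -
  have w: "borel_weak_gradient u G" and u: "AE x in lborel. \<bar>u x\<bar> \<le> 1 * norm x powr (- a)"
    and e: "(\<integral>\<^sup>+x. ennreal (norm x powr b * norm (G x) powr p) \<partial>lborel) \<le> 1"
    using n by (auto simp: normalized_pair_def)
  have G: "G \<in> borel_measurable borel" using w by (simp add: borel_weak_gradient_def)
  show "C1_pair {x. norm x > \<rho>} (mollify h u) (mollify_vec h G)"
    by (rule C1_pair_subset[OF C1_pair_mollify[OF w h(1)]])
       (use h in \<open>auto intro!: open_Collect_less continuous_intros\<close>)
  show "\<bar>mollify h u x\<bar> \<le> 2 powr a * norm x powr (- a)" if "norm x > \<rho>" for x
    using mollify_abs_bound[OF u a h(1), of x] h that by simp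
  have "(\<integral>\<^sup>+x. indicator {x. norm x > \<rho>} x * ennreal (norm x powr b * norm (mollify_vec h G x) powr p) \<partial>lborel)
    \<le> (\<integral>\<^sup>+x. indicator {x. norm x > 2 * real DIM('a) * h} x * ennreal (norm x powr b * norm (mollify_vec h G x) powr p) \<partial>lborel)"
    using h by (intro nn_integral_mono mult_right_mono) (auto simp: indicator_def)
  also have "\<dots> \<le> ennreal (mollified_energy TYPE('a) b p) * (\<integral>\<^sup>+y. ennreal (norm y powr b * norm (G y) powr p) \<partial>lborel)"
    unfolding mollified_energy_def by (rule mollify_vec_weighted_bound[OF G h(1) p])
  also have "\<dots> \<le> ennreal (mollified_energy TYPE('a) b p) * 1" by (intro mult_left_mono e) simp
  finally show "(\<integral>\<^sup>+x. indicator {x. norm x > \<rho>} x * ennreal (norm x powr b * norm (mollify_vec h G x) powr p) \<partial>lborel)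
        \<le> ennreal (mollified_energy TYPE('a) b p)" by simp
qed

text \<open>The normalization makes the excluded ball of radius 2N h_n have radius 1/(2(n+1)), which
  stays strictly inside the unit ball.\<close>

definition mesh :: "'a::euclidean_space itself \<Rightarrow> nat \<Rightarrow> real" where
  "mesh T n = 1 / (4 * real DIM('a) * real (Suc n))"

lemma mesh:
  shows "mesh TYPE('a::euclidean_space) n > 0" "2 * real DIM('a) * mesh TYPE('a) n = 1 / 2 * (1 / real (Suc n))"
    "mesh TYPE('a) \<longlonglongrightarrow> 0"
proof -
  show "mesh TYPE('a) n > 0" by (simp add: mesh_def)
  show "2 * real DIM('a) * mesh TYPE('a) n = 1 / 2 * (1 / real (Suc n))"
  proof -
    have "2 * d * (1 / (4 * d * s)) = 1 / 2 * (1 / s)" if "d \<noteq> 0" "s \<noteq> 0" for d s :: real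
      using that by (simp add: field_simps)
    note this[of "real DIM('a)" "real (Suc n)"]
    then show ?thesis unfolding mesh_def by (simp del: of_nat_Suc)
  qed
  have "(\<lambda>n. 1 / (4 * real DIM('a)) * (1 / real (Suc n))) \<longlonglongrightarrow> 1 / (4 * real DIM('a)) * 0"
    by (intro tendsto_intros inverse_Suc_tendsto)
  then show "mesh TYPE('a) \<longlonglongrightarrow> 0" by (simp add: mesh_def[abs_def])
qed

lemma eventually_mesh_less:
  "d > 0 \<Longrightarrow> eventually (\<lambda>n. 2 * real DIM('a) * mesh TYPE('a::euclidean_space) n < d) sequentially"
proof -
  assume "d > 0"
  have "(\<lambda>n. 2 * real DIM('a) * mesh TYPE('a) n) \<longlonglongrightarrow> 2 * real DIM('a) * 0"
    by (intro tendsto_intros mesh(3))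
  from order_tendstoD(2)[OF this, of d] \<open>d > 0\<close> show ?thesis by simp
qed

lemma normalized_pair_mollify_tendsto:
  assumes "normalized_pair a b p u G"
  shows "AE x in lborel. (\<lambda>n. mollify (mesh TYPE('a::euclidean_space) n) u (x::'a)) \<longlonglongrightarrow> u x"
  using assms mesh(1,3)[where 'a='a]
  by (intro mollify_tendsto_AE_punctured) (auto simp: normalized_pair_def borel_weak_gradient_def)

lemma emeasure_le_of_subset_cball:
  "A \<subseteq> cball (0::'a::euclidean_space) R \<Longrightarrow> 0 \<le> c \<Longrightarrow> (\<And>x. x \<in> A \<Longrightarrow> f x \<le> c) \<Longrightarrow>
    (\<integral>\<^sup>+x. indicator A x * ennreal (f x) \<partial>lborel) \<le> ennreal (c * measure lborel (cball (0::'a) R))"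
proof -
  assume A: "A \<subseteq> cball 0 R" "0 \<le> c" "\<And>x. x \<in> A \<Longrightarrow> f x \<le> c"
  have "(\<integral>\<^sup>+x. indicator A x * ennreal (f x) \<partial>lborel) \<le> (\<integral>\<^sup>+x. ennreal c * indicator (cball (0::'a) R) x \<partial>lborel)"
    using A by (intro nn_integral_mono) (auto simp: indicator_def intro!: ennreal_leI)
  also have "\<dots> = ennreal c * emeasure lborel (cball (0::'a) R)" by (rule nn_integral_cmult_indicator) simp
  also have "emeasure lborel (cball (0::'a) R) = ennreal (measure lborel (cball (0::'a) R))"
    using emeasure_bounded_finite[OF bounded_cball[of "0::'a" R]]
    by (simp add: emeasure_eq_ennreal_measure top.not_eq_extremum)
  finally show ?thesis using A by (simp add: ennreal_mult)
qed

lemma powr_indicator_measurable: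
  fixes w :: "'a::euclidean_space \<Rightarrow> real"
  assumes "open S" "continuous_on S w"
  shows "(\<lambda>x. indicator S x * ennreal (\<bar>w x\<bar> powr r)) \<in> borel_measurable lborel"
proof -
  have [measurable]: "(\<lambda>x. indicator S x *\<^sub>R w x) \<in> borel_measurable borel" "S \<in> sets borel"
    using borel_measurable_of_continuous_on[OF assms] assms(1) by auto
  have "(\<lambda>x. indicator S x * ennreal (\<bar>indicator S x *\<^sub>R w x\<bar> powr r)) \<in> borel_measurable lborel" by measurable
  also have "(\<lambda>x. indicator S x * ennreal (\<bar>indicator S x *\<^sub>R w x\<bar> powr r)) = (\<lambda>x. indicator S x * ennreal (\<bar>w x\<bar> powr r))"
    by (auto simp: fun_eq_iff indicator_def)
  finally show ?thesis .
qed

lemma outer_estimate: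
  fixes \<zeta> :: "'a::euclidean_space \<Rightarrow> real"
  assumes W: "weak_sobolev_const TYPE('a) q C" and q: "1 \<le> q" "q \<le> r" and p: "1 \<le> p" "q * (1 - 1 / p) < 1"
    and a: "a > 0" and nn: "0 \<le> c1" "0 \<le> c2" "0 \<le> \<rho>0"
    and \<zeta>: "\<zeta> \<in> borel_measurable borel" "\<And>x. 0 \<le> \<zeta> x"
      "(\<integral>\<^sup>+x. indicator {x. norm x > \<rho>0} x * ennreal (\<zeta> x) \<partial>lborel) \<le> ennreal c2"
    and pt: "\<And>x t. norm x > \<rho>0 \<Longrightarrow> 0 < t \<Longrightarrow> t \<le> 2 powr a * norm x powr (- a) \<Longrightarrow>
      norm x powr (1 - real DIM('a) * (1 - 1 / q)) * t powr (r / q - 1)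
        \<le> c1 * norm x powr (b / p) * (t powr r + \<zeta> x) powr (1 - 1 / p)"
  shows "\<exists>K. \<forall>(u::'a \<Rightarrow> real) G. normalized_pair a b p u G \<longrightarrow>
     (\<integral>\<^sup>+x. indicator {x. norm x > \<rho>0} x * ennreal (\<bar>u x\<bar> powr r) \<partial>lborel) \<le> ennreal K"
proof -
  let ?\<Gamma> = "mollified_energy TYPE('a) b p"
  have \<Gamma>: "0 \<le> ?\<Gamma>" by (simp add: mollified_energy_def)
  define K0 where "K0 = (1 + c2 + 1 + 4 powr r * (6 * C) powr q * (c1 * (?\<Gamma> + 1)) powr q) powr (1 / (1 - q * (1 - 1 / p)))"
  have r: "r > 0" using q by simp
  show ?thesis
  proof (intro exI[of _ "K0 + 1"] allI impI)
    fix u :: "'a \<Rightarrow> real" and G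
    assume n: "normalized_pair a b p u G"
    define h where "h n = mesh TYPE('a) n" for n
    have h: "h n > 0" for n by (simp add: h_def mesh)
    define \<rho> where "\<rho> n = max \<rho>0 (2 * real DIM('a) * h n)" for n
    have \<rho>: "2 * real DIM('a) * h n \<le> \<rho> n" "\<rho>0 \<le> \<rho> n" "0 < \<rho> n" for n
      using h[of n] by (auto simp: \<rho>_def less_max_iff_disj)
    define w where "w n x = soft_cut (h n) (mollify (h n) u x)" for n x
    have SO: "open {x::'a. norm x > c}" for c by (intro open_Collect_less continuous_intros)
    note M = normalized_pair_mollify[OF n less_imp_le[OF a] p(1) h \<rho>(1)]
    have wC1: "C1_pair {x. norm x > \<rho> n} (w n) (\<lambda>x. soft_cut_deriv (h n) (mollify (h n) u x) *\<^sub>R mollify_vec (h n) G x)" for n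
      unfolding w_def by (rule C1_pair_compose[OF M(1) soft_cut_has_derivative[OF h] soft_cut_deriv_continuous[OF h]])
    have wabs: "\<bar>w n x\<bar> \<le> \<bar>mollify (h n) u x\<bar>" for n x
      using soft_cut_bounds(1,2)[OF h[of n], of "mollify (h n) u x"] by (simp add: w_def)
    have bound: "(\<integral>\<^sup>+x. indicator {x. norm x > \<rho> n} x * ennreal (\<bar>w n x\<bar> powr r) \<partial>lborel) \<le> ennreal (K0 + 1)" for n
    proof -
      \<comment> \<open>Beyond the second radius the bound 2^a |x|^(-a) is below h_n, where the
        cutoff vanishes.\<close>
      define R where "R = max (\<rho> n + 1) ((2 powr a / h n) powr (1 / a))"
      have w0: "w n y = 0" if y: "R \<le> norm y" for y
      proof -
        have y1: "norm y > \<rho> n" "(2 powr a / h n) powr (1 / a) \<le> norm y" using y by (auto simp: R_def)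
        have "((2 powr a / h n) powr (1 / a)) powr a \<le> norm y powr a" using y1 a by (intro powr_mono2) auto
        then have "2 powr a / h n \<le> norm y powr a" using a h[of n] by (simp add: powr_powr)
        then have "2 powr a * norm y powr (- a) \<le> h n"
        proof -
          have "norm y > 0" using y1 \<rho>(3)[of n] by linarith
          then have "norm y powr a > 0" by simp
          then show ?thesis using \<open>2 powr a / h n \<le> norm y powr a\<close> h[of n]
            by (simp add: powr_minus_divide divide_le_eq mult.commute)
        qed
        then have "\<bar>mollify (h n) u y\<bar> \<le> h n" using M(2)[OF y1(1)] by linarith
        then show ?thesis unfolding w_def by (rule soft_cut_bounds(5)[OF h])
      qed
      let ?vol = "measure lborel (cball (0::'a) R)"
      \<comment> \<open>Chosen so that (2L)^r times the volume of the support ball is at most 1.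
        This bounds both the strip between L and 2L and the part below L; the added 1 keeps the
        quotient defined.\<close>
      define L where "L = (1 / (?vol + 1)) powr (1 / r) / 2"
      have vol: "?vol \<ge> 0" by simp
      have L: "L > 0"
      proof -
        have "0 < ?vol + 1" using vol by linarith
        then show ?thesis unfolding L_def by (intro divide_pos_pos) auto
      qed
      have Lr: "(2 * L) powr r = 1 / (?vol + 1)"
      proof -
        have c: "(2 * (c powr (1 / r) / 2)) powr r = c" if "0 < c" for c :: real
          using r that by (simp add: powr_powr)
        have "0 < ?vol + 1" using vol by linarith
        then have "0 < 1 / (?vol + 1)" by (rule divide_pos_pos[OF zero_less_one])
        from c[OF this] show ?thesis by (simp only: L_def)
      qed
      have L2: "(2 * L) powr r * ?vol \<le> 1" 
      proof -
        have "1 / (v + 1) * v \<le> 1" if "0 \<le> v" for v :: real using that by (simp add: divide_simps)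
        from this[OF vol] show ?thesis by (simp only: Lr)
      qed
      have "L powr r \<le> (2 * L) powr r" using L r by (intro powr_mono2) auto
      then have "L powr r * ?vol \<le> (2 * L) powr r * ?vol" by (intro mult_right_mono vol)
      then have L1: "L powr r * ?vol \<le> 1" using L2 by linarith
      have sub: "norm x \<le> R" if "w n x \<noteq> 0" for x using w0[of x] that by force
      have R': "\<bar>w n y\<bar> \<le> L" if "R \<le> norm y" for y using w0[OF that] L by simp
      have B: "\<bar>w n x\<bar> \<le> 2 powr a * (\<rho> n) powr (- a)" if x: "norm x > \<rho> n" for x
      proof -
        have "norm x powr (- a) \<le> (\<rho> n) powr (- a)" using x a \<rho>(3)[of n] by (intro powr_mono2') auto
        then have "2 powr a * norm x powr (- a) \<le> 2 powr a * (\<rho> n) powr (- a)" by (intro mult_left_mono) auto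
        then show ?thesis using wabs[of n x] M(2)[OF x] by linarith
      qed
      have AP: "(\<integral>\<^sup>+x. indicator {x. norm x > \<rho> n \<and> \<bar>w n x\<bar> > L} x * ennreal (\<bar>w n x\<bar> powr r) \<partial>lborel) \<le> ennreal K0"
        unfolding K0_def
      proof (rule a_priori_bound[OF W q p nn(1,2) _ \<Gamma> \<rho>(3) wC1 L R' B \<zeta>(1,2), where b=b])
        show "0 \<le> (1::real)" by simp
        show "norm x powr (1 - real DIM('a) * (1 - 1 / q)) * \<bar>w n x\<bar> powr (r / q - 1)
          \<le> c1 * norm x powr (b / p) * (\<bar>w n x\<bar> powr r + \<zeta> x) powr (1 - 1 / p)"
          if "norm x > \<rho> n" "\<bar>w n x\<bar> > L" for x
          using that \<rho>(2)[of n] L wabs[of n x] M(2)[OF that(1)] by (intro pt) linarith+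
        show "(\<integral>\<^sup>+x. indicator {x. norm x > \<rho> n \<and> \<bar>w n x\<bar> > L} x * ennreal (\<zeta> x) \<partial>lborel) \<le> ennreal c2"
        proof (rule order_trans[OF nn_integral_mono \<zeta>(3)])
          fix x show "indicator {x. norm x > \<rho> n \<and> \<bar>w n x\<bar> > L} x * ennreal (\<zeta> x) \<le> indicator {x. norm x > \<rho>0} x * ennreal (\<zeta> x)"
            using \<rho>(2)[of n] by (auto simp: indicator_def)
        qed
        show "(\<integral>\<^sup>+x. indicator {x. norm x > \<rho> n \<and> \<bar>w n x\<bar> > L} x * ennreal (norm x powr b * norm (soft_cut_deriv (h n) (mollify (h n) u x) *\<^sub>R mollify_vec (h n) G x) powr p) \<partial>lborel) \<le> ennreal ?\<Gamma>"
        proof (rule order_trans[OF nn_integral_mono M(3)])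
          fix x :: 'a
          have "norm (soft_cut_deriv (h n) (mollify (h n) u x) *\<^sub>R mollify_vec (h n) G x) \<le> 1 * norm (mollify_vec (h n) G x)"
            using soft_cut_bounds(4)[OF h[of n]] by (simp only: norm_scaleR) (intro mult_right_mono, auto)
          then have "norm (soft_cut_deriv (h n) (mollify (h n) u x) *\<^sub>R mollify_vec (h n) G x) powr p \<le> norm (mollify_vec (h n) G x) powr p"
            using p by (intro powr_mono2) auto
          then have "ennreal (norm x powr b * norm (soft_cut_deriv (h n) (mollify (h n) u x) *\<^sub>R mollify_vec (h n) G x) powr p) \<le> ennreal (norm x powr b * norm (mollify_vec (h n) G x) powr p)"
            by (intro ennreal_leI mult_left_mono) auto
          then show "indicator {x. norm x > \<rho> n \<and> \<bar>w n x\<bar> > L} x * ennreal (norm x powr b * norm (soft_cut_deriv (h n) (mollify (h n) u x) *\<^sub>R mollify_vec (h n) G x) powr p)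
            \<le> indicator {x. norm x > \<rho> n} x * ennreal (norm x powr b * norm (mollify_vec (h n) G x) powr p)"
            by (cases "norm x > \<rho> n \<and> \<bar>w n x\<bar> > L") auto
        qed
        have "(\<integral>\<^sup>+x. indicator {x. norm x > \<rho> n \<and> L < \<bar>w n x\<bar> \<and> \<bar>w n x\<bar> < 2 * L} x * ennreal (\<bar>w n x\<bar> powr r) \<partial>lborel) \<le> ennreal ((2 * L) powr r * ?vol)"
        proof (rule emeasure_le_of_subset_cball)
          show "{x. norm x > \<rho> n \<and> L < \<bar>w n x\<bar> \<and> \<bar>w n x\<bar> < 2 * L} \<subseteq> cball 0 R"
            using sub L by (auto simp: abs_if split: if_splits)
          show "\<bar>w n x\<bar> powr r \<le> (2 * L) powr r" if "x \<in> {x. norm x > \<rho> n \<and> L < \<bar>w n x\<bar> \<and> \<bar>w n x\<bar> < 2 * L}" for x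
            using that r by (intro powr_mono2) auto
        qed simp
        also have "\<dots> \<le> ennreal 1" by (rule ennreal_leI[OF L2])
        finally show "(\<integral>\<^sup>+x. indicator {x. norm x > \<rho> n \<and> L < \<bar>w n x\<bar> \<and> \<bar>w n x\<bar> < 2 * L} x * ennreal (\<bar>w n x\<bar> powr r) \<partial>lborel) \<le> ennreal 1" .
      qed
      have wc: "continuous_on {x. norm x > \<rho> n} (w n)" by (rule C1_pair_continuous[OF wC1])
      have S1: "open {x. norm x > \<rho> n \<and> \<bar>w n x\<bar> > L}"
      proof -
        have "open ({x. norm x > \<rho> n} \<inter> (\<lambda>x. \<bar>w n x\<bar>) -` {L<..})"
          by (rule continuous_open_preimage[OF _ SO]) (auto intro!: continuous_intros wc)
        then show ?thesis by (simp add: Int_def)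
      qed
      have m1: "(\<lambda>x. indicator {x. norm x > \<rho> n \<and> \<bar>w n x\<bar> > L} x * ennreal (\<bar>w n x\<bar> powr r)) \<in> borel_measurable lborel"
        by (rule powr_indicator_measurable[OF S1]) (rule continuous_on_subset[OF wc], auto)
      have "(\<integral>\<^sup>+x. indicator {x. norm x > \<rho> n} x * ennreal (\<bar>w n x\<bar> powr r) \<partial>lborel)
        \<le> (\<integral>\<^sup>+x. indicator {x. norm x > \<rho> n \<and> \<bar>w n x\<bar> > L} x * ennreal (\<bar>w n x\<bar> powr r) + ennreal (L powr r) * indicator (cball (0::'a) R) x \<partial>lborel)"
      proof (rule nn_integral_mono)
        fix x :: 'a
        show "indicator {x. norm x > \<rho> n} x * ennreal (\<bar>w n x\<bar> powr r) \<le> indicator {x. norm x > \<rho> n \<and> \<bar>w n x\<bar> > L} x * ennreal (\<bar>w n x\<bar> powr r) + ennreal (L powr r) * indicator (cball (0::'a) R) x"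
        proof (cases "norm x > \<rho> n \<and> \<bar>w n x\<bar> \<le> L \<and> w n x \<noteq> 0")
          case True
          then have "\<bar>w n x\<bar> powr r \<le> L powr r" using r by (intro powr_mono2) auto
          then show ?thesis using True sub[of x] by (simp add: ennreal_leI)
        next
          case False
          then show ?thesis by (cases "norm x > \<rho> n") auto
        qed
      qed
      also have "\<dots> = (\<integral>\<^sup>+x. indicator {x. norm x > \<rho> n \<and> \<bar>w n x\<bar> > L} x * ennreal (\<bar>w n x\<bar> powr r) \<partial>lborel) + (\<integral>\<^sup>+x. ennreal (L powr r) * indicator (cball (0::'a) R) x \<partial>lborel)"
        by (rule nn_integral_add[OF m1]) (intro borel_measurable_times_ennreal borel_measurable_const borel_measurable_indicator, simp)
      also have "\<dots> \<le> ennreal K0 + ennreal 1"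
      proof (rule add_mono[OF AP])
        have "(\<integral>\<^sup>+x. indicator (cball (0::'a) R) x * ennreal (L powr r) \<partial>lborel) \<le> ennreal (L powr r * ?vol)"
          by (rule emeasure_le_of_subset_cball) auto
        also have "\<dots> \<le> ennreal 1" by (rule ennreal_leI[OF L1])
        finally show "(\<integral>\<^sup>+x. ennreal (L powr r) * indicator (cball (0::'a) R) x \<partial>lborel) \<le> ennreal 1"
          by (simp only: mult.commute)
      qed
      also have "\<dots> = ennreal (K0 + 1)" by (subst ennreal_plus) (auto simp: K0_def)
      finally show ?thesis .
    qed
    show "(\<integral>\<^sup>+x. indicator {x. norm x > \<rho>0} x * ennreal (\<bar>u x\<bar> powr r) \<partial>lborel) \<le> ennreal (K0 + 1)"
    proof (rule nn_integral_le_of_tendsto[OF _ bound])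
      show "(\<lambda>x. indicator {x. norm x > \<rho> n} x * ennreal (\<bar>w n x\<bar> powr r)) \<in> borel_measurable lborel" for n
        by (rule powr_indicator_measurable[OF SO C1_pair_continuous[OF wC1]])
      show "AE x in lborel. (\<lambda>n. indicator {x. norm x > \<rho> n} x * ennreal (\<bar>w n x\<bar> powr r)) \<longlonglongrightarrow> indicator {x. norm x > \<rho>0} x * ennreal (\<bar>u x\<bar> powr r)"
        using normalized_pair_mollify_tendsto[OF n]
      proof eventually_elim
        case (elim x)
        show ?case
        proof (cases "norm x > \<rho>0")
          case True
          have hl: "h \<longlonglongrightarrow> 0" unfolding h_def[abs_def] by (rule mesh(3))
          have ml: "(\<lambda>n. \<bar>mollify (h n) u x\<bar>) \<longlonglongrightarrow> \<bar>u x\<bar>"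
            using elim unfolding h_def by (rule tendsto_rabs)
          have "(\<lambda>n. \<bar>mollify (h n) u x\<bar> - 2 * h n) \<longlonglongrightarrow> \<bar>u x\<bar> - 2 * 0" by (intro tendsto_intros ml hl)
          then have ml2: "(\<lambda>n. \<bar>mollify (h n) u x\<bar> - 2 * h n) \<longlonglongrightarrow> \<bar>u x\<bar>" by simp
          have wl: "(\<lambda>n. \<bar>w n x\<bar>) \<longlonglongrightarrow> \<bar>u x\<bar>"
          proof (rule tendsto_sandwich[OF _ _ ml2 ml])
            show "eventually (\<lambda>n. \<bar>mollify (h n) u x\<bar> - 2 * h n \<le> \<bar>w n x\<bar>) sequentially"
            proof (rule always_eventually, rule allI)
              fix n show "\<bar>mollify (h n) u x\<bar> - 2 * h n \<le> \<bar>w n x\<bar>"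
                using soft_cut_bounds(3)[OF h[of n], of "mollify (h n) u x"] unfolding w_def by linarith
            qed
            show "eventually (\<lambda>n. \<bar>w n x\<bar> \<le> \<bar>mollify (h n) u x\<bar>) sequentially"
              by (intro always_eventually allI wabs)
          qed
          have "(\<lambda>n. \<bar>w n x\<bar> powr r) \<longlonglongrightarrow> \<bar>u x\<bar> powr r"
            using r by (intro tendsto_powr'[OF wl tendsto_const]) auto
          then have "(\<lambda>n. ennreal (\<bar>w n x\<bar> powr r)) \<longlonglongrightarrow> ennreal (\<bar>u x\<bar> powr r)" by (rule tendsto_ennrealI)
          moreover have "eventually (\<lambda>n. ennreal (\<bar>w n x\<bar> powr r) = indicator {x. norm x > \<rho> n} x * ennreal (\<bar>w n x\<bar> powr r)) sequentially"
          proof -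
            have "norm x > 0" using True nn by linarith
            from eventually_mesh_less[OF this, where 'a='a] show ?thesis
              by eventually_elim (use True in \<open>simp add: \<rho>_def h_def\<close>)
          qed
          ultimately have "(\<lambda>n. indicator {x. norm x > \<rho> n} x * ennreal (\<bar>w n x\<bar> powr r)) \<longlonglongrightarrow> ennreal (\<bar>u x\<bar> powr r)"
            by (rule Lim_transform_eventually)
          then show ?thesis using True by simp
        next
          case False
          then have "\<not> norm x > \<rho> n" for n using \<rho>(2)[of n] by linarith
          then show ?thesis using False by simp
        qed
      qed
    qed
  qed
qed

text \<open>Here no cutoff of the function is called for: outside the unit ball the pointwise bound
  gives |w| <= 2^a, so for the level L = 2^a the superlevel set lies in the unit ball by itself, and
  the part below L is bounded by the volume of that ball.\<close>

lemma inner_estimate: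
  fixes \<zeta> :: "'a::euclidean_space \<Rightarrow> real"
  assumes W: "weak_sobolev_const TYPE('a) q C" and q: "1 \<le> q" "q \<le> r" and p: "1 \<le> p" "q * (1 - 1 / p) < 1"
    and a: "a > 0" and nn: "0 \<le> c1" "0 \<le> c2"
    and \<zeta>: "\<zeta> \<in> borel_measurable borel" "\<And>x. 0 \<le> \<zeta> x"
      "(\<integral>\<^sup>+x. indicator {x. 0 < norm x \<and> norm x \<le> 1} x * ennreal (\<zeta> x) \<partial>lborel) \<le> ennreal c2"
    and pt: "\<And>x t. 0 < norm x \<Longrightarrow> norm x \<le> 1 \<Longrightarrow> 0 < t \<Longrightarrow> t \<le> 2 powr a * norm x powr (- a) \<Longrightarrow>
      norm x powr (1 - real DIM('a) * (1 - 1 / q)) * t powr (r / q - 1)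
        \<le> c1 * norm x powr (b / p) * (t powr r + \<zeta> x) powr (1 - 1 / p)"
  shows "\<exists>K. \<forall>(u::'a \<Rightarrow> real) G. normalized_pair a b p u G \<longrightarrow>
     (\<integral>\<^sup>+x. indicator {x. 0 < norm x \<and> norm x < 1} x * ennreal (\<bar>u x\<bar> powr r) \<partial>lborel) \<le> ennreal K"
proof -
  let ?\<Gamma> = "mollified_energy TYPE('a) b p"
  have \<Gamma>: "0 \<le> ?\<Gamma>" by (simp add: mollified_energy_def)
  let ?vol = "measure lborel (cball (0::'a) 1)"
  define L where "L = 2 powr a"
  have L: "L > 0" by (simp add: L_def)
  let ?c3 = "(2 * L) powr r * ?vol"
  define K0 where "K0 = (1 + c2 + ?c3 + 4 powr r * (6 * C) powr q * (c1 * (?\<Gamma> + 1)) powr q) powr (1 / (1 - q * (1 - 1 / p)))"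
  have r: "r > 0" using q by simp
  show ?thesis
  proof (intro exI[of _ "K0 + L powr r * ?vol"] allI impI)
    fix u :: "'a \<Rightarrow> real" and G
    assume n: "normalized_pair a b p u G"
    define h where "h n = mesh TYPE('a) n" for n
    have h: "h n > 0" for n by (simp add: h_def mesh)
    define \<rho> where "\<rho> n = 2 * real DIM('a) * h n" for n
    have \<rho>: "2 * real DIM('a) * h n \<le> \<rho> n" "0 < \<rho> n" "\<rho> n < 1" for n
    proof -
      show "2 * real DIM('a) * h n \<le> \<rho> n" "0 < \<rho> n" using h[of n] by (simp_all add: \<rho>_def)
      have "1 / real (Suc n) \<le> 1" by simp
      then show "\<rho> n < 1" unfolding \<rho>_def h_def mesh(2) by linarith
    qed
    define w where "w n = mollify (h n) u" for n
    have SO: "open {x::'a. norm x > c}" for c by (intro open_Collect_less continuous_intros)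
    have SO1: "open {x::'a. norm x > c \<and> norm x < 1}" for c
      by (intro open_Collect_conj open_Collect_less continuous_intros)
    note M = normalized_pair_mollify[OF n less_imp_le[OF a] p(1) h \<rho>(1), folded w_def]
    have in1: "norm x \<le> 1" if "norm x > \<rho> n" "\<bar>w n x\<bar> > L" for n x
    proof (rule ccontr)
      assume "\<not> norm x \<le> 1"
      then have "norm x powr (- a) \<le> 1 powr (- a)" using a by (intro powr_mono2') auto
      then have "2 powr a * norm x powr (- a) \<le> 2 powr a * 1" by (intro mult_left_mono) auto
      then show False using M(2)[OF that(1)] that(2) unfolding L_def by linarith
    qed
    have bound: "(\<integral>\<^sup>+x. indicator {x. norm x > \<rho> n \<and> norm x < 1} x * ennreal (\<bar>w n x\<bar> powr r) \<partial>lborel) \<le> ennreal (K0 + L powr r * ?vol)" for n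
    proof -
      have R': "\<bar>w n y\<bar> \<le> L" if "1 \<le> norm y" for y
      proof -
        have y: "norm y > \<rho> n" using that \<rho>(3)[of n] by linarith
        have "norm y powr (- a) \<le> 1 powr (- a)" using a that by (intro powr_mono2') auto
        then have "2 powr a * norm y powr (- a) \<le> 2 powr a * 1" by (intro mult_left_mono) auto
        then show ?thesis using M(2)[OF y] unfolding L_def by linarith
      qed
      have B: "\<bar>w n x\<bar> \<le> 2 powr a * (\<rho> n) powr (- a)" if x: "norm x > \<rho> n" for x
      proof -
        have "norm x powr (- a) \<le> (\<rho> n) powr (- a)" using x a \<rho>(2)[of n] by (intro powr_mono2') auto
        then have "2 powr a * norm x powr (- a) \<le> 2 powr a * (\<rho> n) powr (- a)" by (intro mult_left_mono) auto
        then show ?thesis using M(2)[OF x] by linarith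
      qed
      have AP: "(\<integral>\<^sup>+x. indicator {x. norm x > \<rho> n \<and> \<bar>w n x\<bar> > L} x * ennreal (\<bar>w n x\<bar> powr r) \<partial>lborel) \<le> ennreal K0"
        unfolding K0_def
      proof (rule a_priori_bound[OF W q p nn(1,2) _ \<Gamma> \<rho>(2) M(1) L R' B \<zeta>(1,2), where b=b])
        show "0 \<le> ?c3" by simp
        show "norm x powr (1 - real DIM('a) * (1 - 1 / q)) * \<bar>w n x\<bar> powr (r / q - 1)
          \<le> c1 * norm x powr (b / p) * (\<bar>w n x\<bar> powr r + \<zeta> x) powr (1 - 1 / p)"
          if "norm x > \<rho> n" "\<bar>w n x\<bar> > L" for x
          using that \<rho>(2)[of n] L in1[OF that] M(2)[OF that(1)] by (intro pt) linarith+
        show "(\<integral>\<^sup>+x. indicator {x. norm x > \<rho> n \<and> \<bar>w n x\<bar> > L} x * ennreal (\<zeta> x) \<partial>lborel) \<le> ennreal c2"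
        proof (rule order_trans[OF nn_integral_mono \<zeta>(3)])
          fix x show "indicator {x. norm x > \<rho> n \<and> \<bar>w n x\<bar> > L} x * ennreal (\<zeta> x) \<le> indicator {x. 0 < norm x \<and> norm x \<le> 1} x * ennreal (\<zeta> x)"
          proof (cases "norm x > \<rho> n \<and> \<bar>w n x\<bar> > L")
            case True
            then have "0 < norm x" "norm x \<le> 1" using in1[of n x] \<rho>(2)[of n] by linarith+
            then show ?thesis using True by simp
          qed simp
        qed
        show "(\<integral>\<^sup>+x. indicator {x. norm x > \<rho> n \<and> \<bar>w n x\<bar> > L} x * ennreal (norm x powr b * norm (mollify_vec (h n) G x) powr p) \<partial>lborel) \<le> ennreal ?\<Gamma>"
          by (rule order_trans[OF nn_integral_mono M(3)[of n]]) (auto simp: indicator_def)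
        show "(\<integral>\<^sup>+x. indicator {x. norm x > \<rho> n \<and> L < \<bar>w n x\<bar> \<and> \<bar>w n x\<bar> < 2 * L} x * ennreal (\<bar>w n x\<bar> powr r) \<partial>lborel) \<le> ennreal ?c3"
        proof (rule emeasure_le_of_subset_cball)
          show "{x. norm x > \<rho> n \<and> L < \<bar>w n x\<bar> \<and> \<bar>w n x\<bar> < 2 * L} \<subseteq> cball 0 1"
            using in1 by auto
          show "\<bar>w n x\<bar> powr r \<le> (2 * L) powr r" if "x \<in> {x. norm x > \<rho> n \<and> L < \<bar>w n x\<bar> \<and> \<bar>w n x\<bar> < 2 * L}" for x
            using that r by (intro powr_mono2) auto
        qed simp
      qed
      have wc: "continuous_on {x. norm x > \<rho> n} (w n)" by (rule C1_pair_continuous[OF M(1)])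
      have S1: "open {x. norm x > \<rho> n \<and> \<bar>w n x\<bar> > L}"
      proof -
        have "open ({x. norm x > \<rho> n} \<inter> (\<lambda>x. \<bar>w n x\<bar>) -` {L<..})"
          by (rule continuous_open_preimage[OF _ SO]) (auto intro!: continuous_intros wc)
        then show ?thesis by (simp add: Int_def)
      qed
      have m1: "(\<lambda>x. indicator {x. norm x > \<rho> n \<and> \<bar>w n x\<bar> > L} x * ennreal (\<bar>w n x\<bar> powr r)) \<in> borel_measurable lborel"
        by (rule powr_indicator_measurable[OF S1]) (rule continuous_on_subset[OF wc], auto)
      have "(\<integral>\<^sup>+x. indicator {x. norm x > \<rho> n \<and> norm x < 1} x * ennreal (\<bar>w n x\<bar> powr r) \<partial>lborel)
        \<le> (\<integral>\<^sup>+x. indicator {x. norm x > \<rho> n \<and> \<bar>w n x\<bar> > L} x * ennreal (\<bar>w n x\<bar> powr r) + ennreal (L powr r) * indicator (cball (0::'a) 1) x \<partial>lborel)"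
      proof (rule nn_integral_mono)
        fix x :: 'a
        show "indicator {x. norm x > \<rho> n \<and> norm x < 1} x * ennreal (\<bar>w n x\<bar> powr r) \<le> indicator {x. norm x > \<rho> n \<and> \<bar>w n x\<bar> > L} x * ennreal (\<bar>w n x\<bar> powr r) + ennreal (L powr r) * indicator (cball (0::'a) 1) x"
        proof (cases "norm x > \<rho> n \<and> norm x < 1 \<and> \<bar>w n x\<bar> \<le> L")
          case True
          then have "\<bar>w n x\<bar> powr r \<le> L powr r" using r by (intro powr_mono2) auto
          then show ?thesis using True by (simp add: ennreal_leI)
        next
          case False
          then show ?thesis by (cases "norm x > \<rho> n \<and> norm x < 1") auto
        qed
      qed
      also have "\<dots> = (\<integral>\<^sup>+x. indicator {x. norm x > \<rho> n \<and> \<bar>w n x\<bar> > L} x * ennreal (\<bar>w n x\<bar> powr r) \<partial>lborel) + (\<integral>\<^sup>+x. ennreal (L powr r) * indicator (cball (0::'a) 1) x \<partial>lborel)"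
        by (rule nn_integral_add[OF m1]) (intro borel_measurable_times_ennreal borel_measurable_const borel_measurable_indicator, simp)
      also have "\<dots> \<le> ennreal K0 + ennreal (L powr r * ?vol)"
      proof (rule add_mono[OF AP])
        have "(\<integral>\<^sup>+x. indicator (cball (0::'a) 1) x * ennreal (L powr r) \<partial>lborel) \<le> ennreal (L powr r * ?vol)"
          by (rule emeasure_le_of_subset_cball) auto
        then show "(\<integral>\<^sup>+x. ennreal (L powr r) * indicator (cball (0::'a) 1) x \<partial>lborel) \<le> ennreal (L powr r * ?vol)"
          by (simp only: mult.commute)
      qed
      also have "\<dots> = ennreal (K0 + L powr r * ?vol)" by (subst ennreal_plus) (auto simp: K0_def)
      finally show ?thesis .
    qed
    show "(\<integral>\<^sup>+x. indicator {x. 0 < norm x \<and> norm x < 1} x * ennreal (\<bar>u x\<bar> powr r) \<partial>lborel) \<le> ennreal (K0 + L powr r * ?vol)"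
    proof (rule nn_integral_le_of_tendsto[OF _ bound])
      show "(\<lambda>x. indicator {x. norm x > \<rho> n \<and> norm x < 1} x * ennreal (\<bar>w n x\<bar> powr r)) \<in> borel_measurable lborel" for n
        by (rule powr_indicator_measurable[OF SO1 continuous_on_subset[OF C1_pair_continuous[OF M(1)]]]) auto
      show "AE x in lborel. (\<lambda>n. indicator {x. norm x > \<rho> n \<and> norm x < 1} x * ennreal (\<bar>w n x\<bar> powr r)) \<longlonglongrightarrow> indicator {x. 0 < norm x \<and> norm x < 1} x * ennreal (\<bar>u x\<bar> powr r)"
        using normalized_pair_mollify_tendsto[OF n]
      proof eventually_elim
        case (elim x)
        show ?case
        proof (cases "0 < norm x \<and> norm x < 1")
          case True
          have wl: "(\<lambda>n. \<bar>w n x\<bar>) \<longlonglongrightarrow> \<bar>u x\<bar>"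
            using elim unfolding h_def w_def by (rule tendsto_rabs)
          have "(\<lambda>n. \<bar>w n x\<bar> powr r) \<longlonglongrightarrow> \<bar>u x\<bar> powr r"
            using r by (intro tendsto_powr'[OF wl tendsto_const]) auto
          then have "(\<lambda>n. ennreal (\<bar>w n x\<bar> powr r)) \<longlonglongrightarrow> ennreal (\<bar>u x\<bar> powr r)" by (rule tendsto_ennrealI)
          moreover have "eventually (\<lambda>n. ennreal (\<bar>w n x\<bar> powr r) = indicator {x. norm x > \<rho> n \<and> norm x < 1} x * ennreal (\<bar>w n x\<bar> powr r)) sequentially"
          proof -
            have "norm x > 0" using True by linarith
            from eventually_mesh_less[OF this, where 'a='a] show ?thesis
              by eventually_elim (use True in \<open>simp add: \<rho>_def h_def\<close>)
          qed
          ultimately have "(\<lambda>n. indicator {x. norm x > \<rho> n \<and> norm x < 1} x * ennreal (\<bar>w n x\<bar> powr r)) \<longlonglongrightarrow> ennreal (\<bar>u x\<bar> powr r)"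
            by (rule Lim_transform_eventually)
          then show ?thesis using True by simp
        next
          case False
          then have "\<not> (norm x > \<rho> n \<and> norm x < 1)" for n using \<rho>(2)[of n] by linarith
          then show ?thesis using False by simp
        qed
      qed
    qed
  qed
qed

subsection \<open>Exponents in the three ranges\<close>

definition uniformly_bounded :: "'a::euclidean_space itself \<Rightarrow> real \<Rightarrow> real \<Rightarrow> real \<Rightarrow> real \<Rightarrow> 'a set \<Rightarrow> bool" where
  "uniformly_bounded T a b p r D \<longleftrightarrow> (\<exists>K. \<forall>(u::'a \<Rightarrow> real) G. normalized_pair a b p u G \<longrightarrow>
     (\<integral>\<^sup>+x. indicator D x * ennreal (\<bar>u x\<bar> powr r) \<partial>lborel) \<le> ennreal K)"

lemma uniformly_bounded_complement:
  fixes A B :: "'a::euclidean_space set"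
  assumes D: "uniformly_bounded TYPE('a) a b p r A" and r: "r > 0"
    and AB: "\<And>x. x \<noteq> 0 \<Longrightarrow> x \<in> A \<or> x \<in> B" "A \<in> sets borel" "B \<in> sets borel"
    and fin: "(\<integral>\<^sup>+x. indicator B x * ennreal (norm x powr (- (a * r))) \<partial>lborel) < \<infinity>"
  shows "uniformly_bounded TYPE('a) a b p r UNIV"
proof -
  obtain K where K: "\<And>u G. normalized_pair a b p u G \<Longrightarrow>
     (\<integral>\<^sup>+x. indicator A x * ennreal (\<bar>u x\<bar> powr r) \<partial>lborel) \<le> ennreal K"
    using D unfolding uniformly_bounded_def by auto
  obtain M where M: "(\<integral>\<^sup>+x. indicator B x * ennreal (norm x powr (- (a * r))) \<partial>lborel) = ennreal M" "0 \<le> M"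
    using fin by (cases "(\<integral>\<^sup>+x. indicator B x * ennreal (norm x powr (- (a * r))) \<partial>lborel)") auto
  show ?thesis
    unfolding uniformly_bounded_def
  proof (intro exI[of _ "\<bar>K\<bar> + M"] allI impI)
    fix u :: "'a \<Rightarrow> real" and G
    assume n: "normalized_pair a b p u G"
    have [measurable]: "u \<in> borel_measurable borel" using n by (simp add: normalized_pair_def borel_weak_gradient_def)
    note [measurable] = AB(2,3)
    have u: "AE x in lborel. \<bar>u x\<bar> \<le> norm x powr (- a)" using n by (simp add: normalized_pair_def)
    have "(\<integral>\<^sup>+x. indicator UNIV x * ennreal (\<bar>u x\<bar> powr r) \<partial>lborel)
      \<le> (\<integral>\<^sup>+x. indicator A x * ennreal (\<bar>u x\<bar> powr r) + indicator B x * ennreal (norm x powr (- (a * r))) \<partial>lborel)"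
    proof (rule nn_integral_mono_AE)
      have "AE x::'a in lborel. x \<noteq> 0" by (rule AE_lborel_singleton)
      with u show "AE x in lborel. indicator UNIV x * ennreal (\<bar>u x\<bar> powr r) \<le> indicator A x * ennreal (\<bar>u x\<bar> powr r) + indicator B x * ennreal (norm x powr (- (a * r)))"
      proof eventually_elim
        case (elim x)
        show ?case
        proof (cases "x \<in> A")
          case True then show ?thesis by simp
        next
          case False
          then have "x \<in> B" using AB(1) elim by blast
          moreover have "\<bar>u x\<bar> powr r \<le> (norm x powr (- a)) powr r" using elim r by (intro powr_mono2) auto
          ultimately show ?thesis using False by (simp add: powr_powr ennreal_leI)
        qed
      qed
    qed
    also have "\<dots> = (\<integral>\<^sup>+x. indicator A x * ennreal (\<bar>u x\<bar> powr r) \<partial>lborel) + (\<integral>\<^sup>+x. indicator B x * ennreal (norm x powr (- (a * r))) \<partial>lborel)"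
      by (rule nn_integral_add) measurable
    also have "\<dots> \<le> ennreal \<bar>K\<bar> + ennreal M"
      using K[OF n] M by (intro add_mono) (auto intro: order_trans ennreal_leI)
    also have "\<dots> = ennreal (\<bar>K\<bar> + M)" using M by (simp add: ennreal_plus)
    finally show "(\<integral>\<^sup>+x. indicator UNIV x * ennreal (\<bar>u x\<bar> powr r) \<partial>lborel) \<le> ennreal (\<bar>K\<bar> + M)" .
  qed
qed

lemma uniformly_bounded_of_outer:
  assumes "uniformly_bounded TYPE('a::euclidean_space) a b p r {x. norm x > 1}" "r > 0" "a < real DIM('a) / r"
  shows "uniformly_bounded TYPE('a) a b p r UNIV"
proof (rule uniformly_bounded_complement[OF assms(1,2), where B="{x. 0 < norm x \<and> norm x \<le> 1}"])
  have "- (a * r) > - real DIM('a)" using assms(2,3) by (simp add: less_divide_eq)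
  then show "(\<integral>\<^sup>+x. indicator {x::'a. 0 < norm x \<and> norm x \<le> 1} x * ennreal (norm x powr (- (a * r))) \<partial>lborel) < \<infinity>"
    by (rule radial_powr_integral_inner)
qed (auto simp: not_less)

lemma uniformly_bounded_of_inner:
  assumes "uniformly_bounded TYPE('a::euclidean_space) a b p r {x. 0 < norm x \<and> norm x < 1}" "r > 0" "a > real DIM('a) / r"
  shows "uniformly_bounded TYPE('a) a b p r UNIV"
proof (rule uniformly_bounded_complement[OF assms(1,2), where B="{x. 1 \<le> norm x}"])
  have "- (a * r) < - real DIM('a)" using assms(2,3) by (simp add: divide_less_eq)
  then show "(\<integral>\<^sup>+x. indicator {x::'a. 1 \<le> norm x} x * ennreal (norm x powr (- (a * r))) \<partial>lborel) < \<infinity>"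
    by (rule radial_powr_integral_outer)
qed (auto simp: not_less)

text \<open>The interpolation exponent \<open>q\<close> is adapted to the weight exponent \<open>b0\<close>: by homogeneity the
  pointwise bound below pins \<open>q\<close> down.\<close>

definition critical_scheme :: "real \<Rightarrow> real \<Rightarrow> real \<Rightarrow> real \<Rightarrow> real \<Rightarrow> real \<Rightarrow> real \<Rightarrow> bool" where
  "critical_scheme N a b0 p r q c1 \<longleftrightarrow> 1 \<le> q \<and> q \<le> r \<and> N * (1 - 1 / q) \<le> 1 \<and> q * (1 - 1 / p) < 1 \<and> 0 \<le> c1 \<and>
    (\<forall>s t. 0 < s \<longrightarrow> 0 < t \<longrightarrow> t \<le> 2 powr a * s powr (- a) \<longrightarrow>
      s powr (1 - N * (1 - 1 / q)) * t powr (r / q - 1) \<le> c1 * s powr (b0 / p) * (t powr r) powr (1 - 1 / p))"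

text \<open>Raising b above \<open>b0\<close> enlarges the weight outside the unit ball, lowering it
  enlarges the weight inside, so the pointwise inequality for \<open>b0\<close> passes to b on the
  corresponding side. With b = \<open>b0\<close> it holds everywhere.\<close>

lemma critical_scheme_bounded:
  assumes cs: "critical_scheme (real DIM('a::euclidean_space)) a b0 p r q c1" and p: "1 \<le> p" and a: "a > 0"
  shows "b0 \<le> b \<Longrightarrow> uniformly_bounded TYPE('a) a b p r {x. norm x > 1}"
    and "b \<le> b0 \<Longrightarrow> uniformly_bounded TYPE('a) a b p r {x. 0 < norm x \<and> norm x < 1}"
    and "b = b0 \<Longrightarrow> uniformly_bounded TYPE('a) a b p r UNIV"
proof -
  have q: "1 \<le> q" "q \<le> r" "real DIM('a) * (1 - 1 / q) \<le> 1" "q * (1 - 1 / p) < 1" "0 \<le> c1"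
    and P: "\<And>s t. 0 < s \<Longrightarrow> 0 < t \<Longrightarrow> t \<le> 2 powr a * s powr (- a) \<Longrightarrow>
      s powr (1 - real DIM('a) * (1 - 1 / q)) * t powr (r / q - 1) \<le> c1 * s powr (b0 / p) * (t powr r) powr (1 - 1 / p)"
    using cs by (auto simp: critical_scheme_def)
  obtain C where W: "weak_sobolev_const TYPE('a) q C" using ex_weak_sobolev_const[OF q(1,3)] by blast
  have pt: "s powr (1 - real DIM('a) * (1 - 1 / q)) * t powr (r / q - 1) \<le> c1 * s powr (b / p) * (t powr r + 0) powr (1 - 1 / p)"
    if "0 < s" "0 < t" "t \<le> 2 powr a * s powr (- a)" "s powr (b0 / p) \<le> s powr (b / p)" for s t
  proof -
    have "c1 * s powr (b0 / p) * (t powr r) powr (1 - 1 / p) \<le> c1 * s powr (b / p) * (t powr r) powr (1 - 1 / p)"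
      using that q(5) by (intro mult_right_mono mult_left_mono) auto
    then show ?thesis using P[OF that(1-3)] by simp
  qed
  have z: "(\<integral>\<^sup>+x. indicator A x * ennreal 0 \<partial>lborel) \<le> ennreal 0" for A :: "'a set" by simp
  show "uniformly_bounded TYPE('a) a b p r {x. norm x > 1}" if b: "b0 \<le> b"
    unfolding uniformly_bounded_def
  proof (rule outer_estimate[OF W q(1,2) p q(4) a q(5) _ _ _ _ z])
    fix x :: 'a and t :: real assume *: "1 < norm x" "0 < t" "t \<le> 2 powr a * norm x powr - a"
    show "norm x powr (1 - real DIM('a) * (1 - 1 / q)) * t powr (r / q - 1) \<le> c1 * norm x powr (b / p) * (t powr r + 0) powr (1 - 1 / p)"
      using * b p by (intro pt powr_mono divide_right_mono) auto
  qed auto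
  show "uniformly_bounded TYPE('a) a b p r {x. 0 < norm x \<and> norm x < 1}" if b: "b \<le> b0"
    unfolding uniformly_bounded_def
  proof (rule inner_estimate[OF W q(1,2) p q(4) a q(5) _ _ _ z])
    fix x :: 'a and t :: real assume *: "0 < norm x" "norm x \<le> 1" "0 < t" "t \<le> 2 powr a * norm x powr - a"
    show "norm x powr (1 - real DIM('a) * (1 - 1 / q)) * t powr (r / q - 1) \<le> c1 * norm x powr (b / p) * (t powr r + 0) powr (1 - 1 / p)"
      using * b p by (intro pt powr_mono' divide_right_mono) auto
  qed auto
  show "uniformly_bounded TYPE('a) a b p r UNIV" if b: "b = b0"
  proof -
    \<comment> \<open>The outer estimate with excluded radius 0 treats both sides of the unit sphere
      at once; no comparison of a with N/r enters.\<close>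
    have "uniformly_bounded TYPE('a) a b p r {x. norm x > 0}"
      unfolding uniformly_bounded_def
    proof (rule outer_estimate[OF W q(1,2) p q(4) a q(5) _ _ _ _ z])
      fix x :: 'a and t :: real assume *: "0 < norm x" "0 < t" "t \<le> 2 powr a * norm x powr - a"
      show "norm x powr (1 - real DIM('a) * (1 - 1 / q)) * t powr (r / q - 1) \<le> c1 * norm x powr (b / p) * (t powr r + 0) powr (1 - 1 / p)"
        using * b by (intro pt) auto
    qed auto
    then show ?thesis
      by (rule uniformly_bounded_complement[where B="{}"]) (use q in auto)
  qed
qed

text \<open>The pointwise inequality is an identity with constant 1. That p <= r gives q >= 1, and
  the Sobolev condition is N(1 - 1/q) <= 1 for this q.\<close>

lemma critical_scheme_subcritical:
  fixes N a p r :: real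
  assumes N: "N \<ge> 1" and p: "1 \<le> p" and r: "p \<le> r" and s: "1 / p - 1 / N \<le> 1 / r"
  shows "critical_scheme N a (N * p * (1 / N + 1 / r - 1 / p)) p r (r / (1 + r * (1 - 1 / p))) 1"
proof -
  let ?\<gamma> = "1 + r * (1 - 1 / p)"
  let ?q = "r / ?\<gamma>"
  have r1: "1 \<le> r" using p r by linarith
  have g: "1 \<le> ?\<gamma>" using p r1 by simp
  have gr: "?\<gamma> \<le> r" using p r by (simp add: field_simps)
  have q1: "1 \<le> ?q" using g gr by simp
  have qr: "?q \<le> r" using g r1 by (simp add: divide_le_eq mult_le_cancel_left1)
  have iq: "1 / ?q = 1 / r + 1 - 1 / p" using r1 g by (simp add: field_simps)
  have Nq: "N * (1 - 1 / ?q) \<le> 1"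
  proof -
    have "1 - 1 / ?q \<le> 1 / N" using s unfolding iq by linarith
    then have "N * (1 - 1 / ?q) \<le> N * (1 / N)" using N by (intro mult_left_mono) auto
    then show ?thesis using N by simp
  qed
  have th: "?q * (1 - 1 / p) < 1"
  proof -
    have "?q * (1 - 1 / p) = (r * (1 - 1 / p)) / ?\<gamma>" by simp
    also have "\<dots> < 1" using g by (subst divide_less_eq_1_pos) auto
    finally show ?thesis .
  qed
  have e1: "1 - N * (1 - 1 / ?q) = (N * p * (1 / N + 1 / r - 1 / p)) / p"
  proof -
    have A: "N * p * X / p = N * X" for X using p by simp
    have "N * p * (1 / N + 1 / r - 1 / p) / p = N * (1 / N) + N * (1 / r) - N * (1 / p)"
      unfolding A by (simp only: ring_distribs)
    moreover have "N * (1 / N) = 1" using N by simp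
    moreover have "1 - N * (1 - (1 / r + 1 - 1 / p)) = 1 + N * (1 / r) - N * (1 / p)"
      by (simp add: ring_distribs)
    ultimately show ?thesis unfolding iq by linarith
  qed
  have e2: "r / ?q - 1 = r * (1 - 1 / p)" using r1 by simp
  show ?thesis
    unfolding critical_scheme_def
  proof (intro conjI allI impI)
    fix s t :: real
    show "s powr (1 - N * (1 - 1 / ?q)) * t powr (r / ?q - 1) \<le> 1 * s powr (N * p * (1 / N + 1 / r - 1 / p) / p) * (t powr r) powr (1 - 1 / p)"
      unfolding e1 e2 by (simp add: powr_powr)
  qed (use q1 qr Nq th in auto)
qed

text \<open>For q = N/(N-1) the weight |x|^\<beta> is constant. The surplus exponent
  \<open>?e\<close> of t is positive, so t^e is at most a constant times s^(-a e) by the pointwise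
  bound, and -a e is exactly the critical exponent divided by p.\<close>

lemma critical_scheme_supercritical:
  fixes N a p r :: real
  assumes N: "N > 1" and p: "1 \<le> p" "p < N" and a: "0 < a" and s: "1 / r < 1 / p - 1 / N" and r: "0 < r"
  shows "critical_scheme N a (a * r * p * (1 / N + 1 / r - 1 / p)) p r (N / (N - 1)) ((2 powr a) powr (r * (1 / p - 1 / N) - 1))"
proof -
  let ?q = "N / (N - 1)"
  let ?e = "r * (1 / p - 1 / N) - 1"
  have iq: "1 / ?q = 1 - 1 / N" using N by (simp add: field_simps)
  have e0: "0 < ?e"
  proof -
    have "r * (1 / r) < r * (1 / p - 1 / N)" using s r by (intro mult_strict_left_mono) auto
    then show ?thesis using r by simp
  qed
  have q1: "1 \<le> ?q" using N by simp
  have qr: "?q \<le> r"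
  proof -
    have "1 / p \<le> 1" using p by simp
    then have "1 / r \<le> 1 / ?q" using s unfolding iq by linarith
    then show ?thesis using r N by (simp add: divide_simps mult.commute split: if_splits)
  qed
  have Nq: "N * (1 - 1 / ?q) = 1" unfolding iq using N by simp
  have th: "?q * (1 - 1 / p) < 1"
  proof -
    have "1 / N < 1 / p" using p N by (intro divide_strict_left_mono) auto
    then have "1 - 1 / p < 1 / ?q" unfolding iq by linarith
    then have "?q * (1 - 1 / p) < ?q * (1 / ?q)" using q1 by (intro mult_strict_left_mono) auto
    moreover have "x * (1 / x) = 1" if "1 \<le> x" for x :: real using that by simp
    ultimately show ?thesis using q1 by metis
  qed
  have e1: "1 - N * (1 - 1 / ?q) = 0" using Nq by simp
  have e2: "r / ?q - 1 = r * (1 - 1 / p) + ?e"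
  proof -
    have "r / ?q = r * (1 / ?q)" by simp
    also have "\<dots> = r * (1 - 1 / N)" unfolding iq ..
    finally show ?thesis by (simp add: algebra_simps)
  qed
  have e3: "a * r * p * (1 / N + 1 / r - 1 / p) / p = - a * ?e"
  proof -
    have "a * r * p * X / p = a * r * X" for X using p by simp
    moreover have "a * r * (1 / N + 1 / r - 1 / p) = a * (r * (1 / N)) + a * (r * (1 / r)) - a * (r * (1 / p))"
      by (simp only: ring_distribs mult.assoc)
    moreover have "r * (1 / r) = 1" using r by simp
    moreover have "- a * ?e = a * (r * (1 / N)) + a * 1 - a * (r * (1 / p))"
      by (simp only: ring_distribs mult_minus_left)
    ultimately show ?thesis by metis
  qed
  show ?thesis
    unfolding critical_scheme_def
  proof (intro conjI allI impI)
    fix s t :: real assume *: "0 < s" "0 < t" "t \<le> 2 powr a * s powr - a"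
    have "t powr ?e \<le> (2 powr a * s powr - a) powr ?e" using * e0 by (intro powr_mono2) auto
    also have "\<dots> = (2 powr a) powr ?e * s powr (- a * ?e)" using * by (simp add: powr_mult powr_powr)
    finally have le: "t powr ?e \<le> (2 powr a) powr ?e * s powr (- a * ?e)" .
    have "s powr (1 - N * (1 - 1 / ?q)) * t powr (r / ?q - 1) = t powr (r * (1 - 1 / p)) * t powr ?e"
      unfolding e1 e2 powr_add using * by simp
    also have "\<dots> \<le> t powr (r * (1 - 1 / p)) * ((2 powr a) powr ?e * s powr (- a * ?e))"
      by (intro mult_left_mono le) simp
    finally show "s powr (1 - N * (1 - 1 / ?q)) * t powr (r / ?q - 1) \<le> (2 powr a) powr ?e * s powr (a * r * p * (1 / N + 1 / r - 1 / p) / p) * (t powr r) powr (1 - 1 / p)"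
      unfolding e3 by (simp add: powr_powr mult_ac)
  qed (use q1 qr Nq th in auto)
qed

text \<open>For \<open>r < p\<close> the strict inequality for \<open>b\<close> leaves room for a Hoelder step: the power of \<open>s = |x|\<close> added
  to \<open>t\<^sup>r = |u|\<^sup>r\<close> is integrable on the region under consideration.\<close>

lemma strict_scheme_pointwise:
  fixes p r b s t :: real
  assumes pr: "1 \<le> r" "r < p" and s: "0 < s" and t: "0 < t"
  shows "s powr 1 * t powr (r - 1) \<le> 1 * s powr (b / p) * (t powr r + s powr ((1 - b / p) / (1 / r - 1 / p))) powr (1 - 1 / p)"
proof -
  let ?\<theta> = "1 / r - 1 / p"
  \<comment> \<open>The exponent in \<open>?B\<close> is made for \<open>?B powr ?\<theta>\<close>
    to be s^(1-b/p). Then both factors are bounded by powers of \<open>?A + ?B\<close> whose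
    exponents add up to (1/r - 1/p) + (1 - 1/r) = 1 - 1/p.\<close>
  let ?A = "t powr r" and ?B = "s powr ((1 - b / p) / ?\<theta>)"
  have th: "?\<theta> > 0" using pr by (simp add: divide_strict_left_mono)
  have "t powr (r - 1) = ?A powr (1 - 1 / r)" using pr t by (simp add: powr_powr algebra_simps)
  also have "\<dots> \<le> (?A + ?B) powr (1 - 1 / r)" using pr by (intro powr_mono2) auto
  finally have 1: "t powr (r - 1) \<le> (?A + ?B) powr (1 - 1 / r)" .
  have "x / d * d = x" if "d > 0" for x d :: real using that by simp
  from this[OF th, of "1 - b / p"] have "s powr (1 - b / p) = ?B powr ?\<theta>" by (simp only: powr_powr)
  also have "\<dots> \<le> (?A + ?B) powr ?\<theta>" using th by (intro powr_mono2) auto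
  finally have 2: "s powr (1 - b / p) \<le> (?A + ?B) powr ?\<theta>" .
  have "s powr 1 * t powr (r - 1) = s powr (b / p) * (s powr (1 - b / p) * t powr (r - 1))"
    using s by (simp add: powr_diff)
  also have "\<dots> \<le> s powr (b / p) * ((?A + ?B) powr ?\<theta> * (?A + ?B) powr (1 - 1 / r))"
    by (intro mult_left_mono mult_mono 1 2) auto
  also have "(?A + ?B) powr ?\<theta> * (?A + ?B) powr (1 - 1 / r) = (?A + ?B) powr (1 - 1 / p)"
    by (simp add: powr_add[symmetric])
  finally show ?thesis by simp
qed

text \<open>The case q = 1, where the weight exponent is \<beta> = 1. Since the critical b equals
  p(1 + N(1/r - 1/p)), strict inequality for b says that the added power of |x| has an exponent
  below -N outside the unit ball, respectively above -N inside, hence a finite integral.\<close>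

lemma strict_scheme_bounded:
  assumes pr: "1 \<le> r" "r < p" and a: "a > 0"
  shows "b > real DIM('a) * p * (1 / real DIM('a) + 1 / r - 1 / p) \<Longrightarrow> uniformly_bounded TYPE('a::euclidean_space) a b p r {x. norm x > 1}"
    and "b < real DIM('a) * p * (1 / real DIM('a) + 1 / r - 1 / p) \<Longrightarrow> uniformly_bounded TYPE('a) a b p r {x. 0 < norm x \<and> norm x < 1}"
proof -
  let ?N = "real DIM('a)"
  let ?\<theta> = "1 / r - 1 / p"
  let ?\<sigma> = "(1 - b / p) / ?\<theta>"
  have p: "1 \<le> p" using pr by simp
  have th: "?\<theta> > 0" using pr by (simp add: divide_strict_left_mono)
  have bc: "?N * p * (1 / ?N + 1 / r - 1 / p) = p * (1 + ?N * ?\<theta>)" by (simp add: field_simps)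
  obtain C where W: "weak_sobolev_const TYPE('a) 1 C" using ex_weak_sobolev_const[of 1] by auto
  have h: "1 * (1 - 1 / p) < 1" using p by simp
  show "uniformly_bounded TYPE('a) a b p r {x. norm x > 1}" if b: "b > ?N * p * (1 / ?N + 1 / r - 1 / p)"
  proof -
    have "1 + ?N * ?\<theta> < b / p" using b p unfolding bc by (simp add: less_divide_eq mult.commute)
    then have "1 - b / p < - ?N * ?\<theta>" by simp
    then have "?\<sigma> < - ?N" by (simp only: pos_divide_less_eq[OF th])
    from radial_powr_integral_outer[OF this]
    obtain c2 where c2: "(\<integral>\<^sup>+x. indicator {x::'a. 1 \<le> norm x} x * ennreal (norm x powr ?\<sigma>) \<partial>lborel) = ennreal c2" "0 \<le> c2"
      by (cases "(\<integral>\<^sup>+x. indicator {x::'a. 1 \<le> norm x} x * ennreal (norm x powr ?\<sigma>) \<partial>lborel)") auto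
    show ?thesis unfolding uniformly_bounded_def
    proof (rule outer_estimate[OF W _ pr(1) p h a _ c2(2), where ?c1.0=1 and \<zeta>="\<lambda>x. norm x powr ?\<sigma>"])
      show "(\<integral>\<^sup>+x. indicator {x::'a. 1 < norm x} x * ennreal (norm x powr ?\<sigma>) \<partial>lborel) \<le> ennreal c2"
        unfolding c2(1)[symmetric] by (intro nn_integral_mono mult_right_mono) (auto simp: indicator_def)
      fix x :: 'a and t :: real assume "1 < norm x" "0 < t"
      moreover from this have "0 < norm x" by linarith
      ultimately show "norm x powr (1 - ?N * (1 - 1 / 1)) * t powr (r / 1 - 1) \<le> 1 * norm x powr (b / p) * (t powr r + norm x powr ?\<sigma>) powr (1 - 1 / p)"
        using strict_scheme_pointwise[OF pr, of "norm x" t b] by simp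
    qed auto
  qed
  show "uniformly_bounded TYPE('a) a b p r {x. 0 < norm x \<and> norm x < 1}" if b: "b < ?N * p * (1 / ?N + 1 / r - 1 / p)"
  proof -
    have "b / p < 1 + ?N * ?\<theta>" using b p unfolding bc by (simp add: divide_less_eq mult.commute)
    then have "- ?N * ?\<theta> < 1 - b / p" by simp
    then have "- ?N < ?\<sigma>" by (simp only: pos_less_divide_eq[OF th])
    from radial_powr_integral_inner[OF this]
    obtain c2 where c2: "(\<integral>\<^sup>+x. indicator {x::'a. 0 < norm x \<and> norm x \<le> 1} x * ennreal (norm x powr ?\<sigma>) \<partial>lborel) = ennreal c2" "0 \<le> c2"
      by (cases "(\<integral>\<^sup>+x. indicator {x::'a. 0 < norm x \<and> norm x \<le> 1} x * ennreal (norm x powr ?\<sigma>) \<partial>lborel)") auto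
    show ?thesis unfolding uniformly_bounded_def
    proof (rule inner_estimate[OF W _ pr(1) p h a _ c2(2), where ?c1.0=1 and \<zeta>="\<lambda>x. norm x powr ?\<sigma>"])
      show "(\<integral>\<^sup>+x. indicator {x::'a. 0 < norm x \<and> norm x \<le> 1} x * ennreal (norm x powr ?\<sigma>) \<partial>lborel) \<le> ennreal c2"
        unfolding c2(1) ..
      fix x :: 'a and t :: real assume "0 < norm x" "0 < t"
      then show "norm x powr (1 - ?N * (1 - 1 / 1)) * t powr (r / 1 - 1) \<le> 1 * norm x powr (b / p) * (t powr r + norm x powr ?\<sigma>) powr (1 - 1 / p)"
        using strict_scheme_pointwise[OF pr, of "norm x" t b] by simp
    qed auto
  qed
qed

subsection \<open>The embedding\<close>

lemma weighted_norm_powr: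
  "1 \<le> p \<Longrightarrow> (norm (x::'a::euclidean_space) powr (b / p) * norm (v::'a)) powr p = norm x powr b * norm v powr p"
  by (simp add: powr_mult powr_powr)

lemma weighted_Lp_nn_integral:
  fixes G :: "'a::euclidean_space \<Rightarrow> 'a"
  assumes G: "G \<in> weighted_Lp_space b p" and p: "1 \<le> p"
  shows "(\<integral>\<^sup>+x. ennreal (norm x powr b * norm (G x) powr p) \<partial>lebesgue) = ennreal (weighted_Lp_norm b p G powr p)"
proof -
  let ?f = "\<lambda>x. norm x powr b * norm (G x) powr p"
  have i: "integrable lebesgue ?f"
    using G by (simp add: weighted_Lp_space_def Lp_space_def weighted_norm_powr[OF p])
  have "0 \<le> integral\<^sup>L lebesgue ?f" by (rule integral_nonneg_AE) simp
  then have "weighted_Lp_norm b p G powr p = integral\<^sup>L lebesgue ?f"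
    using p by (simp add: weighted_Lp_norm_def Lp_norm_def weighted_norm_powr powr_powr)
  then show ?thesis using nn_integral_eq_integral[OF i] by simp
qed

lemma distributional_gradient_weighted_norm:
  fixes u :: "'a::euclidean_space \<Rightarrow> real"
  assumes G: "has_distributional_gradient (- {0}) u G" and p: "1 \<le> p"
  shows "weighted_Lp_norm b p (distributional_gradient (- {0}) u) = weighted_Lp_norm b p G"
proof -
  let ?D = "distributional_gradient (- {0}) u"
  have D: "has_distributional_gradient (- {0}) u ?D"
    unfolding distributional_gradient_def by (rule someI[of "has_distributional_gradient (- {0}) u", OF G])
  have m[measurable]: "?D \<in> borel_measurable lebesgue" "G \<in> borel_measurable lebesgue"
    using D G by (auto simp: has_distributional_gradient_def intro: L1_loc_measurable)
  have n[measurable]: "(\<lambda>x::'a. norm x) \<in> borel_measurable lebesgue" by (rule measurable_completion) simp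
  have "AE x in lebesgue. ?D x = G x" by (rule AE_completion[OF distributional_gradient_unique[OF D G]])
  then have "integral\<^sup>L lebesgue (\<lambda>x. norm x powr b * norm (?D x) powr p) = integral\<^sup>L lebesgue (\<lambda>x. norm x powr b * norm (G x) powr p)"
    by (intro integral_cong_AE) (auto elim!: eventually_mono)
  then show ?thesis by (simp add: weighted_Lp_norm_def Lp_norm_def weighted_norm_powr[OF p])
qed

lemma borel_weak_gradient_scale:
  assumes "borel_weak_gradient u G"
  shows "borel_weak_gradient (\<lambda>x. c * u x) (\<lambda>x. c *\<^sub>R G x)"
proof -
  have "(LINT x|lborel. c * u x * frechet_derivative \<phi> (at x) i) = - (LINT x|lborel. (c *\<^sub>R G x) \<bullet> i * \<phi> x)"
    if "\<phi> \<in> test_functions (- {0})" "i \<in> Basis" for \<phi> i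
  proof -
    have "(LINT x|lborel. c * u x * frechet_derivative \<phi> (at x) i) = c * (LINT x|lborel. u x * frechet_derivative \<phi> (at x) i)"
      by (simp add: mult.assoc)
    also have "\<dots> = c * (- (LINT x|lborel. (G x \<bullet> i) * \<phi> x))"
      using assms that unfolding borel_weak_gradient_def by auto
    also have "\<dots> = - (LINT x|lborel. (c *\<^sub>R G x) \<bullet> i * \<phi> x)"
      by (simp add: mult.assoc)
    finally show ?thesis .
  qed
  moreover have "set_integrable lborel K (\<lambda>x. c * u x) \<and> set_integrable lborel K (\<lambda>x. c *\<^sub>R G x)"
    if "compact K \<and> K \<subseteq> - {0}" for K
  proof -
    have i: "integrable lborel (\<lambda>x. indicator K x *\<^sub>R u x)" "integrable lborel (\<lambda>x. indicator K x *\<^sub>R G x)"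
      using assms that by (auto simp: borel_weak_gradient_def set_integrable_def)
    have e: "indicator K x *\<^sub>R (c * u x) = c *\<^sub>R (indicator K x *\<^sub>R u x)"
      "indicator K x *\<^sub>R (c *\<^sub>R G x) = c *\<^sub>R (indicator K x *\<^sub>R G x)" for x by simp_all
    show ?thesis unfolding set_integrable_def e by (intro conjI integrable_scaleR_right i)
  qed
  ultimately show ?thesis using assms unfolding borel_weak_gradient_def by auto
qed

lemma not_AE_lborel_False: "\<not> (AE x::'a::euclidean_space in lborel. False)"
proof
  assume "AE x::'a in lborel. False"
  then have "ae_filter (lborel :: 'a measure) = bot" by (simp only: eventually_False)
  then show False by (simp add: ae_filter_eq_bot_iff)
qed

text \<open>\<open>real_of_ereal\<close> sends infinite values to 0, so the essential supremum has
  to be shown finite from below as well; the value minus infinity would require a null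
  measure.\<close>

lemma Linf_norm_bound:
  fixes f :: "'a::euclidean_space \<Rightarrow> real"
  assumes "f \<in> Linf_space"
  shows "AE x in lborel. \<bar>f x\<bar> \<le> Linf_norm f" "0 \<le> Linf_norm f"
proof -
  let ?E = "esssup lebesgue (\<lambda>x. ereal (norm (f x)))"
  have "AE x in lebesgue. ereal (norm (f x)) \<le> ?E" by (rule esssup_AE)
  then have ae: "AE x in lborel. ereal (norm (f x)) \<le> ?E" by (simp add: AE_completion_iff)
  have "?E < \<infinity>" using assms by (simp add: Linf_space_def)
  moreover have "?E \<noteq> - \<infinity>"
  proof
    assume "?E = - \<infinity>"
    then have "AE x::'a in lborel. False" using ae by simp
    then show False using not_AE_lborel_False by blast
  qed
  ultimately have E: "?E = ereal (Linf_norm f)"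
    unfolding Linf_norm_def by (cases ?E) auto
  show a: "AE x in lborel. \<bar>f x\<bar> \<le> Linf_norm f" using ae unfolding E by simp
  show "0 \<le> Linf_norm f"
  proof (rule ccontr)
    assume "\<not> 0 \<le> Linf_norm f"
    then have "AE x::'a in lborel. False" using a by (auto elim!: eventually_mono)
    then show False using not_AE_lborel_False by blast
  qed
qed

text \<open>The function is divided by a number t larger than its norm, not by the norm, which may
  be 0. Letting t decrease to the norm gives the inequality.\<close>

lemma continuously_embedded_of_uniformly_bounded:
  assumes ub: "uniformly_bounded TYPE('a::euclidean_space) a b p r UNIV" and p: "1 \<le> p" and r: "1 \<le> r"
  shows "continuously_embedded (W_space a b p :: ('a \<Rightarrow> real) set) (W_norm a b p) (Lp_space r) (Lp_norm r)"
proof -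
  obtain K0 where "\<And>(u::'a \<Rightarrow> real) G. normalized_pair a b p u G \<Longrightarrow> (\<integral>\<^sup>+x. ennreal (\<bar>u x\<bar> powr r) \<partial>lborel) \<le> ennreal K0"
    using ub unfolding uniformly_bounded_def by auto
  moreover define K where "K = \<bar>K0\<bar>"
  ultimately have K: "\<And>(u::'a \<Rightarrow> real) G. normalized_pair a b p u G \<Longrightarrow> (\<integral>\<^sup>+x. ennreal (\<bar>u x\<bar> powr r) \<partial>lborel) \<le> ennreal K"
  proof -
    fix u :: "'a \<Rightarrow> real" and G
    assume *: "\<And>(u::'a \<Rightarrow> real) G. normalized_pair a b p u G \<Longrightarrow> (\<integral>\<^sup>+x. ennreal (\<bar>u x\<bar> powr r) \<partial>lborel) \<le> ennreal K0"
      and **: "K = \<bar>K0\<bar>" and n: "normalized_pair a b p u G"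
    show "(\<integral>\<^sup>+x. ennreal (\<bar>u x\<bar> powr r) \<partial>lborel) \<le> ennreal K"
      unfolding ** by (rule order_trans[OF *[OF n] ennreal_leI]) simp
  qed
  have K0: "0 \<le> K" by (simp add: K_def)
  have main: "u \<in> Lp_space r \<and> Lp_norm r u \<le> K powr (1 / r) * t"
    if u: "u \<in> W_space a b p" and t: "W_norm a b p u < t" for u :: "'a \<Rightarrow> real" and t
  proof -
    obtain G where uL: "u \<in> L1_loc (- {0})" and ui: "(\<lambda>x. norm x powr a * u x) \<in> Linf_space"
      and G: "has_distributional_gradient (- {0}) u G" "G \<in> weighted_Lp_space b p"
      using u unfolding W_space_def by blast
    let ?M = "Linf_norm (\<lambda>x. norm x powr a * u x)" and ?E = "weighted_Lp_norm b p G"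
    note M = Linf_norm_bound[OF ui]
    have W: "W_norm a b p u = ?M + ?E"
      unfolding W_norm_def distributional_gradient_weighted_norm[OF G(1) p] ..
    have E0: "0 \<le> ?E" by (simp add: weighted_Lp_norm_def Lp_norm_def)
    have tM: "?M \<le> t" and tE: "?E \<le> t" and t0: "0 < t" using t M(2) E0 unfolding W by linarith+
    have um: "u \<in> borel_measurable lebesgue" by (rule L1_loc_measurable[OF uL])
    obtain u' where u': "u' \<in> borel_measurable borel" "AE x in lborel. u x = u' x"
      using ex_borel_representative[OF um] by blast
    have "G \<in> L1_loc (- {0})" using G(1) by (simp add: has_distributional_gradient_def)
    then obtain G' where G': "G' \<in> borel_measurable borel" "AE x in lborel. G x = G' x"
      using ex_borel_representative[OF L1_loc_measurable] by blast
    have bw: "borel_weak_gradient u' G'" by (rule borel_weak_gradient_of_distributional[OF G(1) u' G'])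
    have "normalized_pair a b p (\<lambda>x. (1 / t) * u' x) (\<lambda>x. (1 / t) *\<^sub>R G' x)"
      unfolding normalized_pair_def
    proof (intro conjI)
      show "borel_weak_gradient (\<lambda>x. (1 / t) * u' x) (\<lambda>x. (1 / t) *\<^sub>R G' x)" by (rule borel_weak_gradient_scale[OF bw])
      have "AE x::'a in lborel. x \<noteq> 0" by (rule AE_lborel_singleton)
      with M(1) u'(2) show "AE x in lborel. \<bar>(1 / t) * u' x\<bar> \<le> norm x powr - a"
      proof eventually_elim
        case (elim x)
        have nx: "norm x powr a > 0" using elim(3) by simp
        have "norm x powr a * \<bar>u' x\<bar> \<le> t" using elim tM by (simp add: abs_mult)
        then have "\<bar>u' x\<bar> \<le> t * norm x powr (- a)" using nx by (simp add: powr_minus_divide le_divide_eq mult.commute)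
        then show ?case using t0 by (simp add: abs_mult divide_le_eq mult.commute)
      qed
      have "(\<integral>\<^sup>+x. ennreal (norm x powr b * norm ((1 / t) *\<^sub>R G' x) powr p) \<partial>lborel) = (\<integral>\<^sup>+x. ennreal ((1 / t) powr p) * ennreal (norm x powr b * norm (G x) powr p) \<partial>lebesgue)"
      proof -
        have "(\<integral>\<^sup>+x. ennreal (norm x powr b * norm ((1 / t) *\<^sub>R G' x) powr p) \<partial>lborel) = (\<integral>\<^sup>+x. ennreal ((1 / t) powr p) * ennreal (norm x powr b * norm (G x) powr p) \<partial>lborel)"
        proof (rule nn_integral_cong_AE)
          show "AE x in lborel. ennreal (norm x powr b * norm ((1 / t) *\<^sub>R G' x) powr p) = ennreal ((1 / t) powr p) * ennreal (norm x powr b * norm (G x) powr p)"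
            using G'(2)
          proof eventually_elim
            case (elim x)
            have "norm ((1 / t) *\<^sub>R G' x) powr p = (1 / t) powr p * norm (G x) powr p"
              unfolding elim[symmetric] norm_scaleR using t0 by (subst powr_mult[symmetric]) auto
            then show ?case by (simp add: ennreal_mult[symmetric] mult_ac)
          qed
        qed
        then show ?thesis by (simp only: nn_integral_completion)
      qed
      also have "\<dots> = ennreal ((1 / t) powr p) * ennreal (?E powr p)"
        unfolding weighted_Lp_nn_integral[OF G(2) p, symmetric]
        using G(2) by (intro nn_integral_cmult) (auto simp: weighted_Lp_space_def Lp_space_def weighted_norm_powr[OF p] intro!: borel_measurable_integrable measurable_compose[OF _ measurable_ennreal])
      also have "\<dots> = ennreal ((?E / t) powr p)" using t0 E0 by (simp add: ennreal_mult[symmetric] powr_divide)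
      also have "\<dots> \<le> ennreal (1 powr p)"
        using tE t0 E0 p by (intro ennreal_leI powr_mono2) auto
      finally show "(\<integral>\<^sup>+x. ennreal (norm x powr b * norm ((1 / t) *\<^sub>R G' x) powr p) \<partial>lborel) \<le> 1" by simp
    qed
    from K[OF this] have k: "(\<integral>\<^sup>+x. ennreal (\<bar>(1 / t) * u' x\<bar> powr r) \<partial>lborel) \<le> ennreal K" .
    have "(\<integral>\<^sup>+x. ennreal (norm (u x) powr r) \<partial>lebesgue) = (\<integral>\<^sup>+x. ennreal (t powr r) * ennreal (\<bar>(1 / t) * u' x\<bar> powr r) \<partial>lborel)"
    proof -
      have "(\<integral>\<^sup>+x. ennreal (norm (u x) powr r) \<partial>lborel) = (\<integral>\<^sup>+x. ennreal (t powr r) * ennreal (\<bar>(1 / t) * u' x\<bar> powr r) \<partial>lborel)"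
      proof (rule nn_integral_cong_AE)
        show "AE x in lborel. ennreal (norm (u x) powr r) = ennreal (t powr r) * ennreal (\<bar>(1 / t) * u' x\<bar> powr r)"
          using u'(2)
        proof eventually_elim
          case (elim x)
          have "norm (u x) powr r = t powr r * \<bar>(1 / t) * u' x\<bar> powr r"
            unfolding elim using t0 by (subst powr_mult[symmetric]) (auto simp: abs_mult)
          then show ?case by (simp add: ennreal_mult)
        qed
      qed
      then show ?thesis by (simp only: nn_integral_completion)
    qed
    also have "\<dots> = ennreal (t powr r) * (\<integral>\<^sup>+x. ennreal (\<bar>(1 / t) * u' x\<bar> powr r) \<partial>lborel)"
      using u'(1) by (intro nn_integral_cmult) auto
    also have "\<dots> \<le> ennreal (t powr r) * ennreal K" by (intro mult_left_mono k) simp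
    also have "\<dots> = ennreal (K * t powr r)" using K0 by (simp add: ennreal_mult[symmetric] mult.commute)
    finally have fin: "(\<integral>\<^sup>+x. ennreal (norm (u x) powr r) \<partial>lebesgue) \<le> ennreal (K * t powr r)" .
    have "(\<lambda>x. norm (u x) powr r) \<in> borel_measurable lebesgue" using um by measurable
    then have int: "integrable lebesgue (\<lambda>x. norm (u x) powr r)"
      using fin by (intro integrableI_bounded) (auto intro: le_less_trans)
    have "ennreal (integral\<^sup>L lebesgue (\<lambda>x. norm (u x) powr r)) \<le> ennreal (K * t powr r)"
      using fin nn_integral_eq_integral[OF int] by simp
    then have le: "integral\<^sup>L lebesgue (\<lambda>x. norm (u x) powr r) \<le> K * t powr r"
      using K0 by (subst (asm) ennreal_le_iff) auto
    have "Lp_norm r u \<le> (K * t powr r) powr (1 / r)"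
      unfolding Lp_norm_def using r le by (intro powr_mono2 integral_nonneg_AE) auto
    also have "\<dots> = K powr (1 / r) * t" using r t0 K0 by (simp add: powr_mult powr_powr)
    finally show ?thesis using int um by (simp add: Lp_space_def)
  qed
  show ?thesis unfolding continuously_embedded_def
  proof (intro conjI exI[of _ "K powr (1 / r)"] ballI subsetI)
    fix u :: "'a \<Rightarrow> real" assume u: "u \<in> W_space a b p"
    show "u \<in> Lp_space r" using main[OF u, of "W_norm a b p u + 1"] by simp
    let ?c = "K powr (1 / r)"
    show "Lp_norm r u \<le> ?c * W_norm a b p u"
    proof (rule field_le_epsilon)
      fix e :: real assume e: "e > 0"
      have c: "0 < ?c + 1" by (rule add_nonneg_pos) auto
      have "Lp_norm r u \<le> ?c * (W_norm a b p u + e / (?c + 1))"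
        using main[OF u, of "W_norm a b p u + e / (?c + 1)"] e c by simp
      also have "\<dots> = ?c * W_norm a b p u + ?c * (e / (?c + 1))" by (simp add: ring_distribs)
      also have "?c * (e / (?c + 1)) \<le> (?c + 1) * (e / (?c + 1))" using e c by (intro mult_right_mono) auto
      also have "\<dots> = e" using c by simp
      finally show "Lp_norm r u \<le> ?c * W_norm a b p u + e" by simp
    qed
  qed
qed

subsection \<open>Smooth functions in the space\<close>

lemma C1_pair_UNIV: "C1_pair UNIV u G \<Longrightarrow> (u has_derivative (\<lambda>v. G x \<bullet> v)) (at x)"
  "C1_pair UNIV u G \<Longrightarrow> continuous_on A G" "C1_pair UNIV u G \<Longrightarrow> continuous_on A u"
  using C1_pair_continuous[of UNIV u G]
  by (auto simp: C1_pair_def intro: continuous_on_subset)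

lemma integrable_continuous_compact_support:
  fixes f :: "'a::euclidean_space \<Rightarrow> real"
  assumes "continuous_on UNIV f" "\<And>x. norm x > R \<Longrightarrow> f x = 0"
  shows "integrable lborel f"
proof -
  have "integrable lborel (\<lambda>x. indicator (cball 0 R) x *\<^sub>R f x)"
    by (rule borel_integrable_compact) (auto intro: continuous_on_subset assms)
  also have "(\<lambda>x. indicator (cball 0 R) x *\<^sub>R f x) = f"
    using assms(2) by (auto simp: fun_eq_iff indicator_def)
  finally show ?thesis .
qed

text \<open>The difference quotients have integral zero by translation invariance.\<close>

lemma integral_partial_derivative_eq_0:
  fixes f :: "'a::euclidean_space \<Rightarrow> real"
  assumes f: "C1_pair UNIV f g" and R: "\<And>x. norm x > R \<Longrightarrow> f x = 0 \<and> g x = 0" and i: "norm i = 1"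
  shows "(LINT x|lborel. g x \<bullet> i) = 0"
proof -
  have fc: "continuous_on UNIV f" and gc: "continuous_on UNIV g" using C1_pair_UNIV[OF f] by auto
  have [measurable]: "f \<in> borel_measurable borel" "g \<in> borel_measurable borel"
    using fc gc by (auto intro: borel_measurable_continuous_onI)
  have "compact ((\<lambda>x. norm (g x)) ` cball 0 R)"
    by (intro compact_continuous_image continuous_intros continuous_on_subset[OF gc]) auto
  then obtain B where B: "B > 0" "\<And>y. y \<in> (\<lambda>x. norm (g x)) ` cball 0 R \<Longrightarrow> norm y \<le> B"
    using compact_imp_bounded bounded_pos by metis
  have gB: "norm (g x) \<le> B" for x
  proof (cases "x \<in> cball 0 R")
    case True
    then have "norm (norm (g x)) \<le> B" by (intro B(2) imageI)
    then show ?thesis by simp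
  next
    case False
    then show ?thesis using B(1) R[of x] by simp
  qed
  have lip: "\<bar>f y - f x\<bar> \<le> B * norm (y - x)" for x y
  proof -
    have "norm (f y - f x) \<le> B * norm (y - x)"
    proof (rule differentiable_bound[where S=UNIV and f'="\<lambda>x v. g x \<bullet> v"])
      show "onorm ((\<bullet>) (g x)) \<le> B" for x
      proof (rule onorm_le)
        fix v show "norm (g x \<bullet> v) \<le> B * norm v"
          using Cauchy_Schwarz_ineq2[of "g x" v] mult_right_mono[OF gB[of x], of "norm v"] by simp
      qed
    qed (use C1_pair_UNIV(1)[OF f] in auto)
    then show ?thesis by simp
  qed
  define e where "e n = 1 / real (Suc n)" for n
  have e: "0 < e n" "e n \<le> 1" for n by (auto simp: e_def)
  define s where "s n x = (f (x + e n *\<^sub>R i) - f x) / e n" for n x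
  have fi: "integrable lborel f" by (rule integrable_continuous_compact_support[OF fc]) (use R in blast)
  have s0: "(LINT x|lborel. s n x) = 0" for n
  proof -
    have "(LINT x|lborel. f (x + e n *\<^sub>R i)) = (LINT x|lborel. f x)"
      using integral_shift_lborel[of f "- (e n *\<^sub>R i)"] by simp
    moreover have "integrable lborel (\<lambda>x. f (x + e n *\<^sub>R i))"
    proof (rule integrable_continuous_compact_support[where R="R + 1"])
      show "continuous_on UNIV (\<lambda>x. f (x + e n *\<^sub>R i))"
        by (rule continuous_on_compose2[OF fc]) (auto intro!: continuous_intros)
      fix x :: 'a assume "norm x > R + 1"
      then have "norm (x + e n *\<^sub>R i) > R"
        using norm_diff_ineq[of x "e n *\<^sub>R i"] e[of n] i by simp
      then show "f (x + e n *\<^sub>R i) = 0" using R by blast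
    qed
    ultimately show ?thesis using fi unfolding s_def
      by (subst integral_divide_zero) simp
  qed
  have "(\<lambda>n. LINT x|lborel. s n x) \<longlonglongrightarrow> (LINT x|lborel. g x \<bullet> i)"
  \<comment> \<open>All increments have length at most 1, so the difference quotients live in the
    ball of radius R + 1, where the Lipschitz constant bounds them.\<close>
  proof (rule integral_dominated_convergence[where w="\<lambda>x. B * indicator (cball 0 (R + 1)) x"])
    show "(\<lambda>x. g x \<bullet> i) \<in> borel_measurable lborel" by simp
    show "s n \<in> borel_measurable lborel" for n unfolding s_def[abs_def] by simp
    show "integrable lborel (\<lambda>x::'a. B * indicator (cball 0 (R + 1)) x)"
      by (intro integrable_mult_right integrable_real_indicator emeasure_lborel_cball_finite) simp
    show "AE x in lborel. norm (s n x) \<le> B * indicator (cball 0 (R + 1)) x" for n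
    proof (rule AE_I2)
      fix x :: 'a
      show "norm (s n x) \<le> B * indicator (cball 0 (R + 1)) x"
      proof (cases "norm x \<le> R + 1")
        case True
        have "\<bar>f (x + e n *\<^sub>R i) - f x\<bar> \<le> B * e n" using lip[where x=x and y="x + e n *\<^sub>R i"] i e[of n] by simp
        then show ?thesis using True e[of n] by (simp add: s_def divide_le_eq)
      next
        case False
        then have "norm (x + e n *\<^sub>R i) > R" "norm x > R"
          using norm_diff_ineq[of x "e n *\<^sub>R i"] e[of n] i by auto
        then have "f (x + e n *\<^sub>R i) = 0" "f x = 0" using R by blast+
        then show ?thesis using False by (simp add: s_def)
      qed
    qed
    show "AE x in lborel. (\<lambda>n. s n x) \<longlonglongrightarrow> g x \<bullet> i"
    proof (rule AE_I2)
      fix x :: 'a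
      have 1: "((\<lambda>t. x + t *\<^sub>R i) has_derivative (\<lambda>t. t *\<^sub>R i)) (at 0)" by (auto intro!: derivative_eq_intros)
      have 2: "(f has_derivative (\<lambda>v. g x \<bullet> v)) (at (x + 0 *\<^sub>R i))" using C1_pair_UNIV(1)[OF f] by simp
      have "(\<lambda>t. g x \<bullet> (t *\<^sub>R i)) = (*) (g x \<bullet> i)" by (auto simp: fun_eq_iff mult.commute)
      with has_derivative_compose[OF 1 2]
      have "((\<lambda>t. f (x + t *\<^sub>R i)) has_real_derivative g x \<bullet> i) (at 0)" by (simp only: has_field_derivative_def)
      then have "((\<lambda>t. (f (x + t *\<^sub>R i) - f x) / t) \<longlongrightarrow> g x \<bullet> i) (at 0)"
        by (simp add: DERIV_def)
      moreover have "e \<longlonglongrightarrow> 0" unfolding e_def[abs_def] by (rule inverse_Suc_tendsto)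
      ultimately show "(\<lambda>n. s n x) \<longlonglongrightarrow> g x \<bullet> i"
        unfolding tendsto_at_iff_sequentially s_def using e by (auto simp: comp_def less_imp_neq[symmetric])
    qed
  qed
  then have "(\<lambda>n::nat. 0::real) \<longlonglongrightarrow> (LINT x|lborel. g x \<bullet> i)" by (simp only: s0)
  then show ?thesis using LIMSEQ_unique[OF tendsto_const] by metis
qed

lemma set_integrable_continuous_lebesgue:
  fixes f :: "'a::euclidean_space \<Rightarrow> 'b::euclidean_space"
  assumes "continuous_on UNIV f" "compact K"
  shows "set_integrable lebesgue K f"
proof -
  have i: "integrable lborel (\<lambda>x. indicator K x *\<^sub>R f x)"
    by (rule borel_integrable_compact) (auto intro: continuous_on_subset assms)
  then have "(\<lambda>x. indicator K x *\<^sub>R f x) \<in> borel_measurable lborel" by (rule borel_measurable_integrable)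
  with i show ?thesis unfolding set_integrable_def by (simp only: integrable_completion)
qed

lemma C1_pair_mult:
  assumes "C1_pair S u G" "C1_pair S v H"
  shows "C1_pair S (\<lambda>x. u x * v x) (\<lambda>x. u x *\<^sub>R H x + v x *\<^sub>R G x)"
proof -
  note c = C1_pair_continuous[OF assms(1)] C1_pair_continuous[OF assms(2)]
  show ?thesis using assms c unfolding C1_pair_def
    by (auto intro!: continuous_intros derivative_eq_intros simp: inner_add_left mult.commute)
qed

lemma test_function_C1_pair:
  assumes "\<phi> \<in> test_functions \<Omega>"
  obtains H R where "C1_pair UNIV \<phi> H" "\<And>x i. frechet_derivative \<phi> (at x) i = H x \<bullet> i"
    "\<And>x::'a::euclidean_space. norm x > R \<Longrightarrow> \<phi> x = 0 \<and> H x = 0"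
proof -
  have s: "smooth_order (Suc 0) \<phi>" using assms unfolding test_functions_def by blast
  define H where "H x = (\<Sum>i\<in>Basis. frechet_derivative \<phi> (at x) i *\<^sub>R i)" for x
  have d: "(\<phi> has_derivative frechet_derivative \<phi> (at x)) (at x)" for x
    using s by (simp add: frechet_derivative_works)
  have fd: "frechet_derivative \<phi> (at x) v = H x \<bullet> v" for x v
  proof -
    interpret linear "frechet_derivative \<phi> (at x)" using d by (rule has_derivative_linear)
    have "frechet_derivative \<phi> (at x) v = frechet_derivative \<phi> (at x) (\<Sum>i\<in>Basis. (v \<bullet> i) *\<^sub>R i)"
      by (simp only: euclidean_representation)
    also have "\<dots> = (\<Sum>i\<in>Basis. (v \<bullet> i) * frechet_derivative \<phi> (at x) i)" by (simp add: sum scale)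
    also have "\<dots> = (\<Sum>i\<in>Basis. (frechet_derivative \<phi> (at x) i *\<^sub>R i) \<bullet> v)"
      by (rule sum.cong) (simp_all add: inner_commute)
    finally show ?thesis by (simp only: H_def inner_sum_left)
  qed
  have Hc: "continuous_on UNIV H" unfolding H_def[abs_def] using s by (intro continuous_intros) auto
  have C: "C1_pair UNIV \<phi> H"
    using d Hc unfolding C1_pair_def by (simp add: fd[abs_def, symmetric])
  have "compact (closure {x. \<phi> x \<noteq> 0})" using assms unfolding test_functions_def by blast
  then have "bounded (closure {x. \<phi> x \<noteq> 0})" by (rule compact_imp_bounded)
  then obtain R where R: "\<forall>x\<in>closure {x. \<phi> x \<noteq> 0}. norm x \<le> R"
    unfolding bounded_iff by (elim exE) (rule that)
  have z: "\<phi> x = 0" if "norm x > R" for x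
  proof (rule ccontr)
    assume "\<phi> x \<noteq> 0"
    then have "x \<in> closure {x. \<phi> x \<noteq> 0}" by (intro subsetD[OF closure_subset] CollectI)
    with R that show False by force
  qed
  have "H x = 0" if "norm x > R" for x
  proof -
    have "open {x::'a. norm x > R}" by (intro open_Collect_less continuous_intros)
    then have "(\<phi> has_derivative (\<lambda>v. 0)) (at x)"
      by (rule has_derivative_transform_within_open[OF has_derivative_const[of 0]]) (use that z in auto)
    from has_derivative_unique[OF this C1_pair_UNIV(1)[OF C]] have "H x \<bullet> H x = 0" by metis
    then show ?thesis by simp
  qed
  then show ?thesis using that[OF C fd] z by blast
qed

text \<open>The product of u with a test function is C^1 with compact support, so its partial
  derivatives have integral 0; the product rule makes this integration by parts.\<close>

lemma C1_has_distributional_gradient: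
  fixes u :: "'a::euclidean_space \<Rightarrow> real"
  assumes u: "C1_pair UNIV u G"
  shows "has_distributional_gradient \<Omega> u G"
proof -
  have uc: "continuous_on UNIV u" and Gc: "continuous_on UNIV G" using C1_pair_UNIV[OF u] by auto
  have "integral\<^sup>L lebesgue (\<lambda>x. u x * frechet_derivative \<phi> (at x) i) = - integral\<^sup>L lebesgue (\<lambda>x. (G x \<bullet> i) * \<phi> x)"
    if \<phi>: "\<phi> \<in> test_functions \<Omega>" and i: "i \<in> Basis" for \<phi> i
  proof -
    obtain H R where H: "C1_pair UNIV \<phi> H" "\<And>x i. frechet_derivative \<phi> (at x) i = H x \<bullet> i"
      "\<And>x::'a. norm x > R \<Longrightarrow> \<phi> x = 0 \<and> H x = 0" using test_function_C1_pair[OF \<phi>] by blast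
    have \<phi>c: "continuous_on UNIV \<phi>" and Hc: "continuous_on UNIV H" using C1_pair_UNIV[OF H(1)] by auto
    have 1: "integrable lborel (\<lambda>x. u x * (H x \<bullet> i))" "integrable lborel (\<lambda>x. (G x \<bullet> i) * \<phi> x)"
      by (rule integrable_continuous_compact_support[where R=R]; use H(3) uc Gc \<phi>c Hc in \<open>auto intro!: continuous_intros\<close>)+
    have "(LINT x|lborel. (u x *\<^sub>R H x + \<phi> x *\<^sub>R G x) \<bullet> i) = 0"
      by (rule integral_partial_derivative_eq_0[OF C1_pair_mult[OF u H(1)], of R]) (use H(3) i in auto)
    then have "(LINT x|lborel. u x * (H x \<bullet> i) + (G x \<bullet> i) * \<phi> x) = 0"
      by (simp add: inner_add_left mult.commute)
    then have "(LINT x|lborel. u x * (H x \<bullet> i)) = - (LINT x|lborel. (G x \<bullet> i) * \<phi> x)"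
      using 1 by simp
    moreover have "(\<lambda>x. u x * (H x \<bullet> i)) \<in> borel_measurable lborel" "(\<lambda>x. (G x \<bullet> i) * \<phi> x) \<in> borel_measurable lborel"
      using 1 by (auto dest: borel_measurable_integrable)
    ultimately show ?thesis by (simp add: H(2) integral_completion)
  qed
  then show ?thesis unfolding has_distributional_gradient_def L1_loc_def
    using set_integrable_continuous_lebesgue[OF uc] set_integrable_continuous_lebesgue[OF Gc] by blast
qed

text \<open>All that necessity uses of the embedding: a uniform bound for C^1 functions, free of
  essential suprema, of chosen gradients and of integrability questions. The constant depends on K
  only, so it applies to a whole family with bounded energy.\<close>

lemma continuously_embedded_C1_bound:
  assumes emb: "continuously_embedded (W_space a b p :: ('a::euclidean_space \<Rightarrow> real) set) (W_norm a b p) (Lp_space r) (Lp_norm r)"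
    and p: "1 \<le> p" and r: "1 \<le> r" and K: "0 \<le> K"
  shows "\<exists>C. \<forall>(u::'a \<Rightarrow> real) G. C1_pair UNIV u G \<longrightarrow> (\<forall>x. norm x powr a * \<bar>u x\<bar> \<le> 1) \<longrightarrow>
     (\<integral>\<^sup>+x. ennreal (norm x powr b * norm (G x) powr p) \<partial>lborel) \<le> ennreal K \<longrightarrow>
     (\<integral>\<^sup>+x. ennreal (\<bar>u x\<bar> powr r) \<partial>lborel) \<le> ennreal C"
proof -
  have sub: "(W_space a b p :: ('a \<Rightarrow> real) set) \<subseteq> Lp_space r"
    using emb unfolding continuously_embedded_def by (rule conjunct1)
  from emb[unfolded continuously_embedded_def, THEN conjunct2]
  obtain C where C: "\<forall>u\<in>(W_space a b p :: ('a \<Rightarrow> real) set). Lp_norm r u \<le> C * W_norm a b p u"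
    by (elim exE) (rule that)
  let ?c = "\<bar>C\<bar> * (1 + K powr (1 / p))"
  show ?thesis
  proof (intro exI[of _ "?c powr r"] allI impI)
    fix u :: "'a \<Rightarrow> real" and G
    assume u: "C1_pair UNIV u G" and ua: "\<forall>x. norm x powr a * \<bar>u x\<bar> \<le> 1"
      and GK: "(\<integral>\<^sup>+x. ennreal (norm x powr b * norm (G x) powr p) \<partial>lborel) \<le> ennreal K"
    note dg = C1_has_distributional_gradient[OF u, of "- {0}"]
    have [measurable]: "u \<in> borel_measurable borel" "G \<in> borel_measurable borel"
      using C1_pair_UNIV[OF u] by (auto intro: borel_measurable_continuous_onI)
    have mL: "f \<in> borel_measurable borel \<Longrightarrow> f \<in> borel_measurable lebesgue" for f :: "'a \<Rightarrow> 'c::topological_space"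
      by (rule measurable_completion) simp
    have Gw: "G \<in> weighted_Lp_space b p"
    proof -
      have "integrable lborel (\<lambda>x. norm x powr b * norm (G x) powr p)"
        by (rule integrableI_bounded) (use GK in \<open>auto intro: le_less_trans\<close>)
      then have "integrable lebesgue (\<lambda>x. norm x powr b * norm (G x) powr p)"
        by (subst integrable_completion) auto
      then show ?thesis
        by (simp add: weighted_Lp_space_def Lp_space_def weighted_norm_powr[OF p] mL)
    qed
    have ess: "esssup lebesgue (\<lambda>x. ereal (norm (norm x powr a * u x))) \<le> ereal 1"
      by (rule esssup_I) (use ua in \<open>auto simp: abs_mult intro!: mL\<close>)
    have Li: "(\<lambda>x. norm x powr a * u x) \<in> Linf_space"
      unfolding Linf_space_def using ess by (auto intro!: mL intro: le_less_trans)
    have Ln: "Linf_norm (\<lambda>x. norm x powr a * u x) \<le> 1"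
      unfolding Linf_norm_def using ess
      by (cases "esssup lebesgue (\<lambda>x. ereal (norm (norm x powr a * u x)))") auto
    have uW: "u \<in> W_space a b p"
      unfolding W_space_def using dg Gw Li by (auto simp: has_distributional_gradient_def)
    have E0: "0 \<le> weighted_Lp_norm b p G" by (simp add: weighted_Lp_norm_def Lp_norm_def)
    have "ennreal (weighted_Lp_norm b p G powr p) \<le> ennreal K"
      using weighted_Lp_nn_integral[OF Gw p] GK by (simp add: nn_integral_completion)
    then have "weighted_Lp_norm b p G powr p \<le> K" using K by simp
    then have "(weighted_Lp_norm b p G powr p) powr (1 / p) \<le> K powr (1 / p)" using p by (intro powr_mono2) auto
    then have En: "weighted_Lp_norm b p G \<le> K powr (1 / p)" using p E0 by (simp add: powr_powr)
    have Wn: "W_norm a b p u \<le> 1 + K powr (1 / p)"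
      unfolding W_norm_def distributional_gradient_weighted_norm[OF dg p] using Ln En by linarith
    have W0: "0 \<le> W_norm a b p u"
      unfolding W_norm_def distributional_gradient_weighted_norm[OF dg p] using Linf_norm_bound(2)[OF Li] E0 by linarith
    have "Lp_norm r u \<le> C * W_norm a b p u" by (rule bspec[OF C uW])
    also have "\<dots> \<le> \<bar>C\<bar> * W_norm a b p u" using W0 by (intro mult_right_mono) auto
    also have "\<dots> \<le> ?c" using Wn by (intro mult_left_mono) auto
    finally have Lc: "Lp_norm r u \<le> ?c" .
    have int: "integrable lebesgue (\<lambda>x. norm (u x) powr r)"
      using subsetD[OF sub uW] by (simp add: Lp_space_def)
    have I0: "0 \<le> integral\<^sup>L lebesgue (\<lambda>x. norm (u x) powr r)" by (rule integral_nonneg_AE) simp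
    have "integral\<^sup>L lebesgue (\<lambda>x. norm (u x) powr r) = Lp_norm r u powr r"
      using r I0 by (simp add: Lp_norm_def powr_powr)
    also have "\<dots> \<le> ?c powr r" using Lc r by (intro powr_mono2) (auto simp: Lp_norm_def)
    finally have "ennreal (integral\<^sup>L lebesgue (\<lambda>x. norm (u x) powr r)) \<le> ennreal (?c powr r)" by (rule ennreal_leI)
    then show "(\<integral>\<^sup>+x. ennreal (\<bar>u x\<bar> powr r) \<partial>lborel) \<le> ennreal (?c powr r)"
      using nn_integral_eq_integral[OF int] by (simp add: nn_integral_completion)
  qed
qed

subsection \<open>Necessity\<close>

lemma quadratic_C1_pair:
  "C1_pair UNIV (\<lambda>x::'a::euclidean_space. \<alpha> + \<beta> * ((x - c) \<bullet> (x - c))) (\<lambda>x. (2 * \<beta>) *\<^sub>R (x - c))"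
  unfolding C1_pair_def
proof (intro conjI ballI)
  fix x :: 'a
  show "((\<lambda>x. \<alpha> + \<beta> * ((x - c) \<bullet> (x - c))) has_derivative (\<lambda>v. ((2 * \<beta>) *\<^sub>R (x - c)) \<bullet> v)) (at x)"
  proof -
    have 1: "((\<lambda>x. x - c) has_derivative (\<lambda>v. v)) (at x)"
      using has_derivative_diff[OF has_derivative_ident has_derivative_const[of c]] by simp
    have 2: "((\<lambda>x. \<alpha> + \<beta> * ((x - c) \<bullet> (x - c))) has_derivative (\<lambda>v. 0 + \<beta> * ((x - c) \<bullet> v + v \<bullet> (x - c)))) (at x)"
      by (intro has_derivative_add has_derivative_const has_derivative_mult_right has_derivative_inner 1)
    have "(\<lambda>v. 0 + \<beta> * ((x - c) \<bullet> v + v \<bullet> (x - c))) = (\<lambda>v. ((2 * \<beta>) *\<^sub>R (x - c)) \<bullet> v)"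
      by (rule ext) (simp add: inner_commute[of _ "x - c"])
    with 2 show ?thesis by (simp only:)
  qed
next
  show "continuous_on UNIV (\<lambda>x. (2 * \<beta>) *\<^sub>R (x - c))" by (intro continuous_intros)
qed simp

text \<open>The squared positive part of the paraboloid 1 - |x-c|^2/\<delta>^2, which is C^1. The
  factor (-1/\<delta>^2) is kept in this shape to match the quadratic functions differentiated
  above.\<close>

definition bump :: "'a::euclidean_space \<Rightarrow> real \<Rightarrow> 'a \<Rightarrow> real" where
  "bump c \<delta> x = (max 0 (1 + (- 1 / \<delta>\<^sup>2) * ((x - c) \<bullet> (x - c))))\<^sup>2"

definition bump_grad :: "'a::euclidean_space \<Rightarrow> real \<Rightarrow> 'a \<Rightarrow> 'a" where
  "bump_grad c \<delta> x = (2 * max 0 (1 + (- 1 / \<delta>\<^sup>2) * ((x - c) \<bullet> (x - c)))) *\<^sub>R ((2 * (- 1 / \<delta>\<^sup>2)) *\<^sub>R (x - c))"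

lemma bump_C1_pair: "C1_pair UNIV (bump c \<delta>) (bump_grad c \<delta>)"
  unfolding bump_def[abs_def] bump_grad_def[abs_def]
  by (rule C1_pair_compose[OF quadratic_C1_pair max_square_deriv]) (intro continuous_intros)

lemma bump_bounds:
  fixes x :: "'a::euclidean_space"
  assumes "\<delta> > 0"
  shows "0 \<le> bump c \<delta> x" "bump c \<delta> x \<le> 1" "x \<notin> ball c \<delta> \<Longrightarrow> bump c \<delta> x = 0 \<and> bump_grad c \<delta> x = 0"
    "norm (bump_grad c \<delta> x) \<le> 4 / \<delta>" "x \<in> ball c (\<delta> / 2) \<Longrightarrow> 1 / 2 \<le> bump c \<delta> x"
proof -
  define y where "y = norm (x - c) / \<delta>"
  have y0: "0 \<le> y" using assms by (simp add: y_def)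
  have q: "1 + (- 1 / \<delta>\<^sup>2) * ((x - c) \<bullet> (x - c)) = 1 - y\<^sup>2"
    by (simp add: y_def power_divide power2_norm_eq_inner)
  have m: "0 \<le> max 0 (1 - y\<^sup>2)" "max 0 (1 - y\<^sup>2) \<le> 1" by auto
  show "0 \<le> bump c \<delta> x" by (simp add: bump_def)
  show "bump c \<delta> x \<le> 1" unfolding bump_def q using m by (intro power_le_one) auto
  have out: "max 0 (1 - y\<^sup>2) = 0" if "1 \<le> y" using that one_le_power[OF that, of 2] by simp
  show "bump c \<delta> x = 0 \<and> bump_grad c \<delta> x = 0" if "x \<notin> ball c \<delta>"
  proof -
    have "1 \<le> y" using that assms by (simp add: y_def dist_norm norm_minus_commute)
    then show ?thesis unfolding bump_def bump_grad_def q using out by simp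
  qed
  show "norm (bump_grad c \<delta> x) \<le> 4 / \<delta>"
  proof -
    have "norm (bump_grad c \<delta> x) = max 0 (1 - y\<^sup>2) * y * (4 / \<delta>)"
      unfolding bump_grad_def q using assms by (simp add: y_def power2_eq_square abs_mult)
    also have "\<dots> \<le> 1 * (4 / \<delta>)"
    proof (rule mult_right_mono)
      show "max 0 (1 - y\<^sup>2) * y \<le> 1"
      proof (cases "1 \<le> y")
        case True then show ?thesis using out by simp
      next
        case False
        then have "max 0 (1 - y\<^sup>2) * y \<le> 1 * 1" using m y0 by (intro mult_mono) auto
        then show ?thesis by simp
      qed
    qed (use assms in simp)
    finally show ?thesis by simp
  qed
  show "1 / 2 \<le> bump c \<delta> x" if "x \<in> ball c (\<delta> / 2)"
  proof -
    have "y \<le> 1 / 2" using that assms by (simp add: y_def dist_norm norm_minus_commute field_simps)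
    then have "y\<^sup>2 \<le> (1 / 2)\<^sup>2" using y0 by (intro power_mono) auto
    then have "3 / 4 \<le> 1 - y\<^sup>2" by (simp add: power_divide)
    then have "3 / 4 \<le> max 0 (1 - y\<^sup>2)" by (rule max.coboundedI2)
    then have "(3 / 4)\<^sup>2 \<le> (max 0 (1 - y\<^sup>2))\<^sup>2" by (rule power_mono) simp
    moreover have "(3 / 4)\<^sup>2 \<ge> (1 / 2 :: real)" by (simp add: power2_eq_square)
    ultimately show ?thesis unfolding bump_def q by linarith
  qed
qed

lemma C1_pair_sum:
  assumes "finite J" "\<And>j. j \<in> J \<Longrightarrow> C1_pair UNIV (u j) (G j)"
  shows "C1_pair UNIV (\<lambda>x. \<Sum>j\<in>J. h j * u j x) (\<lambda>x. \<Sum>j\<in>J. h j *\<^sub>R G j x)"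
  unfolding C1_pair_def
proof (intro conjI ballI)
  show "continuous_on UNIV (\<lambda>x. \<Sum>j\<in>J. h j *\<^sub>R G j x)"
    using assms by (intro continuous_intros) (auto simp: C1_pair_def)
  fix x
  have "((\<lambda>x. \<Sum>j\<in>J. h j * u j x) has_derivative (\<lambda>v. \<Sum>j\<in>J. h j * (G j x \<bullet> v))) (at x)"
    by (intro has_derivative_sum has_derivative_mult_right) (use assms in \<open>auto simp: C1_pair_def\<close>)
  then show "((\<lambda>x. \<Sum>j\<in>J. h j * u j x) has_derivative (\<lambda>v. (\<Sum>j\<in>J. h j *\<^sub>R G j x) \<bullet> v)) (at x)"
    by (simp add: inner_sum_left)
qed simp

text \<open>A common point has norm between 3/4 and 5/4 of each of the two radii. Their quotient is
  then below 5/3 < 2, and distinct powers of 2 differ by at least the factor 2.\<close>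

lemma dyadic_balls_disjoint:
  fixes c :: "nat \<Rightarrow> 'a::euclidean_space"
  assumes s: "s = 1 \<or> s = -1" and c: "\<And>j. norm (c j) = 2 powr (s * real j)"
    and \<delta>: "\<And>j. \<delta> j \<le> 2 powr (s * real j) / 4"
    and x: "x \<in> ball (c i) (\<delta> i)" "x \<in> ball (c j) (\<delta> j)"
  shows "i = j"
proof -
  have lt: "2 powr (s * real k) < 2 * 2 powr (s * real l)"
    if "x \<in> ball (c k) (\<delta> k)" "x \<in> ball (c l) (\<delta> l)" for k l
  proof -
    have "norm (c k - x) < 2 powr (s * real k) / 4" "norm (c l - x) < 2 powr (s * real l) / 4"
      using that \<delta>[of k] \<delta>[of l] by (auto simp: dist_norm)
    then have "2 powr (s * real k) - norm x < 2 powr (s * real k) / 4" "norm x - 2 powr (s * real l) < 2 powr (s * real l) / 4"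
      using norm_triangle_ineq2[of "c k" x] norm_triangle_ineq2[of x "c l"] c[of k] c[of l]
      by (auto simp: norm_minus_commute)
    moreover have "0 < 2 powr (s * real l)" by simp
    ultimately show ?thesis by linarith
  qed
  have lt2: "s * real k < 1 + s * real l" if "x \<in> ball (c k) (\<delta> k)" "x \<in> ball (c l) (\<delta> l)" for k l
  proof -
    have "2 powr (s * real k) < 2 powr (1 + s * real l)" using lt[OF that] by (simp add: powr_add)
    then show ?thesis by (simp only: powr_less_cancel_iff one_less_numeral_iff semiring_norm)
  qed
  from lt2[OF x] lt2[OF x(2,1)] s show ?thesis by auto
qed

lemma dyadic_ball_norm_powr:
  fixes c :: "'a::euclidean_space"
  assumes "norm c = R" "0 < R" "\<delta> \<le> R / 4" "x \<in> ball c \<delta>"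
  shows "norm x powr d \<le> 2 powr \<bar>d\<bar> * R powr d"
proof -
  have "norm (c - x) < R / 4" using assms by (auto simp: dist_norm)
  then have "R - norm x < R / 4" "norm x - R < R / 4"
    using norm_triangle_ineq2[of c x] norm_triangle_ineq2[of x c] assms(1) by (auto simp: norm_minus_commute)
  then show ?thesis using assms(2) by (intro powr_abs_le_of_ratio) auto
qed

text \<open>Superposing bumps of height \<open>h\<^sub>j\<close> and width \<open>\<delta>\<^sub>j\<close> located in the dyadic shells of radius
  \<open>2\<^sup>j\<close> (for \<open>s = 1\<close>) or \<open>2\<^sup>-\<^sup>j\<close> (for \<open>s = -1\<close>) turns the embedding into an implication between series.\<close>

lemma summable_of_embedding:
  assumes emb: "continuously_embedded (W_space a b p :: ('a::euclidean_space \<Rightarrow> real) set) (W_norm a b p) (Lp_space r) (Lp_norm r)"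
    and p: "1 \<le> p" and r: "1 \<le> r" and s: "s = 1 \<or> s = -1"
    and h: "\<And>j. 0 < h j" and \<delta>: "\<And>j. 0 < \<delta> j" "\<And>j. \<delta> j \<le> 2 powr (s * real j) / 4"
    and ha: "\<And>j. 2 powr \<bar>a\<bar> * (2 powr (s * real j)) powr a * h j \<le> 1"
    and sm: "summable (\<lambda>j. (2 powr (s * real j)) powr b * h j powr p * \<delta> j powr (real DIM('a) - p))"
  shows "summable (\<lambda>j. h j powr r * \<delta> j powr real DIM('a))"
proof -
  let ?N = "DIM('a)"
  let ?V = "unit_ball_vol (real ?N)"
  have V: "?V > 0" by simp
  define R where "R j = 2 powr (s * real j)" for j :: nat
  have R: "0 < R j" for j by (simp add: R_def)
  obtain e :: 'a where e: "e \<in> Basis" using nonempty_Basis by blast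
  define c where "c j = R j *\<^sub>R e" for j
  have c: "norm (c j) = R j" for j using e R[of j] by (simp add: c_def)
  define t where "t j = R j powr b * h j powr p * \<delta> j powr (real ?N - p)" for j
  have t0: "0 \<le> t j" for j by (simp add: t_def)
  have st: "summable t" using sm by (simp add: t_def[abs_def] R_def)
  \<comment> \<open>The energy of any finite superposition, whatever the number of bumps: on the
    j-th ball the gradient is at most 4 h_j/\<delta>_j, and the weight is comparable to its value at
    the centre. The embedding constant can thus be fixed before that number.\<close>
  let ?K = "2 powr \<bar>b\<bar> * 4 powr p * ?V * suminf t"
  have K0: "0 \<le> ?K" using V t0 by (intro mult_nonneg_nonneg suminf_nonneg st) auto
  obtain C where C: "\<And>(u::'a \<Rightarrow> real) G. C1_pair UNIV u G \<Longrightarrow> (\<And>x. norm x powr a * \<bar>u x\<bar> \<le> 1) \<Longrightarrow>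
     (\<integral>\<^sup>+x. ennreal (norm x powr b * norm (G x) powr p) \<partial>lborel) \<le> ennreal ?K \<Longrightarrow>
     (\<integral>\<^sup>+x. ennreal (\<bar>u x\<bar> powr r) \<partial>lborel) \<le> ennreal C"
    using continuously_embedded_C1_bound[OF emb p r K0] by blast
  have one: "i = j" if "x \<in> ball (c i) (\<delta> i)" "x \<in> ball (c j) (\<delta> j)" for i j x
    by (rule dyadic_balls_disjoint[OF s, of c \<delta> x i j]) (use c \<delta> that in \<open>auto simp: R_def\<close>)
  \<comment> \<open>On the ball of half the radius each bump is at least 1/2, which gives the halves
    of height and width.\<close>
  have partial: "(\<Sum>j<J. (h j / 2) powr r * (?V * (\<delta> j / 2) ^ ?N)) \<le> \<bar>C\<bar>" for J
  proof -
    define u where "u x = (\<Sum>j<J. h j * bump (c j) (\<delta> j) x)" for x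
    define G where "G x = (\<Sum>j<J. h j *\<^sub>R bump_grad (c j) (\<delta> j) x)" for x
    have C1: "C1_pair UNIV u G" unfolding u_def[abs_def] G_def[abs_def]
      by (rule C1_pair_sum) (auto intro: bump_C1_pair)
    have single: "u x = h j * bump (c j) (\<delta> j) x \<and> G x = h j *\<^sub>R bump_grad (c j) (\<delta> j) x"
      if j: "j < J" "x \<in> ball (c j) (\<delta> j)" for x j
    proof -
      have z: "bump (c i) (\<delta> i) x = 0 \<and> bump_grad (c i) (\<delta> i) x = 0" if "i \<noteq> j" for i
        using one[OF _ j(2), of i] that by (intro bump_bounds(3) \<delta>) blast
      have "u x = (\<Sum>i\<in>{j}. h i * bump (c i) (\<delta> i) x)" unfolding u_def
        by (rule sum.mono_neutral_right) (use j z in auto)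
      moreover have "G x = (\<Sum>i\<in>{j}. h i *\<^sub>R bump_grad (c i) (\<delta> i) x)" unfolding G_def
        by (rule sum.mono_neutral_right) (use j z in auto)
      ultimately show ?thesis by simp
    qed
    have none: "u x = 0 \<and> G x = 0" if "\<And>j. j < J \<Longrightarrow> x \<notin> ball (c j) (\<delta> j)" for x
      using bump_bounds(3)[OF \<delta>(1) that] by (simp add: u_def G_def)
    have 1: "norm x powr a * \<bar>u x\<bar> \<le> 1" for x
    proof (cases "\<exists>j<J. x \<in> ball (c j) (\<delta> j)")
      case True
      then obtain j where j: "j < J" "x \<in> ball (c j) (\<delta> j)" by blast
      have "norm x powr a \<le> 2 powr \<bar>a\<bar> * R j powr a"
        using dyadic_ball_norm_powr[OF c R _ j(2)] \<delta>(2)[of j] by (simp add: R_def)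
      moreover have "\<bar>u x\<bar> \<le> h j"
        using single[OF j] bump_bounds(1,2)[OF \<delta>(1)[of j], of "c j" x] h[of j]
        by (auto simp: abs_mult mult_left_le less_imp_le)
      ultimately have "norm x powr a * \<bar>u x\<bar> \<le> (2 powr \<bar>a\<bar> * R j powr a) * h j"
        by (intro mult_mono) auto
      then show ?thesis using ha[of j] by (simp add: R_def)
    next
      case False then show ?thesis using none[of x] by auto
    qed
    have 2: "(\<integral>\<^sup>+x. ennreal (norm x powr b * norm (G x) powr p) \<partial>lborel) \<le> ennreal ?K"
    proof -
      let ?g = "\<lambda>j. 2 powr \<bar>b\<bar> * R j powr b * (h j * (4 / \<delta> j)) powr p"
      have "(\<integral>\<^sup>+x. ennreal (norm x powr b * norm (G x) powr p) \<partial>lborel)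
        \<le> (\<integral>\<^sup>+x. (\<Sum>j<J. ennreal (?g j) * indicator (ball (c j) (\<delta> j)) x) \<partial>lborel)"
      proof (rule nn_integral_mono)
        fix x
        show "ennreal (norm x powr b * norm (G x) powr p) \<le> (\<Sum>j<J. ennreal (?g j) * indicator (ball (c j) (\<delta> j)) x)"
        proof (cases "\<exists>j<J. x \<in> ball (c j) (\<delta> j)")
          case True
          then obtain j where j: "j < J" "x \<in> ball (c j) (\<delta> j)" by blast
          have "norm (G x) \<le> h j * (4 / \<delta> j)"
            using single[OF j] bump_bounds(4)[OF \<delta>(1)[of j], of "c j" x] h[of j]
            by (simp add: mult_left_mono less_imp_le del: times_divide_eq_right)
          then have "norm (G x) powr p \<le> (h j * (4 / \<delta> j)) powr p" using p by (intro powr_mono2) auto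
          moreover have "norm x powr b \<le> 2 powr \<bar>b\<bar> * R j powr b"
            using dyadic_ball_norm_powr[OF c R _ j(2)] \<delta>(2)[of j] by (simp add: R_def)
          ultimately have "norm x powr b * norm (G x) powr p \<le> ?g j" by (intro mult_mono) auto
          then have "ennreal (norm x powr b * norm (G x) powr p) \<le> ennreal (?g j) * indicator (ball (c j) (\<delta> j)) x"
            using j(2) by (simp add: ennreal_leI)
          also have "\<dots> \<le> (\<Sum>j<J. ennreal (?g j) * indicator (ball (c j) (\<delta> j)) x)"
            by (rule member_le_sum) (use j in auto)
          finally show ?thesis .
        next
          case False
          then have "norm (G x) = 0" using none[of x] by auto
          then show ?thesis by simp
        qed
      qed
      also have "\<dots> = (\<Sum>j<J. \<integral>\<^sup>+x. ennreal (?g j) * indicator (ball (c j) (\<delta> j)) x \<partial>lborel)"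
        by (rule nn_integral_sum) (intro borel_measurable_times_ennreal borel_measurable_const borel_measurable_indicator, simp)
      also have "\<dots> = (\<Sum>j<J. ennreal (2 powr \<bar>b\<bar> * 4 powr p * ?V * t j))"
      proof (rule sum.cong[OF refl])
        fix j
        have "(\<integral>\<^sup>+x. ennreal (?g j) * indicator (ball (c j) (\<delta> j)) x \<partial>lborel) = ennreal (?g j) * emeasure lborel (ball (c j) (\<delta> j))"
          by (rule nn_integral_cmult_indicator) simp
        also have "\<dots> = ennreal (?g j * (?V * \<delta> j ^ ?N))"
          using \<delta>(1)[of j] V by (subst emeasure_ball) (auto simp: ennreal_mult[symmetric])
        also have "?g j * (?V * \<delta> j ^ ?N) = 2 powr \<bar>b\<bar> * 4 powr p * ?V * t j"
        proof -
          have "(h j * (4 / \<delta> j)) powr p = h j powr p * (4 powr p / \<delta> j powr p)"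
            using h[of j] \<delta>(1)[of j] by (subst powr_mult) (auto simp: powr_divide)
          moreover have "\<delta> j powr (real ?N - p) = \<delta> j ^ ?N / \<delta> j powr p"
            using \<delta>(1)[of j] by (simp add: powr_diff powr_realpow)
          ultimately show ?thesis by (simp add: t_def)
        qed
        finally show "(\<integral>\<^sup>+x. ennreal (?g j) * indicator (ball (c j) (\<delta> j)) x \<partial>lborel) = ennreal (2 powr \<bar>b\<bar> * 4 powr p * ?V * t j)" .
      qed
      also have "\<dots> = ennreal (2 powr \<bar>b\<bar> * 4 powr p * ?V * (\<Sum>j<J. t j))"
        using V t0 by (subst sum_ennreal) (auto simp: sum_distrib_left)
      also have "\<dots> \<le> ennreal ?K"
        using V t0 by (intro ennreal_leI mult_left_mono sum_le_suminf[OF st]) auto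
      finally show ?thesis .
    qed
    have "ennreal (\<Sum>j<J. (h j / 2) powr r * (?V * (\<delta> j / 2) ^ ?N)) = (\<Sum>j<J. ennreal ((h j / 2) powr r) * emeasure lborel (ball (c j) (\<delta> j / 2)))"
    proof -
      have "ennreal ((h j / 2) powr r * (?V * (\<delta> j / 2) ^ ?N)) = ennreal ((h j / 2) powr r) * emeasure lborel (ball (c j) (\<delta> j / 2))" for j
        using \<delta>(1)[of j] V by (subst emeasure_ball) (auto simp: ennreal_mult[symmetric])
      moreover have "0 \<le> (h j / 2) powr r * (?V * (\<delta> j / 2) ^ ?N)" for j using \<delta>(1)[of j] V by simp
      ultimately show ?thesis by (subst sum_ennreal[symmetric]) auto
    qed
    also have "\<dots> = (\<Sum>j<J. \<integral>\<^sup>+x. ennreal ((h j / 2) powr r) * indicator (ball (c j) (\<delta> j / 2)) x \<partial>lborel)"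
      by (intro sum.cong refl nn_integral_cmult_indicator[symmetric]) simp
    also have "\<dots> = (\<integral>\<^sup>+x. (\<Sum>j<J. ennreal ((h j / 2) powr r) * indicator (ball (c j) (\<delta> j / 2)) x) \<partial>lborel)"
      by (rule nn_integral_sum[symmetric]) (intro borel_measurable_times_ennreal borel_measurable_const borel_measurable_indicator, simp)
    also have "\<dots> \<le> (\<integral>\<^sup>+x. ennreal (\<bar>u x\<bar> powr r) \<partial>lborel)"
    proof (rule nn_integral_mono)
      fix x
      have hb: "ball (c j) (\<delta> j / 2) \<subseteq> ball (c j) (\<delta> j)" for j using \<delta>(1)[of j] by (intro subset_ball) simp
      show "(\<Sum>j<J. ennreal ((h j / 2) powr r) * indicator (ball (c j) (\<delta> j / 2)) x) \<le> ennreal (\<bar>u x\<bar> powr r)"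
      proof (cases "\<exists>j<J. x \<in> ball (c j) (\<delta> j / 2)")
        case True
        then obtain j where j: "j < J" "x \<in> ball (c j) (\<delta> j / 2)" by blast
        then have jb: "x \<in> ball (c j) (\<delta> j)" using hb by blast
        have z: "x \<notin> ball (c i) (\<delta> i / 2)" if "i \<noteq> j" for i using one[OF _ jb, of i] hb[of i] that by blast
        have "(\<Sum>j<J. ennreal ((h j / 2) powr r) * indicator (ball (c j) (\<delta> j / 2)) x) = (\<Sum>j\<in>{j}. ennreal ((h j / 2) powr r) * indicator (ball (c j) (\<delta> j / 2)) x)"
          by (rule sum.mono_neutral_right) (use j z in auto)
        also have "\<dots> = ennreal ((h j / 2) powr r)" using j(2) by simp
        also have "\<dots> \<le> ennreal (\<bar>u x\<bar> powr r)"
        proof -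
          have "h j * (1 / 2) \<le> h j * bump (c j) (\<delta> j) x"
            using bump_bounds(5)[OF \<delta>(1) j(2)] h[of j] by (intro mult_left_mono) auto
          then have "h j / 2 \<le> \<bar>u x\<bar>" using single[OF j(1) jb] by simp
          then show ?thesis using r h[of j] by (intro ennreal_leI powr_mono2) auto
        qed
        finally show ?thesis .
      next
        case False
        then have "(\<Sum>j<J. ennreal ((h j / 2) powr r) * indicator (ball (c j) (\<delta> j / 2)) x) = 0"
          by (intro sum.neutral ballI) auto
        then show ?thesis by (simp only: zero_le)
      qed
    qed
    also have "\<dots> \<le> ennreal C" by (rule C[OF C1 1 2])
    also have "\<dots> \<le> ennreal \<bar>C\<bar>" by (rule ennreal_leI) simp
    finally show ?thesis by (subst (asm) ennreal_le_iff) auto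
  qed
  show ?thesis
  proof (rule summableI_nonneg_bounded)
    show "0 \<le> h j powr r * \<delta> j powr real ?N" for j by simp
    fix J
    let ?m = "(1 / 2) powr r * ?V * (1 / 2) ^ ?N"
    have m: "?m > 0" using V by simp
    have "(\<Sum>j<J. h j powr r * \<delta> j powr real ?N) * ?m = (\<Sum>j<J. (h j / 2) powr r * (?V * (\<delta> j / 2) ^ ?N))"
      unfolding sum_distrib_right
    proof (rule sum.cong[OF refl])
      fix j
      have "(h j / 2) powr r = h j powr r * (1 / 2) powr r" using h[of j] by (subst powr_mult[symmetric]) auto
      moreover have "(\<delta> j / 2) ^ ?N = \<delta> j powr real ?N * (1 / 2) ^ ?N"
        using \<delta>(1)[of j] by (simp add: powr_realpow power_divide)
      ultimately show "h j powr r * \<delta> j powr real ?N * ?m = (h j / 2) powr r * (?V * (\<delta> j / 2) ^ ?N)" by simp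
    qed
    also have "\<dots> \<le> \<bar>C\<bar>" by (rule partial)
    finally show "(\<Sum>j<J. h j powr r * \<delta> j powr real ?N) \<le> \<bar>C\<bar> / ?m"
      using m by (simp only: pos_le_divide_eq)
  qed
qed

section \<open>Series that exclude the remaining exponents\<close>

lemma summable_dyadic_powr:
  assumes "s * e < 0"
  shows "summable (\<lambda>j. (2 powr (s * real j)) powr e)"
proof -
  have "2 powr (s * e) < 2 powr 0" using assms by (intro powr_less_mono) auto
  then have "summable (\<lambda>j. (2 powr (s * e)) ^ j)" by (intro summable_geometric) simp
  moreover have "(2 powr (s * real j)) powr e = (2 powr (s * e)) ^ j" for j :: nat
    by (simp add: powr_powr powr_realpow[symmetric] mult_ac)
  ultimately show ?thesis by simp
qed

lemma dyadic_powr_le_1: "s * e \<le> 0 \<Longrightarrow> (2 powr (s * real j)) powr e \<le> 1"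
proof -
  assume "s * e \<le> 0"
  then have "real j * (s * e) \<le> 0" by (rule mult_nonneg_nonpos[OF of_nat_0_le_iff])
  then have "2 powr (real j * (s * e)) \<le> 2 powr 0" by (intro powr_mono) auto
  then show ?thesis by (simp add: powr_powr mult_ac)
qed

lemma mult_regroup3:
  fixes B H D :: real
  assumes "H = c1 * x * e" "D = c2 * y" "B * x * y = Z"
  shows "B * H * D = c1 * c2 * (Z * e)"
  unfolding assms(1,2) assms(3)[symmetric] by (simp only: mult_ac)

lemma mult_regroup2:
  fixes H D :: real
  assumes "H = c1 * x * e" "D = c2 * y" "x * y = 1"
  shows "H * D = c1 * c2 * e"
proof -
  have "H * D = c1 * c2 * e * (x * y)" unfolding assms(1,2) by (simp only: mult_ac)
  then show ?thesis unfolding assms(3) by simp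
qed

text \<open>The heights are such that the integral of |u|^r becomes the harmonic series. The energy
  series has the terms R_j^(b-bc) (j+1)^(-p/r): it converges geometrically when s(b - bc) < 0, and
  for b = bc it converges when r < p, which is why the inequalities are strict in that range. The
  hypothesis on a keeps the bumps below |x|^(-a) in the shells going to infinity (s = 1) or to the
  origin (s = -1).\<close>

lemma embedding_necessary_critical:
  assumes emb: "continuously_embedded (W_space a b p :: ('a::euclidean_space \<Rightarrow> real) set) (W_norm a b p) (Lp_space r) (Lp_norm r)"
    and p: "1 \<le> p" and r: "1 \<le> r" and s: "s = 1 \<or> s = -1"
    and a: "s * (a - real DIM('a) / r) \<le> 0"
  shows "\<not> (s * (b - real DIM('a) * p * (1 / real DIM('a) + 1 / r - 1 / p)) < 0 \<or>
    b = real DIM('a) * p * (1 / real DIM('a) + 1 / r - 1 / p) \<and> r < p)"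
proof
  let ?N = "real DIM('a)"
  define bc where "bc = ?N * p * (1 / ?N + 1 / r - 1 / p)"
  assume "s * (b - ?N * p * (1 / ?N + 1 / r - 1 / p)) < 0 \<or> b = ?N * p * (1 / ?N + 1 / r - 1 / p) \<and> r < p"
  then have b: "s * (b - bc) < 0 \<or> b = bc \<and> r < p" by (simp only: bc_def)
  define R where "R j = 2 powr (s * real j)" for j :: nat
  have R: "0 < R j" for j by (simp add: R_def)
  \<comment> \<open>Compensates the variation of |x|^a over one shell.\<close>
  define \<kappa> where "\<kappa> = 2 powr - \<bar>a\<bar>"
  have \<kappa>: "0 < \<kappa>" "2 powr \<bar>a\<bar> * \<kappa> = 1" by (simp_all add: \<kappa>_def powr_minus)
  define h where "h j = \<kappa> * R j powr (- (?N / r)) * real (Suc j) powr (- (1 / r))" for j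
  define \<delta> where "\<delta> j = R j / 4" for j
  have h: "0 < h j" for j using \<kappa> R[of j] by (simp add: h_def del: of_nat_Suc)
  have \<delta>: "0 < \<delta> j" "\<delta> j \<le> R j / 4" for j using R[of j] by (auto simp: \<delta>_def)
  have ha: "2 powr \<bar>a\<bar> * R j powr a * h j \<le> 1" for j
  proof -
    have "2 powr \<bar>a\<bar> * R j powr a * h j = (2 powr \<bar>a\<bar> * \<kappa>) * (R j powr a * R j powr (- (?N / r))) * real (Suc j) powr (- (1 / r))"
      unfolding h_def by (simp only: mult_ac)
    also have "\<dots> = R j powr (a - ?N / r) * real (Suc j) powr (- (1 / r))"
      unfolding \<kappa>(2) by (simp add: powr_add[symmetric] del: of_nat_Suc)
    also have "\<dots> \<le> 1 * 1"
    proof (rule mult_mono)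
      show "R j powr (a - ?N / r) \<le> 1" unfolding R_def by (rule dyadic_powr_le_1[OF a])
      have "real (Suc j) powr (- (1 / r)) \<le> real (Suc j) powr 0" using r by (intro powr_mono) auto
      then show "real (Suc j) powr (- (1 / r)) \<le> 1" by (simp del: of_nat_Suc)
    qed auto
    finally show ?thesis by simp
  qed
  have bce: "bc = p + ?N * p / r - ?N"
  proof -
    have "bc = p * (?N * (1 / ?N)) + ?N * p * (1 / r) - ?N * (p * (1 / p))"
      unfolding bc_def by (simp only: ring_distribs mult_ac)
    then show ?thesis using p by simp
  qed
  have grad: "R j powr b * h j powr p * \<delta> j powr (?N - p) = \<kappa> powr p * (1 / 4) powr (?N - p) * (R j powr (b - bc) * real (Suc j) powr (- (p / r)))" for j
  proof -
    have "h j powr p = \<kappa> powr p * R j powr (- (?N / r) * p) * real (Suc j) powr (- (p / r))"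
      unfolding h_def using \<kappa> R[of j] by (simp add: powr_mult powr_powr del: of_nat_Suc)
    moreover have "\<delta> j powr (?N - p) = (1 / 4) powr (?N - p) * R j powr (?N - p)"
      unfolding \<delta>_def using R[of j] by (subst powr_mult[symmetric]) auto
    moreover have "R j powr b * R j powr (- (?N / r) * p) * R j powr (?N - p) = R j powr (b - bc)"
      unfolding bce by (simp only: powr_add[symmetric]) (simp add: algebra_simps)
    ultimately show ?thesis by (rule mult_regroup3)
  qed
  have zeta: "summable (\<lambda>j. real (Suc j) powr e) \<longleftrightarrow> e < -1" for e
    using summable_Suc_iff[of "\<lambda>n. real n powr e"] summable_real_powr_iff[of e] by simp
  have "summable (\<lambda>j. R j powr (b - bc) * real (Suc j) powr (- (p / r)))"
    using b
  proof
    assume "s * (b - bc) < 0"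
    then have "summable (\<lambda>j. R j powr (b - bc))" unfolding R_def by (rule summable_dyadic_powr)
    then show ?thesis
    proof (rule summable_comparison_test')
      fix j :: nat
      have "real (Suc j) powr (- (p / r)) \<le> real (Suc j) powr 0" using p r by (intro powr_mono) auto
      then have "real (Suc j) powr (- (p / r)) \<le> 1" by (simp del: of_nat_Suc)
      then have "R j powr (b - bc) * real (Suc j) powr (- (p / r)) \<le> R j powr (b - bc) * 1" by (intro mult_left_mono) auto
      then show "norm (R j powr (b - bc) * real (Suc j) powr (- (p / r))) \<le> R j powr (b - bc)"
        by (simp add: abs_mult del: of_nat_Suc)
    qed
  next
    assume *: "b = bc \<and> r < p"
    have "R j powr (b - bc) = 1" for j using * R[of j] by simp
    moreover have "- (p / r) < -1" using * r by (simp add: less_divide_eq)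
    ultimately show ?thesis using zeta[of "- (p / r)"] by simp
  qed
  then have sm: "summable (\<lambda>j. R j powr b * h j powr p * \<delta> j powr (?N - p))"
    unfolding grad by (rule summable_mult)
  have "summable (\<lambda>j. h j powr r * \<delta> j powr ?N)"
  proof (rule summable_of_embedding[OF emb p r s, where h=h and \<delta>=\<delta>])
    show "0 < h j" for j by (rule h)
    show "0 < \<delta> j" for j by (rule \<delta>(1))
    show "\<delta> j \<le> 2 powr (s * real j) / 4" for j using \<delta>(2)[of j] by (simp only: R_def)
    show "2 powr \<bar>a\<bar> * (2 powr (s * real j)) powr a * h j \<le> 1" for j using ha[of j] by (simp only: R_def)
    show "summable (\<lambda>j. (2 powr (s * real j)) powr b * h j powr p * \<delta> j powr (?N - p))"
      using sm by (simp only: R_def)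
  qed
  moreover have "h j powr r * \<delta> j powr ?N = \<kappa> powr r * (1 / 4) powr ?N * real (Suc j) powr -1" for j
  proof -
    have "h j powr r = \<kappa> powr r * R j powr (- ?N) * real (Suc j) powr -1"
      unfolding h_def using \<kappa> R[of j] r by (simp add: powr_mult powr_powr del: of_nat_Suc)
    moreover have "\<delta> j powr ?N = (1 / 4) powr ?N * R j powr ?N"
      unfolding \<delta>_def using R[of j] by (subst powr_mult[symmetric]) auto
    moreover have "R j powr (- ?N) * R j powr ?N = 1"
      using R[of j] by (simp add: powr_add[symmetric])
    ultimately show ?thesis by (rule mult_regroup2)
  qed
  ultimately have "summable (\<lambda>j. \<kappa> powr r * (1 / 4) powr ?N * real (Suc j) powr -1)" by simp
  then have "summable (\<lambda>j. real (Suc j) powr -1)"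
    using \<kappa> by (subst (asm) summable_cmult_iff) auto
  then show False using zeta[of "-1"] by simp
qed

text \<open>The bumps have the maximal height and the width that makes each of them contribute the
  same amount to the integral of |u|^r, so that series diverges, while the energy series is
  geometric with exponent b - b3. The hypothesis on a is what makes the width R^(ar/N) at most
  R.\<close>

lemma embedding_necessary_concentration:
  assumes emb: "continuously_embedded (W_space a b p :: ('a::euclidean_space \<Rightarrow> real) set) (W_norm a b p) (Lp_space r) (Lp_norm r)"
    and p: "1 \<le> p" and r: "1 \<le> r" and s: "s = 1 \<or> s = -1"
    and a: "s * (a - real DIM('a) / r) \<le> 0"
  shows "\<not> s * (b - a * r * p * (1 / real DIM('a) + 1 / r - 1 / p)) < 0"
proof
  let ?N = "real DIM('a)"
  define b3 where "b3 = a * r * p * (1 / ?N + 1 / r - 1 / p)"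
  assume "s * (b - a * r * p * (1 / ?N + 1 / r - 1 / p)) < 0"
  then have b: "s * (b - b3) < 0" by (simp only: b3_def)
  define R where "R j = 2 powr (s * real j)" for j :: nat
  have R: "0 < R j" for j by (simp add: R_def)
  define \<kappa> where "\<kappa> = 2 powr - \<bar>a\<bar>"
  have \<kappa>: "0 < \<kappa>" "2 powr \<bar>a\<bar> * \<kappa> = 1" by (simp_all add: \<kappa>_def powr_minus)
  define h where "h j = \<kappa> * R j powr (- a)" for j
  define \<delta> where "\<delta> j = R j powr (a * r / ?N) / 4" for j
  have h: "0 < h j" for j using \<kappa> R[of j] by (simp add: h_def)
  have \<delta>: "0 < \<delta> j" "\<delta> j \<le> R j / 4" for j
  proof -
    show "0 < \<delta> j" using R[of j] by (simp add: \<delta>_def)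
    have "s * (a * r / ?N - 1) = (s * (a - ?N / r)) * (r / ?N)" using r by (simp add: field_simps)
    also have "\<dots> \<le> 0" by (rule mult_nonpos_nonneg[OF a]) (use r in simp)
    finally have "R j powr (a * r / ?N - 1) \<le> 1" unfolding R_def by (rule dyadic_powr_le_1)
    then have "R j powr (a * r / ?N - 1) * R j \<le> 1 * R j" using R[of j] by (intro mult_right_mono) auto
    moreover have "R j powr (a * r / ?N - 1) * R j = R j powr (a * r / ?N)"
      using R[of j] by (simp add: powr_diff)
    ultimately show "\<delta> j \<le> R j / 4" by (simp add: \<delta>_def)
  qed
  have ha: "2 powr \<bar>a\<bar> * R j powr a * h j \<le> 1" for j
  proof -
    have "2 powr \<bar>a\<bar> * R j powr a * h j = (2 powr \<bar>a\<bar> * \<kappa>) * (R j powr a * R j powr (- a))"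
      unfolding h_def by (simp only: mult_ac)
    then show ?thesis unfolding \<kappa>(2) using R[of j] by (simp add: powr_add[symmetric])
  qed
  have b3e: "b3 = a * r * p / ?N + a * p - a * r"
  proof -
    have "b3 = a * r * p * (1 / ?N) + a * p * (r * (1 / r)) - a * r * (p * (1 / p))"
      unfolding b3_def by (simp only: ring_distribs mult_ac)
    then show ?thesis using p r by simp
  qed
  have grad: "R j powr b * h j powr p * \<delta> j powr (?N - p) = \<kappa> powr p * (1 / 4) powr (?N - p) * R j powr (b - b3)" for j
  proof -
    have "h j powr p = \<kappa> powr p * R j powr (- a * p)"
      unfolding h_def using \<kappa> R[of j] by (simp add: powr_mult powr_powr)
    moreover have "\<delta> j powr (?N - p) = (1 / 4) powr (?N - p) * R j powr (a * r / ?N * (?N - p))"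
      unfolding \<delta>_def powr_powr[symmetric] using R[of j] by (subst powr_mult[symmetric]) auto
    moreover have "R j powr b * R j powr (- a * p) * R j powr (a * r / ?N * (?N - p)) = R j powr (b - b3)"
    proof -
      have "a * r / ?N * (?N - p) = a * r - a * r * p / ?N" by (simp add: field_simps)
      then have "b + - a * p + a * r / ?N * (?N - p) = b - b3" unfolding b3e by simp
      then show ?thesis by (simp only: powr_add[symmetric])
    qed
    ultimately show ?thesis by (rule mult_regroup3[where e=1, unfolded mult_1_right])
  qed
  have "summable (\<lambda>j. R j powr (b - b3))" unfolding R_def by (rule summable_dyadic_powr[OF b])
  then have sm: "summable (\<lambda>j. R j powr b * h j powr p * \<delta> j powr (?N - p))"
    unfolding grad by (rule summable_mult)
  have "summable (\<lambda>j. h j powr r * \<delta> j powr ?N)"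
  proof (rule summable_of_embedding[OF emb p r s, where h=h and \<delta>=\<delta>])
    show "0 < h j" for j by (rule h)
    show "0 < \<delta> j" for j by (rule \<delta>(1))
    show "\<delta> j \<le> 2 powr (s * real j) / 4" for j using \<delta>(2)[of j] by (simp only: R_def)
    show "2 powr \<bar>a\<bar> * (2 powr (s * real j)) powr a * h j \<le> 1" for j using ha[of j] by (simp only: R_def)
    show "summable (\<lambda>j. (2 powr (s * real j)) powr b * h j powr p * \<delta> j powr (?N - p))"
      using sm by (simp only: R_def)
  qed
  moreover have "h j powr r * \<delta> j powr ?N = \<kappa> powr r * (1 / 4) powr ?N" for j
  proof -
    have "h j powr r = \<kappa> powr r * R j powr (- (a * r))"
      unfolding h_def using \<kappa> R[of j] by (simp add: powr_mult powr_powr)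
    moreover have "\<delta> j powr ?N = (1 / 4) powr ?N * R j powr (a * r)"
    proof -
      have "\<delta> j powr ?N = (1 / 4) powr ?N * (R j powr (a * r / ?N)) powr ?N"
        unfolding \<delta>_def using R[of j] by (subst powr_mult[symmetric]) auto
      then show ?thesis by (simp add: powr_powr)
    qed
    moreover have "R j powr (- (a * r)) * R j powr (a * r) = 1"
      using R[of j] by (simp add: powr_add[symmetric])
    ultimately show ?thesis by (rule mult_regroup2[where e=1, unfolded mult_1_right])
  qed
  ultimately have "summable (\<lambda>j::nat. \<kappa> powr r * (1 / 4) powr ?N)" by simp
  then show False using \<kappa> by (simp add: summable_const_iff)
qed

lemma embedding_necessary_positive:
  assumes emb: "continuously_embedded (W_space a b p :: ('a::euclidean_space \<Rightarrow> real) set) (W_norm a b p) (Lp_space r) (Lp_norm r)"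
    and p: "1 \<le> p" and r: "1 \<le> r"
  shows "a > 0"
proof (rule ccontr)
  assume "\<not> a > 0"
  then have a: "a \<le> 0" by simp
  \<comment> \<open>Applied to y = |x|^2, this profile makes u rise from 0 at |x| = 1 to 1 at |x| =
    2, so that the gradient lives in a shell away from the origin and u is 1 on a set of infinite
    measure.\<close>
  define A where "A y = max 0 ((4 - y) / 3)" for y :: real
  define F where "F y = (max 0 (1 - (A y)\<^sup>2))\<^sup>2" for y
  define F' where "F' y = (2 * max 0 (1 - (A y)\<^sup>2)) * (0 - (2 * A y) * (- 1 / 3))" for y
  have dF: "(F has_real_derivative F' y) (at y)" for y
  proof -
    have 1: "((\<lambda>y. (4 - y) / 3) has_real_derivative (- 1 / 3)) (at y)"
      by (auto intro!: derivative_eq_intros)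
    from max_square_deriv_compose[OF DERIV_diff[OF DERIV_const[of 1] max_square_deriv_compose[OF 1]]]
    show ?thesis unfolding F_def[abs_def] F'_def A_def .
  qed
  have cF: "continuous_on UNIV F'" unfolding F'_def A_def by (intro continuous_intros) auto
  define u where "u x = F (0 + 1 * ((x - 0) \<bullet> (x - 0)))" for x :: 'a
  define G where "G x = F' (0 + 1 * ((x - 0) \<bullet> (x - 0))) *\<^sub>R ((2 * 1) *\<^sub>R (x - 0))" for x :: 'a
  have C1: "C1_pair UNIV u G"
    unfolding u_def[abs_def] G_def[abs_def] by (rule C1_pair_compose[OF quadratic_C1_pair dF cF])
  have sq: "0 + 1 * ((x - 0) \<bullet> (x - 0)) = (norm x)\<^sup>2" for x :: 'a by (simp add: power2_norm_eq_inner)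
  have F01: "0 \<le> F y" "F y \<le> 1" for y
    unfolding F_def by (auto intro!: power_le_one)
  have A1: "1 \<le> (A y)\<^sup>2" if "y \<le> 1" for y
    using that by (intro one_le_power) (simp add: A_def)
  have low: "F y = 0" "F' y = 0" if "y \<le> 1" for y
    using A1[OF that] by (auto simp: F_def F'_def)
  have high: "F y = 1" "F' y = 0" if "4 \<le> y" for y
  proof -
    have "A y = 0" using that by (simp add: A_def)
    then show "F y = 1" "F' y = 0" by (simp_all add: F_def F'_def)
  qed
  have F'b: "\<bar>F' y\<bar> \<le> 2" for y
  proof (cases "y \<le> 1")
    case True then show ?thesis using low by simp
  next
    case False
    then have A: "0 \<le> A y" "A y \<le> 1" by (auto simp: A_def)
    have "\<bar>2 * max 0 (1 - (A y)\<^sup>2)\<bar> \<le> 2" by (auto simp: max_def)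
    moreover have "\<bar>0 - (2 * A y) * (- 1 / 3)\<bar> \<le> 1" using A by simp
    ultimately have "\<bar>2 * max 0 (1 - (A y)\<^sup>2)\<bar> * \<bar>0 - (2 * A y) * (- 1 / 3)\<bar> \<le> 2 * 1" by (intro mult_mono) auto
    then show ?thesis unfolding F'_def abs_mult by simp
  qed
  have 1: "norm x powr a * \<bar>u x\<bar> \<le> 1" for x
  proof (cases "norm x \<le> 1")
    case True
    then have "(norm x)\<^sup>2 \<le> 1" by (intro power_le_one) auto
    then show ?thesis unfolding u_def sq by (simp add: low)
  next
    case False
    then have "norm x powr a \<le> norm x powr 0" using a by (intro powr_mono) auto
    also have "\<dots> = 1"
    proof -
      have "x \<noteq> 0" using False by auto
      then show ?thesis by simp
    qed
    finally have "norm x powr a * \<bar>u x\<bar> \<le> 1 * 1"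
      unfolding u_def sq using F01[of "(norm x)\<^sup>2"] by (intro mult_mono) auto
    then show ?thesis by simp
  qed
  let ?vol = "measure lborel (cball (0::'a) 2)"
  \<comment> \<open>The 8 is the bound 2 for F' times 2|x| <= 4.\<close>
  define K where "K = 2 powr \<bar>b\<bar> * 8 powr p * ?vol"
  have K0: "0 \<le> K" by (simp add: K_def)
  have 2: "(\<integral>\<^sup>+x. ennreal (norm x powr b * norm (G x) powr p) \<partial>lborel) \<le> ennreal K"
  proof -
    have G0: "G x = 0" if "x \<notin> {x. 1 \<le> norm x \<and> norm x \<le> 2}" for x
    proof -
      have "(norm x)\<^sup>2 \<le> 1 \<or> 4 \<le> (norm x)\<^sup>2"
      proof (cases "norm x \<le> 1")
        case True then show ?thesis by (intro disjI1 power_le_one) auto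
      next
        case False
        then have "2 \<le> norm x" using that by auto
        then have "2\<^sup>2 \<le> (norm x)\<^sup>2" by (intro power_mono) auto
        then show ?thesis by simp
      qed
      then have "F' ((norm x)\<^sup>2) = 0" using low high by blast
      then show ?thesis unfolding G_def sq by simp
    qed
    have "(\<integral>\<^sup>+x. ennreal (norm x powr b * norm (G x) powr p) \<partial>lborel)
      = (\<integral>\<^sup>+x. indicator {x. 1 \<le> norm x \<and> norm x \<le> 2} x * ennreal (norm x powr b * norm (G x) powr p) \<partial>lborel)"
    proof (rule nn_integral_cong)
      fix x :: 'a
      show "ennreal (norm x powr b * norm (G x) powr p) = indicator {x. 1 \<le> norm x \<and> norm x \<le> 2} x * ennreal (norm x powr b * norm (G x) powr p)"
        using G0[of x] by (cases "x \<in> {x. 1 \<le> norm x \<and> norm x \<le> 2}") auto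
    qed
    also have "\<dots> \<le> ennreal ((2 powr \<bar>b\<bar> * 8 powr p) * ?vol)"
    proof (rule emeasure_le_of_subset_cball)
      show "{x::'a. 1 \<le> norm x \<and> norm x \<le> 2} \<subseteq> cball 0 2" by auto
      fix x :: 'a assume "x \<in> {x. 1 \<le> norm x \<and> norm x \<le> 2}"
      then have x: "1 \<le> norm x" "norm x \<le> 2" by simp_all
      have "norm x powr b \<le> 2 powr \<bar>b\<bar> * 1 powr b" using x by (intro powr_abs_le_of_ratio) auto
      moreover have "norm (G x) \<le> 8"
      proof -
        have "norm (G x) = \<bar>F' ((norm x)\<^sup>2)\<bar> * (2 * norm x)" unfolding G_def sq by (simp add: abs_mult)
        also have "\<dots> \<le> 2 * (2 * 2)" using F'b x by (intro mult_mono) auto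
        finally show ?thesis by simp
      qed
      then have "norm (G x) powr p \<le> 8 powr p" using p by (intro powr_mono2) auto
      ultimately show "norm x powr b * norm (G x) powr p \<le> 2 powr \<bar>b\<bar> * 8 powr p" by (intro mult_mono) auto
    qed simp
    finally show ?thesis by (simp add: K_def)
  qed
  obtain C where "(\<integral>\<^sup>+x. ennreal (\<bar>u x\<bar> powr r) \<partial>lborel) \<le> ennreal C"
    using continuously_embedded_C1_bound[OF emb p r K0] C1 1 2 by blast
  moreover have "emeasure lborel (- cball (0::'a) 2) \<le> (\<integral>\<^sup>+x. ennreal (\<bar>u x\<bar> powr r) \<partial>lborel)"
  proof -
    have "emeasure lborel (- cball (0::'a) 2) = (\<integral>\<^sup>+x. indicator (- cball (0::'a) 2) x \<partial>lborel)" by simp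
    also have "\<dots> \<le> (\<integral>\<^sup>+x. ennreal (\<bar>u x\<bar> powr r) \<partial>lborel)"
    proof (rule nn_integral_mono)
      fix x :: 'a
      show "indicator (- cball 0 2) x \<le> ennreal (\<bar>u x\<bar> powr r)"
      proof (cases "x \<in> cball 0 2")
        case False
        then have "2\<^sup>2 \<le> (norm x)\<^sup>2" by (intro power_mono) auto
        then have "u x = 1" unfolding u_def sq by (simp add: high)
        then show ?thesis using False by simp
      qed simp
    qed
    finally show ?thesis .
  qed
  ultimately have "emeasure lborel (- cball (0::'a) 2) < top" by (meson ennreal_less_top le_less_trans)
  moreover have "emeasure lborel (cball (0::'a) 2) < \<infinity>" by (rule emeasure_bounded_finite) simp
  moreover have "emeasure lborel (UNIV :: 'a set) \<le> emeasure lborel (cball (0::'a) 2) + emeasure lborel (- cball (0::'a) 2)"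
    using emeasure_subadditive[of "cball (0::'a) 2" lborel "- cball 0 2"] by simp
  ultimately show False by (auto simp: top_unique)
qed

text \<open>In reciprocals the condition needs no case distinction: for p >= N the left-hand side is
  nonpositive and the inequality holds for every r.\<close>

lemma sobolev_exponent_le_iff:
  fixes N :: nat and p r :: real
  assumes "1 \<le> N" "1 \<le> p" "1 \<le> r"
  shows "ereal r \<le> sobolev_exponent N p \<longleftrightarrow> 1 / p - 1 / real N \<le> 1 / r"
proof (cases "p \<ge> real N")
  case True
  then have "1 / p \<le> 1 / real N" using assms by (intro divide_left_mono) auto
  moreover have "0 \<le> 1 / r" using assms by simp
  ultimately have "1 / p - 1 / real N \<le> 1 / r" by linarith
  then show ?thesis using True by (simp add: sobolev_exponent_def)
next
  case False
  have e: "1 / p - 1 / real N = (real N - p) / (real N * p)" using assms by (simp add: field_simps)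
  have "ereal r \<le> sobolev_exponent N p \<longleftrightarrow> r \<le> real N * p / (real N - p)"
    using False by (simp add: sobolev_exponent_def)
  also have "\<dots> \<longleftrightarrow> r * (real N - p) \<le> real N * p" using False by (simp add: pos_le_divide_eq)
  also have "\<dots> \<longleftrightarrow> (real N - p) / (real N * p) \<le> 1 / r"
  proof -
    have "0 < real N * p" "0 < r" using assms by auto
    then show ?thesis by (simp add: pos_divide_le_eq pos_le_divide_eq mult.commute)
  qed
  finally show ?thesis unfolding e .
qed

theorem theorem8p1:
  fixes a b p r :: real and N :: nat
  assumes "N = DIM('a::euclidean_space)" and "1 \<le> p" and "1 \<le> r"
  shows "continuously_embedded
           (W_space a b p :: ('a \<Rightarrow> real) set) (W_norm a b p) (Lp_space r) (Lp_norm r)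
     \<longleftrightarrow>
     a > 0 \<and>
     ((r < p \<and>
        ((a < N / r \<and> b > N * p * (1 / N + 1 / r - 1 / p)) \<or>
         (a > N / r \<and> b < N * p * (1 / N + 1 / r - 1 / p)))) \<or>
      (p \<le> r \<and> ereal r \<le> sobolev_exponent N p \<and>
        ((a < N / r \<and> b \<ge> N * p * (1 / N + 1 / r - 1 / p)) \<or>
         (a > N / r \<and> b \<le> N * p * (1 / N + 1 / r - 1 / p)) \<or>
         (a = N / r \<and> b = N * p * (1 / N + 1 / r - 1 / p)))) \<or>
      (p < N \<and> ereal r > sobolev_exponent N p \<and>
        ((a < N / r \<and> b \<ge> a * r * p * (1 / N + 1 / r - 1 / p)) \<or>
         (a > N / r \<and> b \<le> a * r * p * (1 / N + 1 / r - 1 / p)) \<or>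
         (a = N / r \<and> b = a * r * p * (1 / N + 1 / r - 1 / p) \<and>
            a * r * p * (1 / N + 1 / r - 1 / p) = N * p * (1 / N + 1 / r - 1 / p)))))"
proof -
  let ?X = "1 / real N + 1 / r - 1 / p"
  let ?emb = "continuously_embedded (W_space a b p :: ('a \<Rightarrow> real) set) (W_norm a b p) (Lp_space r) (Lp_norm r)"
  let ?ub = "uniformly_bounded TYPE('a) a b p r"
  have ND: "real DIM('a) = real N" using assms(1) by simp
  have N1: "1 \<le> N" using assms(1) by simp
  note p = assms(2) and r = assms(3)
  have outer: ?emb if "?ub {x. norm x > 1}" "a < N / r"
    using continuously_embedded_of_uniformly_bounded[OF uniformly_bounded_of_outer[OF that(1)] p r] that(2) r ND by simp
  have inner: ?emb if "?ub {x. 0 < norm x \<and> norm x < 1}" "a > N / r"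
    using continuously_embedded_of_uniformly_bounded[OF uniformly_bounded_of_inner[OF that(1)] p r] that(2) r ND by simp
  \<comment> \<open>The third alternative asks nothing of a beyond positivity, and thereby covers
    the borderline a = N/r of both ranges.\<close>
  have critical: ?emb
    if cs: "critical_scheme (real N) a b0 p r q c" and a: "a > 0"
      and b: "a < N / r \<and> b \<ge> b0 \<or> a > N / r \<and> b \<le> b0 \<or> b = b0" for b0 q c
  proof -
    note cs' = critical_scheme_bounded[OF cs[folded ND] p a]
    from b consider "a < N / r" "b0 \<le> b" | "a > N / r" "b \<le> b0" | "b = b0" by blast
    then show ?emb
    proof cases
      case 1 then show ?thesis using outer cs'(1) by simp
    next
      case 2 then show ?thesis using inner cs'(2) by simp
    next
      case 3 show ?thesis
        by (rule continuously_embedded_of_uniformly_bounded[OF cs'(3)[OF 3] p r])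
    qed
  qed
  have se: "ereal r \<le> sobolev_exponent N p \<longleftrightarrow> 1 / p - 1 / real N \<le> 1 / r"
    by (rule sobolev_exponent_le_iff[OF N1 p r])
  have strict: ?emb if "r < p" "a > 0"
    "a < N / r \<and> b > N * p * ?X \<or> a > N / r \<and> b < N * p * ?X"
    using that(3)
  proof
    assume "a < N / r \<and> b > N * p * ?X"
    then show ?emb using outer strict_scheme_bounded(1)[where 'a='a, OF r that(1,2), of b] ND by simp
  next
    assume "a > N / r \<and> b < N * p * ?X"
    then show ?emb using inner strict_scheme_bounded(2)[where 'a='a, OF r that(1,2), of b] ND by simp
  qed
  have sub: ?emb if "p \<le> r" "ereal r \<le> sobolev_exponent N p" "a > 0"
    "a < N / r \<and> b \<ge> N * p * ?X \<or> a > N / r \<and> b \<le> N * p * ?X \<or> b = N * p * ?X"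
  proof (rule critical[OF critical_scheme_subcritical])
    show "1 \<le> real N" using N1 by simp
    show "1 / p - 1 / real N \<le> 1 / r" using that(2) se by simp
  qed (use p that in auto)
  have super: ?emb if "p < N" "ereal r > sobolev_exponent N p" "a > 0"
    "a < N / r \<and> b \<ge> a * r * p * ?X \<or> a > N / r \<and> b \<le> a * r * p * ?X \<or> b = a * r * p * ?X"
  proof (rule critical[OF critical_scheme_supercritical])
    show "1 < real N" using that(1) p by linarith
    show "1 / r < 1 / p - 1 / real N" using that(2) se by (simp add: not_le[symmetric])
  qed (use p r that in auto)
  show ?thesis (is "_ \<longleftrightarrow> ?R")
  proof
    assume ?R
    then show ?emb using strict sub super by blast
  next
    assume emb: ?emb
    have a0: "a > 0" by (rule embedding_necessary_positive[OF emb p r])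
    have crit1: "b \<ge> N * p * ?X \<and> \<not> (b = N * p * ?X \<and> r < p)" if "a \<le> N / r"
      using embedding_necessary_critical[OF emb p r, of 1] that unfolding ND by auto
    have crit2: "b \<le> N * p * ?X \<and> \<not> (b = N * p * ?X \<and> r < p)" if "a \<ge> N / r"
      using embedding_necessary_critical[OF emb p r, of "-1"] that unfolding ND by auto
    have conc1: "b \<ge> a * r * p * ?X" if "a \<le> N / r"
      using embedding_necessary_concentration[OF emb p r, of 1] that unfolding ND by auto
    have conc2: "b \<le> a * r * p * ?X" if "a \<ge> N / r"
      using embedding_necessary_concentration[OF emb p r, of "-1"] that unfolding ND by auto
    have pN: "p < N" if "ereal r > sobolev_exponent N p"
      using that by (simp add: sobolev_exponent_def split: if_splits)
    have small: "ereal r \<le> sobolev_exponent N p" if "r < p"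
    proof -
      have "1 / p \<le> 1 / r" using that r by (simp add: frac_le)
      moreover have "0 \<le> 1 / real N" by simp
      ultimately show ?thesis unfolding se by linarith
    qed
    consider "r < p" | "p \<le> r" "ereal r \<le> sobolev_exponent N p"
      | "p \<le> r" "ereal r > sobolev_exponent N p"
      using leI[of r p] leI[of "sobolev_exponent N p" "ereal r"] by blast
    then show ?R
    proof cases
      case 1
      \<comment> \<open>At a = N/r both families of shells apply and squeeze b to the critical
        value, which r < p excludes.\<close>
      then have "a \<noteq> N / r" using crit1 crit2 by force
      then consider "a < N / r" | "a > N / r" by linarith
      then show ?thesis
      proof cases
        case 1
        with \<open>r < p\<close> crit1 have "b > N * p * ?X" by force
        with \<open>r < p\<close> 1 a0 show ?thesis by blast
      next
        case 2
        with \<open>r < p\<close> crit2 have "b < N * p * ?X" by force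
        with \<open>r < p\<close> 2 a0 show ?thesis by blast
      qed
    next
      case 2
      consider "a < N / r" | "a > N / r" | "a = N / r" by linarith
      then have "a < N / r \<and> b \<ge> N * p * ?X \<or> a > N / r \<and> b \<le> N * p * ?X \<or> a = N / r \<and> b = N * p * ?X"
        using crit1 crit2 by cases (auto intro: antisym)
      with 2 a0 show ?thesis by blast
    next
      case 3
      \<comment> \<open>Here a r = N, so the exponents from concentration and from scaling
        coincide.\<close>
      have eq: "a * r * p * ?X = N * p * ?X" if "a = N / r" using that r by simp
      consider "a < N / r" | "a > N / r" | "a = N / r" by linarith
      then have "a < N / r \<and> b \<ge> a * r * p * ?X \<or> a > N / r \<and> b \<le> a * r * p * ?X \<or>
          a = N / r \<and> b = a * r * p * ?X \<and> a * r * p * ?X = N * p * ?X"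
      proof cases
        case 1 then show ?thesis using conc1 by simp
      next
        case 2 then show ?thesis using conc2 by simp
      next
        case 3
        then have "a \<le> N / r" "a \<ge> N / r" by simp_all
        then show ?thesis using 3 antisym[OF conc2 conc1] eq by blast
      qed
      with 3 pN a0 show ?thesis by blast
    qed
  qed
qed

end
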